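(* Let $N\ge1$ and $d\ge2$. The ring of regular functions $\mathbb{Q}[\mathrm{Hom}_d^N]$ of the affine variety $\mathrm{Hom}_d^N$ is given explicitly by $$\mathbb{Q}[\mathrm{Hom}_d^N]=\mathbb{Q}\left[\frac{\prod_{i,j}a_{ij}^{e_{ij}}}{\rho}\;:\;e_{ij}\in\mathbb{Z}_{\ge0},\ \sum_{i,j}e_{ij}=(N+1)d^N\right].$$ Furthermore, $\mathbb{Q}[\mathcal{M}_d^N]=\mathbb{Q}[\mathrm{Hom}_d^N]^{\mathrm{SL}_{N+1}}$.
   Context: Let $M=\binom{N+d}{N}$ be the number of monomials of degree $d$ in $x_0,\ldots,x_N$. For indeterminates $a_{ij}$ ($0\le i\le N$, with $j$ indexing the $M$ monomials of degree $d$), let $f_{gen}=[f_0,\ldots,f_N]$ be the generic tuple, where $f_i=\sum_j a_{ij}m_j$ and $m_j$ runs over these monomials; thus the $a_{ij}$ are homogeneous coordinates on $\mathbb{P}^{(N+1)M-1}$. Let $\rho=\mathrm{Res}(f_0,\ldots,f_N)\in\mathbb{Z}[a_{ij}]$ be the Macaulay resultant. $\mathrm{Hom}_d^N$, the variety of degree $d$ endomorphisms of $\mathbb{P}^N$, is the open subset $\{\rho\ne0\}$ of $\mathbb{P}^{(N+1)M-1}$, considered over $\mathbb{Q}$. $\mathrm{PGL}_{N+1}$ acts on it by conjugation $f^\alpha=\alpha^{-1}\circ f\circ\alpha$, which lifts to an action of $\mathrm{SL}_{N+1}$, and $\mathcal{M}_d^N=\mathrm{Hom}_d^N/\mathrm{PGL}_{N+1}$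 is the geometric quotient (known to exist). $\mathbb{Q}[X]$ denotes the ring of regular functions on $X$; the superscript $\mathrm{SL}_{N+1}$ denotes the subring of invariants. *)

theory Defs
  imports
    "HOL-Library.Poly_Mapping"
    "HOL-Computational_Algebra.Factorial_Ring"
    "HOL-Algebra.Generated_Rings"
    "HOL-Analysis.Abstract_Topology"
    "Jordan_Normal_Form.Determinant"
    "Jordan_Normal_Form.Gauss_Jordan_Elimination"
begin

section \<open>Polynomials\<close>

text \<open>A monomial is a finitely supported exponent function, a polynomial a finitely supported
  function from monomials to coefficients.\<close>

type_synonym 'v monomial = "'v \<Rightarrow>\<^sub>0 nat"
type_synonym ('v, 'c) mpoly = "'v monomial \<Rightarrow>\<^sub>0 'c"

definition mdeg :: "'v monomial \<Rightarrow> nat" where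
  "mdeg m = (\<Sum>v\<in>Poly_Mapping.keys m. Poly_Mapping.lookup m v)"

definition mono_eval :: "'v monomial \<Rightarrow> ('v \<Rightarrow> 'b) \<Rightarrow> 'b::comm_semiring_1" where
  "mono_eval m x = (\<Prod>v\<in>Poly_Mapping.keys m. x v ^ Poly_Mapping.lookup m v)"

text \<open>Evaluation at \<open>x\<close> after mapping the coefficients by \<open>h\<close>. With \<open>h = single 0\<close> (the constant
  polynomials) and polynomial values \<open>x\<close> this is substitution.\<close>

definition mpeval :: "('c::zero \<Rightarrow> 'b) \<Rightarrow> ('v, 'c) mpoly \<Rightarrow> ('v \<Rightarrow> 'b) \<Rightarrow> 'b::comm_semiring_1" where
  "mpeval h p x = (\<Sum>m\<in>Poly_Mapping.keys p. h (Poly_Mapping.lookup p m) * mono_eval m x)"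

definition polys_in :: "'v set \<Rightarrow> ('v, 'c::zero) mpoly set" where
  "polys_in I = {p. \<forall>m\<in>Poly_Mapping.keys p. Poly_Mapping.keys m \<subseteq> I}"

definition forms_in :: "'v set \<Rightarrow> nat \<Rightarrow> ('v, 'c::zero) mpoly set" where
  "forms_in I n = {p \<in> polys_in I. \<forall>m\<in>Poly_Mapping.keys p. mdeg m = n}"

definition coord_space :: "'v set \<Rightarrow> ('v \<Rightarrow> complex) set" where
  "coord_space I = {x. \<forall>v. v \<notin> I \<longrightarrow> x v = 0}"

section \<open>Varieties over the rationals as spaces with functions\<close>

text \<open>A variety over \<open>\<rat>\<close> is represented by its complex points, with the Zariski topology whose
  closed sets are cut out by polynomials with rational coefficients, and with the sheaf of
  those complex-valued functions that are locally quotients of polynomials with rational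
  coefficients. Functions on \<open>V\<close> are made unique by being \<open>undefined\<close> off \<open>V\<close>; the field
  \<open>regular\<close> is only meaningful on open sets.\<close>

record 'p fspace =
  zar :: "'p topology"
  regular :: "'p set \<Rightarrow> ('p \<Rightarrow> complex) set"

abbreviation points :: "'p fspace \<Rightarrow> 'p set" where
  "points X \<equiv> topspace (zar X)"

definition open_subspace :: "'p fspace \<Rightarrow> 'p set \<Rightarrow> 'p fspace" where
  "open_subspace X U = \<lparr>zar = subtopology (zar X) U, regular = regular X\<rparr>"

definition preim :: "'p fspace \<Rightarrow> ('p \<Rightarrow> 'q) \<Rightarrow> 'q set \<Rightarrow> 'p set" where
  "preim X \<phi> V = {x \<in> points X. \<phi> x \<in> V}"

definition pullback :: "'p fspace \<Rightarrow> ('p \<Rightarrow> 'q) \<Rightarrow> 'q set \<Rightarrow> ('q \<Rightarrow> complex) \<Rightarrow> 'p \<Rightarrow> complex" where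
  "pullback X \<phi> V h = restrict (h \<circ> \<phi>) (preim X \<phi> V)"

definition fspace_iso :: "'p fspace \<Rightarrow> 'q fspace \<Rightarrow> ('p \<Rightarrow> 'q) \<Rightarrow> bool" where
  "fspace_iso X Y \<phi> \<longleftrightarrow> homeomorphic_map (zar X) (zar Y) \<phi> \<and>
    (\<forall>V. openin (zar Y) V \<longrightarrow>
       bij_betw (pullback X \<phi> V) (regular Y V) (regular X (preim X \<phi> V)))"

definition is_function_sheaf :: "'p fspace \<Rightarrow> bool" where
  "is_function_sheaf X \<longleftrightarrow> (\<forall>V f. openin (zar X) V \<longrightarrow>
    (f \<in> regular X V \<longleftrightarrow> f \<in> extensional V \<and>
      (\<forall>p\<in>V. \<exists>W. openin (zar X) W \<and> p \<in> W \<and> W \<subseteq> V \<and> restrict f W \<in> regular X W)))"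

subsection \<open>Affine varieties\<close>

definition zero_locus :: "nat \<Rightarrow> (nat, rat) mpoly set \<Rightarrow> (nat \<Rightarrow> complex) set" where
  "zero_locus n S = {x \<in> coord_space {..<n}. \<forall>F\<in>S. mpeval of_rat F x = 0}"

definition affine_zar :: "nat \<Rightarrow> (nat, rat) mpoly set \<Rightarrow> (nat \<Rightarrow> complex) topology" where
  "affine_zar n S = topology_generated_by
     {{x \<in> zero_locus n S. mpeval of_rat F x \<noteq> 0} | F. F \<in> polys_in {..<n}}"

definition affine_variety :: "nat \<Rightarrow> (nat, rat) mpoly set \<Rightarrow> (nat \<Rightarrow> complex) fspace" where
  "affine_variety n S = \<lparr>zar = affine_zar n S,
     regular = (\<lambda>V. {f \<in> extensional V. \<forall>x\<in>V. \<exists>W F G.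
       openin (affine_zar n S) W \<and> x \<in> W \<and> W \<subseteq> V \<and> F \<in> polys_in {..<n} \<and> G \<in> polys_in {..<n} \<and>
       (\<forall>y\<in>W. mpeval of_rat G y \<noteq> 0 \<and> f y = mpeval of_rat F y / mpeval of_rat G y)})\<rparr>"

definition prevariety :: "'p fspace \<Rightarrow> bool" where
  "prevariety X \<longleftrightarrow> is_function_sheaf X \<and>
    (\<exists>\<U>. finite \<U> \<and> \<Union>\<U> = points X \<and>
      (\<forall>U\<in>\<U>. openin (zar X) U \<and>
        (\<exists>n S \<phi>. S \<subseteq> polys_in {..<n} \<and> fspace_iso (open_subspace X U) (affine_variety n S) \<phi>)))"

subsection \<open>Projective space\<close>

text \<open>Projective space with homogeneous coordinates indexed by a finite set \<open>I\<close>; a point is the set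
  of all its homogeneous coordinate vectors.\<close>

definition proj_point :: "('v \<Rightarrow> complex) \<Rightarrow> ('v \<Rightarrow> complex) set" where
  "proj_point x = {(\<lambda>v. c * x v) | c. c \<noteq> 0}"

definition proj_points :: "'v set \<Rightarrow> ('v \<Rightarrow> complex) set set" where
  "proj_points I = proj_point ` (coord_space I - {\<lambda>_. 0})"

definition proj_zar :: "'v set \<Rightarrow> ('v \<Rightarrow> complex) set topology" where
  "proj_zar I = topology_generated_by
     {{P \<in> proj_points I. \<forall>x\<in>P. mpeval of_rat F x \<noteq> 0} | F :: ('v, rat) mpoly. \<exists>n. F \<in> forms_in I n}"

definition proj_space :: "'v set \<Rightarrow> ('v \<Rightarrow> complex) set fspace" where
  "proj_space I = \<lparr>zar = proj_zar I,
     regular = (\<lambda>V. {f \<in> extensional V. \<forall>P\<in>V. \<exists>W n (F :: ('v, rat) mpoly) G.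
       openin (proj_zar I) W \<and> P \<in> W \<and> W \<subseteq> V \<and> F \<in> forms_in I n \<and> G \<in> forms_in I n \<and>
       (\<forall>Q\<in>W. \<forall>x\<in>Q. mpeval of_rat G x \<noteq> 0 \<and> f Q = mpeval of_rat F x / mpeval of_rat G x)})\<rparr>"

subsection \<open>Rings of functions\<close>

definition fun_ring :: "'p set \<Rightarrow> ('p \<Rightarrow> complex) ring" where
  "fun_ring S = \<lparr>carrier = extensional S,
     monoid.mult = (\<lambda>f g. \<lambda>p\<in>S. f p * g p), monoid.one = (\<lambda>p\<in>S. 1),
     ring.zero = (\<lambda>p\<in>S. 0), ring.add = (\<lambda>f g. \<lambda>p\<in>S. f p + g p)\<rparr>"

definition coord_ring :: "'p fspace \<Rightarrow> ('p \<Rightarrow> complex) ring" where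
  "coord_ring X = (fun_ring (points X))\<lparr>carrier := regular X (points X)\<rparr>"

definition rat_subalgebra :: "'p set \<Rightarrow> ('p \<Rightarrow> complex) set \<Rightarrow> ('p \<Rightarrow> complex) ring" where
  "rat_subalgebra S H = (fun_ring S)\<lparr>carrier :=
     generate_ring (fun_ring S) ({(\<lambda>p\<in>S. of_rat q) | q. True} \<union> H)\<rparr>"

definition invariants :: "'g set \<Rightarrow> ('g \<Rightarrow> 'p \<Rightarrow> 'p) \<Rightarrow> 'p set \<Rightarrow> ('p \<Rightarrow> complex) set" where
  "invariants G act U = {f. \<forall>g\<in>G. \<forall>x\<in>U. f (act g x) = f x}"

definition invariant_ring ::
  "'g set \<Rightarrow> ('g \<Rightarrow> 'p \<Rightarrow> 'p) \<Rightarrow> 'p fspace \<Rightarrow> ('p \<Rightarrow> complex) ring" where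
  "invariant_ring G act X = (fun_ring (points X))\<lparr>carrier :=
     regular X (points X) \<inter> invariants G act (points X)\<rparr>"

subsection \<open>Geometric quotients\<close>

text \<open>Mumford's definition: \<open>\<pi>\<close> is surjective with the orbits (of geometric points) as its
  fibres, it is submersive, and the functions on \<open>Y\<close> are the invariant functions on \<open>X\<close>.
  Surjectivity and submersiveness together are \<open>quotient_map\<close>; that \<open>\<pi>\<close> is a morphism
  follows from the last clause.\<close>

definition geometric_quotient ::
  "'g set \<Rightarrow> ('g \<Rightarrow> 'p \<Rightarrow> 'p) \<Rightarrow> 'p fspace \<Rightarrow> 'q fspace \<Rightarrow> ('p \<Rightarrow> 'q) \<Rightarrow> bool" where
  "geometric_quotient G act X Y \<pi> \<longleftrightarrow>
     prevariety Y \<and>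
     quotient_map (zar X) (zar Y) \<pi> \<and>
     (\<forall>x\<in>points X. preim X \<pi> {\<pi> x} = {act g x | g. g \<in> G}) \<and>
     (\<forall>V. openin (zar Y) V \<longrightarrow>
        bij_betw (pullback X \<pi> V) (regular Y V)
          (regular X (preim X \<pi> V) \<inter> invariants G act (preim X \<pi> V)))"

section \<open>Endomorphisms of projective space\<close>

definition monomials :: "nat \<Rightarrow> nat \<Rightarrow> nat monomial set" where
  "monomials N d = {m. Poly_Mapping.keys m \<subseteq> {..N} \<and> mdeg m = d}"

text \<open>The coefficient \<open>a\<^sub>i\<^sub>j\<close> is indexed by \<open>i\<close> and the \<open>j\<close>-th monomial itself.\<close>

type_synonym coeff_ix = "nat \<times> nat monomial"

definition coeff_index :: "nat \<Rightarrow> nat \<Rightarrow> coeff_ix set" where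
  "coeff_index N d = {..N} \<times> monomials N d"

definition tuple_form :: "nat \<Rightarrow> nat \<Rightarrow> (coeff_ix \<Rightarrow> complex) \<Rightarrow> nat \<Rightarrow> (nat, complex) mpoly" where
  "tuple_form N d a i = (\<Sum>m\<in>monomials N d. Poly_Mapping.single m (a (i, m)))"

subsection \<open>The Macaulay resultant\<close>

text \<open>The resultant is the unique irreducible polynomial with integer coefficients in the
  \<open>a\<^sub>i\<^sub>j\<close> that vanishes exactly at the tuples of forms with a nontrivial common zero, with the sign
  fixed by \<open>Res(x\<^sub>0\<^sup>d, \<dots>, x\<^sub>N\<^sup>d) = 1\<close>.
  Irreducibility in the ambient type, which has more variables, agrees with
  irreducibility in \<open>\<int>[a\<^sub>i\<^sub>j]\<close>.\<close>

definition power_tuple :: "nat \<Rightarrow> nat \<Rightarrow> coeff_ix \<Rightarrow> complex" where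
  "power_tuple N d = (\<lambda>(i, m). if i \<le> N \<and> m = Poly_Mapping.single i d then 1 else 0)"

definition macaulay_resultant :: "nat \<Rightarrow> nat \<Rightarrow> (coeff_ix, int) mpoly \<Rightarrow> bool" where
  "macaulay_resultant N d \<rho> \<longleftrightarrow>
     \<rho> \<in> polys_in (coeff_index N d) \<and>
     Factorial_Ring.irreducible \<rho> \<and>
     (\<forall>a\<in>coord_space (coeff_index N d). mpeval of_int \<rho> a = (0::complex) \<longleftrightarrow>
        (\<exists>x\<in>coord_space {..N}. x \<noteq> (\<lambda>_. 0) \<and> (\<forall>i\<le>N. mpeval id (tuple_form N d a i) x = 0))) \<and>
     mpeval of_int \<rho> (power_tuple N d) = (1::complex)"

subsection \<open>The variety \<open>Hom\<close>\<close>

definition Hom_space :: "nat \<Rightarrow> nat \<Rightarrow> (coeff_ix, int) mpoly \<Rightarrow> (coeff_ix \<Rightarrow> complex) set fspace" where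
  "Hom_space N d \<rho> = open_subspace (proj_space (coeff_index N d))
     {P \<in> proj_points (coeff_index N d). \<forall>a\<in>P. mpeval of_int \<rho> a \<noteq> 0}"

text \<open>The function \<open>\<Prod> a\<^sub>i\<^sub>j\<^bsup>e\<^sub>i\<^sub>j\<^esup> / \<rho>\<close>, computed on any homogeneous coordinate vector.\<close>

definition mono_over_res ::
  "nat \<Rightarrow> nat \<Rightarrow> (coeff_ix, int) mpoly \<Rightarrow> coeff_ix monomial \<Rightarrow> (coeff_ix \<Rightarrow> complex) set \<Rightarrow> complex" where
  "mono_over_res N d \<rho> e =
     (\<lambda>P \<in> points (Hom_space N d \<rho>). the_elem ((\<lambda>a. mono_eval e a / mpeval of_int \<rho> a) ` P))"

subsection \<open>Conjugation\<close>

text \<open>The coefficients of \<open>\<alpha>\<^sup>-\<^sup>1 \<circ> f \<circ> \<alpha>\<close> for an invertible matrix \<open>\<alpha>\<close> acting on column vectors.\<close>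

definition linear_tuple :: "nat \<Rightarrow> complex mat \<Rightarrow> nat \<Rightarrow> (nat, complex) mpoly" where
  "linear_tuple N \<alpha> l = (\<Sum>j\<le>N. Poly_Mapping.single (Poly_Mapping.single j 1) (\<alpha> $$ (l, j)))"

definition conj_form ::
  "nat \<Rightarrow> nat \<Rightarrow> complex mat \<Rightarrow> (coeff_ix \<Rightarrow> complex) \<Rightarrow> nat \<Rightarrow> (nat, complex) mpoly" where
  "conj_form N d \<alpha> a i = (\<Sum>k\<le>N. Poly_Mapping.single 0 (the (mat_inverse \<alpha>) $$ (i, k)) *
     mpeval (Poly_Mapping.single 0) (tuple_form N d a k) (linear_tuple N \<alpha>))"

definition conj_tuple ::
  "nat \<Rightarrow> nat \<Rightarrow> complex mat \<Rightarrow> (coeff_ix \<Rightarrow> complex) \<Rightarrow> coeff_ix \<Rightarrow> complex" where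
  "conj_tuple N d \<alpha> a = (\<lambda>(i, m).
     if (i, m) \<in> coeff_index N d then Poly_Mapping.lookup (conj_form N d \<alpha> a i) m else 0)"

definition GL :: "nat \<Rightarrow> complex mat set" where
  "GL n = {\<alpha> \<in> carrier_mat n n. invertible_mat \<alpha>}"

definition SL :: "nat \<Rightarrow> complex mat set" where
  "SL n = {\<alpha> \<in> carrier_mat n n. det \<alpha> = 1}"

definition PGL :: "nat \<Rightarrow> complex mat set set" where
  "PGL n = (\<lambda>\<alpha>. {c \<cdot>\<^sub>m \<alpha> | c. c \<noteq> 0}) ` GL n"

text \<open>Conjugation is linear in the coefficients, so the image of a projective point is again a
  projective point. Rescaling \<open>\<alpha>\<close> rescales the conjugated tuple, so in the action of
  \<open>PGL\<close> every matrix of the class contributes the same projective point to the union.\<close>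

definition SL_act ::
  "nat \<Rightarrow> nat \<Rightarrow> complex mat \<Rightarrow> (coeff_ix \<Rightarrow> complex) set \<Rightarrow> (coeff_ix \<Rightarrow> complex) set" where
  "SL_act N d \<alpha> P = conj_tuple N d \<alpha> ` P"

definition PGL_act ::
  "nat \<Rightarrow> nat \<Rightarrow> complex mat set \<Rightarrow> (coeff_ix \<Rightarrow> complex) set \<Rightarrow> (coeff_ix \<Rightarrow> complex) set" where
  "PGL_act N d g P = (\<Union>\<alpha>\<in>g. conj_tuple N d \<alpha> ` P)"

end

theory Submission
  imports
    Defs
    "HOL-Library.Product_Lexorder"
    "HOL-Computational_Algebra.Fundamental_Theorem_Algebra"
    "Jordan_Normal_Form.Char_Poly"
begin

text \<open>
  Write \<open>D = (N + 1) * d ^ N\<close>. The first claim rests on two facts: a regular function on the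
  complement of the hypersurface \<open>\<rho> = 0\<close> is a single quotient \<open>F / (c * \<rho> ^ k)\<close> of forms, and
  \<open>\<rho>\<close> is a form of degree \<open>D\<close>. Then \<open>F\<close> has degree \<open>k * D\<close>, every monomial of degree \<open>k * D\<close> is a
  product of \<open>k\<close> monomials of degree \<open>D\<close>, and so \<open>F / (c * \<rho> ^ k)\<close> is a polynomial in the functions
  \<open>m / \<rho>\<close> with rational coefficients (\<open>regular_hypersurface_complement\<close>).

  For the single quotient, choose among all local representations \<open>F / G\<close> of the function one
  whose denominator \<open>G\<close> has no proper divisor that is also a denominator. Any two representations
  satisfy \<open>F * G' = F' * G\<close>, so an irreducible factor \<open>q\<close> of \<open>G\<close>, not being cancellable against \<open>F\<close>,
  divides every local denominator \<open>G'\<close>; as near each point some \<open>G'\<close> is nonzero, \<open>q\<close> has no zero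
  with \<open>\<rho> \<noteq> 0\<close>. By the Nullstellensatz for hypersurfaces (\<open>hypersurface_nullstellensatz\<close>) \<open>q\<close> is a
  constant or a divisor of \<open>\<rho>\<close>, so \<open>G = c * \<rho> ^ k\<close> (\<open>regular_global_quotient\<close>). This argument, and the
  one for the degree, take place in the factorial ring of integral polynomials, where irreducible
  elements are prime (\<open>irreducible_imp_prime_elem_mpoly\<close>).

  The degree of \<open>\<rho>\<close> has to be derived from its zero set and its irreducibility, and is found
  separately in each block of variables, the coefficients of one \<open>f\<^sub>i\<close>. Macaulay's determinant, with
  rows arranged so that \<open>f\<^sub>i\<close> is used as rarely as possible, vanishes wherever \<open>\<rho>\<close> does and has degree
  at most \<open>d ^ N\<close> in the \<open>i\<close>-th block (\<open>macaulay_determinant\<close>). By the Nullstellensatz \<open>\<rho>\<close> divides it.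
  As it is homogeneous in each block, so is \<open>\<rho>\<close>, of degree at most \<open>d ^ N\<close> in the \<open>i\<close>-th. Conversely, on a
  suitable line in the space of tuples along which only the \<open>i\<close>-th form varies, \<open>\<rho>\<close> is not
  identically zero but has \<open>d ^ N\<close> roots (\<open>res_leading_degree_ge\<close>). Hence the degree in each of the
  \<open>N + 1\<close> blocks is \<open>d ^ N\<close> (\<open>resultant_degree\<close>).

  For the second claim, the functions on a geometric quotient are by definition the \<open>PGL\<close>-invariant
  regular functions. Rescaling a matrix rescales the conjugated tuple, so a class in \<open>PGL\<close> moves a
  projective point as each of its representatives does; over the complex numbers one of these has
  determinant \<open>1\<close>. So \<open>PGL\<close> and \<open>SL\<close> have the same invariants
  (\<open>PGL_invariants_eq_SL_invariants\<close>).
\<close>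

section \<open>Evaluation of multivariate polynomials\<close>

definition Var :: "'v \<Rightarrow> ('v, 'c::zero_neq_one) mpoly" where
  "Var v = Poly_Mapping.single (Poly_Mapping.single v 1) 1"

abbreviation Const :: "'c::zero \<Rightarrow> ('v, 'c) mpoly" where
  "Const \<equiv> Poly_Mapping.single 0"

definition wdeg :: "('v \<Rightarrow> nat) \<Rightarrow> 'v monomial \<Rightarrow> nat" where
  "wdeg w m = (\<Sum>v\<in>Poly_Mapping.keys m. w v * Poly_Mapping.lookup m v)"

lemma sum_keys_superset:
  assumes "finite A" "Poly_Mapping.keys m \<subseteq> A" "\<And>v. g v 0 = 0"
  shows "(\<Sum>v\<in>Poly_Mapping.keys m. g v (Poly_Mapping.lookup m v)) = (\<Sum>v\<in>A. g v (Poly_Mapping.lookup m v))"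
  using assms by (intro sum.mono_neutral_left) (auto simp: in_keys_iff)

lemma wdeg_superset:
  assumes "finite A" "Poly_Mapping.keys m \<subseteq> A"
  shows "wdeg w m = (\<Sum>v\<in>A. w v * Poly_Mapping.lookup m v)"
  unfolding wdeg_def using assms by (rule sum_keys_superset) simp

lemma wdeg_add: "wdeg w (m + m') = wdeg w m + wdeg w m'"
proof -
  let ?A = "Poly_Mapping.keys m \<union> Poly_Mapping.keys m'"
  have "wdeg w (m + m') = (\<Sum>v\<in>?A. w v * Poly_Mapping.lookup (m + m') v)"
    by (rule wdeg_superset) (auto dest: subsetD[OF Poly_Mapping.keys_add])
  moreover have "wdeg w m = (\<Sum>v\<in>?A. w v * Poly_Mapping.lookup m v)"
    by (rule wdeg_superset) auto
  moreover have "wdeg w m' = (\<Sum>v\<in>?A. w v * Poly_Mapping.lookup m' v)"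
    by (rule wdeg_superset) auto
  ultimately show ?thesis by (simp add: lookup_add algebra_simps sum.distrib)
qed

lemma wdeg_0 [simp]: "wdeg w 0 = 0"
  by (simp add: wdeg_def)

lemma wdeg_single [simp]: "wdeg w (Poly_Mapping.single v n) = w v * n"
  by (simp add: wdeg_def)

lemma mdeg_eq_wdeg: "mdeg m = wdeg (\<lambda>_. 1) m"
  by (simp add: mdeg_def wdeg_def)

lemma mono_eval_superset:
  assumes "finite A" "Poly_Mapping.keys m \<subseteq> A"
  shows "mono_eval m x = (\<Prod>v\<in>A. x v ^ Poly_Mapping.lookup m v)"
  unfolding mono_eval_def using assms
  by (intro prod.mono_neutral_left) (auto simp: in_keys_iff)

lemma mono_eval_add: "mono_eval (m + m') x = mono_eval m x * mono_eval m' x"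
proof -
  let ?A = "Poly_Mapping.keys m \<union> Poly_Mapping.keys m'"
  have "mono_eval (m + m') x = (\<Prod>v\<in>?A. x v ^ Poly_Mapping.lookup (m + m') v)"
    by (rule mono_eval_superset) (auto dest: subsetD[OF Poly_Mapping.keys_add])
  moreover have "mono_eval m x = (\<Prod>v\<in>?A. x v ^ Poly_Mapping.lookup m v)"
    by (rule mono_eval_superset) auto
  moreover have "mono_eval m' x = (\<Prod>v\<in>?A. x v ^ Poly_Mapping.lookup m' v)"
    by (rule mono_eval_superset) auto
  ultimately show ?thesis by (simp add: lookup_add power_add prod.distrib)
qed

lemma mono_eval_0 [simp]: "mono_eval 0 x = 1"
  by (simp add: mono_eval_def)

lemma mono_eval_single [simp]: "mono_eval (Poly_Mapping.single v n) x = x v ^ n"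
  by (simp add: mono_eval_def)

lemma mono_eval_scale: "mono_eval m (\<lambda>v. c ^ w v * x v) = c ^ wdeg w m * mono_eval m x"
  by (simp add: mono_eval_def wdeg_def power_mult_distrib prod.distrib power_sum flip: power_mult)

lemma mono_eval_Var: "mono_eval m Var = (Poly_Mapping.single m 1 :: ('v, 'c::comm_semiring_1) mpoly)"
proof (induction m rule: Poly_Mapping.update_induct)
  case const
  then show ?case by simp
next
  case (update m v n)
  have eq: "Poly_Mapping.update v n m = Poly_Mapping.single v n + m"
    using update(1) by (intro poly_mapping_eqI)
      (auto simp: lookup_update lookup_add lookup_single in_keys_iff)
  have "(Var v :: ('v, 'c) mpoly) ^ n = Poly_Mapping.single (Poly_Mapping.single v n) 1"
    by (induction n) (simp_all add: Var_def mult_single flip: single_add)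
  then show ?case
    by (simp add: eq mono_eval_add update(3) mult_single)
qed

lemma mpeval_superset:
  assumes "finite A" "Poly_Mapping.keys p \<subseteq> A" "h 0 = 0"
  shows "mpeval h p x = (\<Sum>m\<in>A. h (Poly_Mapping.lookup p m) * mono_eval m x)"
  unfolding mpeval_def using assms
  by (intro sum_keys_superset[where g = "\<lambda>m c. h c * mono_eval m x"]) auto

lemma mpoly_eq_sum_single:
  "p = (\<Sum>m\<in>Poly_Mapping.keys p. Poly_Mapping.single m (Poly_Mapping.lookup p m))"
  by (rule poly_mapping_eqI)
     (simp add: lookup_sum lookup_single when_def sum.delta in_keys_iff)

lemma mpeval_single:
  assumes "h 0 = 0"
  shows "mpeval h (Poly_Mapping.single m c) x = h c * mono_eval m x"
  using assms by (simp add: mpeval_def)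

context comm_semiring_hom
begin

lemma mpeval_add: "mpeval hom (p + q) x = mpeval hom p x + mpeval hom q x"
proof -
  let ?A = "Poly_Mapping.keys p \<union> Poly_Mapping.keys q"
  have "mpeval hom (p + q) x = (\<Sum>m\<in>?A. hom (Poly_Mapping.lookup (p + q) m) * mono_eval m x)"
    by (rule mpeval_superset) (auto dest: subsetD[OF Poly_Mapping.keys_add])
  moreover have "mpeval hom p x = (\<Sum>m\<in>?A. hom (Poly_Mapping.lookup p m) * mono_eval m x)"
    by (rule mpeval_superset) auto
  moreover have "mpeval hom q x = (\<Sum>m\<in>?A. hom (Poly_Mapping.lookup q m) * mono_eval m x)"
    by (rule mpeval_superset) auto
  ultimately show ?thesis by (simp add: lookup_add algebra_simps sum.distrib hom_add)
qed

lemma mpeval_0 [simp]: "mpeval hom 0 x = 0"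
  by (simp add: mpeval_def)

lemma mpeval_sum: "mpeval hom (sum f A) x = (\<Sum>a\<in>A. mpeval hom (f a) x)"
  by (induction A rule: infinite_finite_induct) (simp_all add: mpeval_add)

lemma mpeval_mult: "mpeval hom (p * q) x = mpeval hom p x * mpeval hom q x"
proof -
  have s: "mpeval hom (Poly_Mapping.single m c * Poly_Mapping.single m' c') x =
    mpeval hom (Poly_Mapping.single m c) x * mpeval hom (Poly_Mapping.single m' c') x" for m m' c c'
    by (simp add: mult_single mpeval_single mono_eval_add hom_mult algebra_simps)
  have "mpeval hom (p * q) x =
    mpeval hom ((\<Sum>m\<in>Poly_Mapping.keys p. Poly_Mapping.single m (Poly_Mapping.lookup p m)) *
      (\<Sum>m\<in>Poly_Mapping.keys q. Poly_Mapping.single m (Poly_Mapping.lookup q m))) x"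
    by (simp flip: mpoly_eq_sum_single)
  also have "\<dots> = (\<Sum>m\<in>Poly_Mapping.keys p. mpeval hom (Poly_Mapping.single m (Poly_Mapping.lookup p m)) x) *
      (\<Sum>m\<in>Poly_Mapping.keys q. mpeval hom (Poly_Mapping.single m (Poly_Mapping.lookup q m)) x)"
    by (simp add: sum_product mpeval_sum s)
  also have "\<dots> = mpeval hom p x * mpeval hom q x"
    by (simp add: mpeval_single) (simp add: mpeval_def)
  finally show ?thesis .
qed

lemma mpeval_Const [simp]: "mpeval hom (Const c) x = hom c"
  by (simp add: mpeval_single)

lemma mpeval_1 [simp]: "mpeval hom 1 x = 1"
  using mpeval_Const[of 1 x] by simp

lemma mpeval_Var [simp]: "mpeval hom (Var v) x = x v"
  by (simp add: Var_def mpeval_single)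

lemma comm_semiring_hom_mpeval: "comm_semiring_hom (\<lambda>p. mpeval hom p x)"
  by unfold_locales (simp_all add: mpeval_add mpeval_mult)

lemma hom_mono_eval: "hom (mono_eval m x) = mono_eval m (\<lambda>v. hom (x v))"
  by (simp add: mono_eval_def hom_prod hom_power)

lemma hom_mpeval: "hom (mpeval h p x) = mpeval (\<lambda>c. hom (h c)) p (\<lambda>v. hom (x v))"
  by (simp add: mpeval_def hom_sum hom_mult hom_mono_eval)

end

lemma comm_semiring_hom_Const:
  "comm_semiring_hom (Const :: 'c::comm_semiring_1 \<Rightarrow> ('v, 'c) mpoly)"
  by unfold_locales (simp_all add: single_add mult_single)

text \<open>Evaluating at the variables themselves changes nothing. Together with \<open>hom_mpeval\<close> this identifies
  a composite of evaluations without looking at coefficients.\<close>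

lemma mpeval_Const_Var: "mpeval Const p Var = (p :: ('v, 'c::comm_semiring_1) mpoly)"
  by (subst (3) mpoly_eq_sum_single) (simp add: mpeval_def mono_eval_Var mult_single)

lemma mono_eval_cong:
  "(\<And>v. v \<in> Poly_Mapping.keys m \<Longrightarrow> x v = y v) \<Longrightarrow> mono_eval m x = mono_eval m y"
  by (simp add: mono_eval_def)

lemma mpeval_cong:
  assumes "p \<in> polys_in J" "\<And>v. v \<in> J \<Longrightarrow> x v = y v"
  shows "mpeval h p x = mpeval h p y"
proof -
  have "mono_eval m x = mono_eval m y" if "m \<in> Poly_Mapping.keys p" for m
    using assms that by (intro mono_eval_cong) (auto simp: polys_in_def)
  then show ?thesis by (simp add: mpeval_def)
qed

text \<open>Used to bound the variables that occur in the result of a substitution.\<close>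

lemma mpeval_closed:
  fixes S :: "'b::comm_semiring_1 set" and p :: "('v, 'c::zero) mpoly"
  assumes "0 \<in> S" "1 \<in> S" "\<And>a b. a \<in> S \<Longrightarrow> b \<in> S \<Longrightarrow> a + b \<in> S"
    "\<And>a b. a \<in> S \<Longrightarrow> b \<in> S \<Longrightarrow> a * b \<in> S" "\<And>c. h c \<in> S" "\<And>v. v \<in> J \<Longrightarrow> x v \<in> S"
    "p \<in> polys_in J"
  shows "mpeval h p x \<in> S"
proof -
  have s: "sum f A \<in> S" if "\<And>a. a \<in> A \<Longrightarrow> f a \<in> S" for f and A :: "'v monomial set"
    using that by (induction A rule: infinite_finite_induct) (auto intro: assms)
  have p: "prod f A \<in> S" if "\<And>a. a \<in> A \<Longrightarrow> f a \<in> S" for f and A :: "'v set"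
    using that by (induction A rule: infinite_finite_induct) (auto intro: assms)
  have pw: "a ^ n \<in> S" if "a \<in> S" for a and n :: nat
    using that by (induction n) (auto intro: assms)
  show ?thesis unfolding mpeval_def mono_eval_def
    using assms(7) by (intro s assms(4) assms(5) p pw assms(6)) (auto simp: polys_in_def)
qed

section \<open>Subrings of polynomials in some of the variables\<close>

lemma polys_in_0 [simp]: "0 \<in> polys_in J"
  and polys_in_single: "Poly_Mapping.keys m \<subseteq> J \<Longrightarrow> Poly_Mapping.single m c \<in> polys_in J"
  by (auto simp: polys_in_def)

lemma polys_in_1 [simp]: "(1 :: ('v, 'c::zero_neq_one) mpoly) \<in> polys_in J"
  by (auto simp: polys_in_def)

lemma polys_in_Const [simp]: "Const c \<in> polys_in J"
  by (rule polys_in_single) simp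

lemma polys_in_Var: "v \<in> J \<Longrightarrow> Var v \<in> polys_in J"
  unfolding Var_def by (rule polys_in_single) simp

lemma polys_in_add: "p \<in> polys_in J \<Longrightarrow> q \<in> polys_in J \<Longrightarrow> p + q \<in> polys_in J"
  by (force simp: polys_in_def dest: subsetD[OF Poly_Mapping.keys_add])

lemma polys_in_sum: "(\<And>a. a \<in> A \<Longrightarrow> f a \<in> polys_in J) \<Longrightarrow> sum f A \<in> polys_in J"
  by (induction A rule: infinite_finite_induct) (auto intro: polys_in_add)

lemma polys_in_uminus: "p \<in> polys_in J \<Longrightarrow> - p \<in> polys_in J"
  by (auto simp: polys_in_def in_keys_iff)

lemma polys_in_diff:
  "p \<in> polys_in J \<Longrightarrow> q \<in> polys_in J \<Longrightarrow> (p - q :: ('v, 'c::ab_group_add) mpoly) \<in> polys_in J"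
  using polys_in_add[of p J "- q"] polys_in_uminus[of q J] by simp

lemma polys_in_mult:
  "p \<in> polys_in J \<Longrightarrow> q \<in> polys_in J \<Longrightarrow> (p * q :: ('v, 'c::semiring_0) mpoly) \<in> polys_in J"
  by (fastforce simp: polys_in_def dest!: subsetD[OF Poly_Mapping.keys_mult] subsetD[OF Poly_Mapping.keys_add])

lemma polys_in_power: "p \<in> polys_in J \<Longrightarrow> (p ^ n :: ('v, 'c::semiring_1) mpoly) \<in> polys_in J"
  by (induction n) (auto intro: polys_in_mult)

lemma polys_in_mono: "p \<in> polys_in J \<Longrightarrow> J \<subseteq> K \<Longrightarrow> p \<in> polys_in K"
  by (auto simp: polys_in_def)

lemma polys_in_empty_iff: "p \<in> polys_in {} \<longleftrightarrow> (\<exists>c. p = Const c)"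
proof
  assume p: "p \<in> polys_in {}"
  have "Poly_Mapping.lookup p m = Poly_Mapping.lookup (Const (Poly_Mapping.lookup p 0)) m" for m
    using p by (cases "m = 0") (auto simp: polys_in_def lookup_single in_keys_iff)
  then show "\<exists>c. p = Const c" by (metis poly_mapping_eqI)
qed auto

lemma finite_vars: obtains J where "finite J" "p \<in> polys_in J"
  by (rule that[of "\<Union>m\<in>Poly_Mapping.keys p. Poly_Mapping.keys m"]) (auto simp: polys_in_def)

section \<open>A multivariate polynomial as a univariate one\<close>

text \<open>The polynomial ring in all variables maps to polynomials in one new variable over itself: the
  variable \<open>v\<close> becomes the new one. The coefficients of the result no longer contain \<open>v\<close>, so this
  is the view of \<open>\<int>[J]\<close> as \<open>\<int>[J - {v}][v]\<close>, on which inductions over finite sets of variables are based.\<close>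

definition to_uni :: "'v \<Rightarrow> ('v, 'c::comm_ring_1) mpoly \<Rightarrow> ('v, 'c) mpoly poly" where
  "to_uni v p = mpeval (\<lambda>c. [:Const c:]) p (\<lambda>u. if u = v then [:0, 1:] else [:Var u:])"

abbreviation vdeg :: "'v \<Rightarrow> ('v, 'c::comm_ring_1) mpoly \<Rightarrow> nat" where
  "vdeg v p \<equiv> Polynomial.degree (to_uni v p)"

lemma comm_semiring_hom_poly_Const:
  "comm_semiring_hom (\<lambda>c. [:Const c:] :: ('v, 'c::comm_ring_1) mpoly poly)"
  by unfold_locales (simp_all add: single_add mult_single mult.commute)

lemma comm_semiring_hom_to_uni: "comm_semiring_hom (to_uni v)"
  unfolding to_uni_def[abs_def]
  by (rule comm_semiring_hom.comm_semiring_hom_mpeval[OF comm_semiring_hom_poly_Const])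

lemma comm_ring_hom_to_uni: "comm_ring_hom (to_uni v)"
  using comm_semiring_hom_to_uni by (simp add: comm_ring_hom_def ring_hom_def semiring_hom_def
    comm_semiring_hom_def)

interpretation to_uni: comm_ring_hom "to_uni v" for v
  by (rule comm_ring_hom_to_uni)

lemma poly_to_uni_Var [simp]: "poly (to_uni v p) (Var v) = p"
proof -
  have "poly (to_uni v p) (Var v) = mpeval Const p Var"
  proof -
    have "(\<lambda>u. poly (if u = v then [:0, 1:] else [:Var u:]) (Var v)) = (Var :: _ \<Rightarrow> ('a, 'b) mpoly)"
      by auto
    then show ?thesis unfolding to_uni_def
      by (subst poly_hom.hom_mpeval) simp
  qed
  then show ?thesis by (simp add: mpeval_Const_Var)
qed

lemma to_uni_eq_0_iff [simp]: "to_uni v p = 0 \<longleftrightarrow> p = 0"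
  by (metis poly_to_uni_Var poly_0 to_uni.hom_zero)

lemma to_uni_free:
  assumes "p \<in> polys_in J" "v \<notin> J"
  shows "to_uni v p = [:p:]"
proof -
  interpret C: comm_semiring_hom "\<lambda>c. [:c:] :: ('a, 'b) mpoly poly"
    by unfold_locales simp_all
  have "to_uni v p = mpeval (\<lambda>c. [:Const c:]) p (\<lambda>u. [:Var u:])"
    unfolding to_uni_def using assms by (intro mpeval_cong) auto
  also have "\<dots> = [:mpeval Const p Var:]"
    by (simp add: C.hom_mpeval)
  finally show ?thesis by (simp add: mpeval_Const_Var)
qed

lemma coeff_to_uni_in:
  assumes "p \<in> polys_in J"
  shows "coeff (to_uni v p) k \<in> polys_in (J - {v})"
proof -
  let ?S = "{q. \<forall>k. coeff q k \<in> polys_in (J - {v})} :: ('a, 'b) mpoly poly set"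
  have "to_uni v p \<in> ?S"
    unfolding to_uni_def
    by (rule mpeval_closed[where J = J])
       (auto simp: coeff_pCons coeff_mult assms split: nat.splits
         intro!: polys_in_add polys_in_mult polys_in_sum polys_in_Var)
  then show ?thesis by simp
qed

text \<open>Specialising all variables but \<open>v\<close> gives a univariate polynomial whose values are those of \<open>p\<close>
  along a coordinate line.\<close>

lemma poly_map_to_uni:
  assumes "comm_semiring_hom h"
  shows "poly (map_poly (\<lambda>c. mpeval h c x) (to_uni v p)) t = mpeval h p (x(v := t))"
proof -
  interpret h: comm_semiring_hom h by fact
  interpret e: comm_semiring_hom "\<lambda>c. mpeval h c x" by (rule h.comm_semiring_hom_mpeval)
  interpret m: map_poly_comm_semiring_hom "\<lambda>c. mpeval h c x" ..
  interpret g: comm_semiring_hom "\<lambda>q. poly (map_poly (\<lambda>c. mpeval h c x) q) t"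
    by unfold_locales (simp_all add: hom_distribs)
  have 1: "(\<lambda>u. poly (map_poly (\<lambda>c. mpeval h c x) (if u = v then [:0, 1:] else [:Var u:])) t) = x(v := t)"
    by (auto simp: hom_distribs)
  have 2: "(\<lambda>c. poly (map_poly (\<lambda>c. mpeval h c x) [:Const c:]) t) = h"
    by (auto simp: hom_distribs)
  show ?thesis unfolding to_uni_def g.hom_mpeval 1 2 ..
qed

section \<open>Grading by a weighted degree\<close>

text \<open>Substituting \<open>x\<^sub>u * T ^ w u\<close> for \<open>x\<^sub>u\<close> sorts the terms of \<open>p\<close> by weighted degree: the coefficient of
  \<open>T ^ k\<close> is the component of degree \<open>k\<close>. Since this is a ring homomorphism into polynomials over a
  domain, weighted degrees add in products.\<close>

definition grade :: "('v \<Rightarrow> nat) \<Rightarrow> ('v, 'c::comm_ring_1) mpoly \<Rightarrow> ('v, 'c) mpoly poly" where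
  "grade w p = mpeval (\<lambda>c. [:Const c:]) p (\<lambda>u. Polynomial.monom (Var u) (w u))"

definition whomog :: "('v \<Rightarrow> nat) \<Rightarrow> nat \<Rightarrow> ('v, 'c::zero) mpoly \<Rightarrow> bool" where
  "whomog w n p \<longleftrightarrow> (\<forall>m\<in>Poly_Mapping.keys p. wdeg w m = n)"

lemma comm_ring_hom_grade: "comm_ring_hom (grade w)"
  using comm_semiring_hom.comm_semiring_hom_mpeval[OF comm_semiring_hom_poly_Const]
  unfolding grade_def[abs_def]
  by (simp add: comm_ring_hom_def ring_hom_def semiring_hom_def comm_semiring_hom_def)

interpretation grade: comm_ring_hom "grade w" for w
  by (rule comm_ring_hom_grade)

lemma mono_eval_monom:
  "mono_eval m (\<lambda>u. Polynomial.monom (x u) (w u)) = Polynomial.monom (mono_eval m x) (wdeg w m)"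
proof -
  have "(\<Prod>v\<in>A. Polynomial.monom (y v) (n v)) = Polynomial.monom (\<Prod>v\<in>A. y v) (\<Sum>v\<in>A. n v)"
    for y and n :: "_ \<Rightarrow> nat" and A
    by (induction A rule: infinite_finite_induct) (simp_all add: mult_monom monom_0 one_pCons)
  then show ?thesis unfolding mono_eval_def wdeg_def by (simp add: monom_power)
qed

lemma grade_eq: "grade w p =
  (\<Sum>m\<in>Poly_Mapping.keys p. Polynomial.monom (Poly_Mapping.single m (Poly_Mapping.lookup p m)) (wdeg w m))"
  by (simp add: grade_def mpeval_def mono_eval_monom mono_eval_Var smult_monom mult_single)

lemma lookup_coeff_grade:
  "Poly_Mapping.lookup (coeff (grade w p) k) m = (if wdeg w m = k then Poly_Mapping.lookup p m else 0)"
proof -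
  have "Poly_Mapping.lookup (coeff (grade w p) k) m =
    (\<Sum>x\<in>Poly_Mapping.keys p. if x = m then (if wdeg w m = k then Poly_Mapping.lookup p m else 0) else 0)"
    unfolding grade_eq coeff_sum lookup_sum
    by (intro sum.cong) (auto simp: lookup_single when_def)
  then show ?thesis by (simp add: sum.delta in_keys_iff)
qed

lemma grade_eq_0_iff [simp]: "grade w p = 0 \<longleftrightarrow> p = 0"
  by (metis coeff_0 grade.hom_zero lookup_coeff_grade lookup_zero poly_mapping_eqI)

lemma whomog_iff_grade: "whomog w n p \<longleftrightarrow> grade w p = Polynomial.monom p n"
proof
  assume "whomog w n p"
  then have "Poly_Mapping.lookup (coeff (grade w p) k) m = Poly_Mapping.lookup (coeff (Polynomial.monom p n) k) m" for k m
    by (auto simp: lookup_coeff_grade whomog_def in_keys_iff)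
  then show "grade w p = Polynomial.monom p n"
    by (intro poly_eqI poly_mapping_eqI) auto
next
  assume *: "grade w p = Polynomial.monom p n"
  have "wdeg w m = n" if "m \<in> Poly_Mapping.keys p" for m
  proof (rule ccontr)
    assume "wdeg w m \<noteq> n"
    then have "Poly_Mapping.lookup (coeff (grade w p) n) m = 0"
      by (simp add: lookup_coeff_grade)
    with that show False by (simp add: * in_keys_iff)
  qed
  then show "whomog w n p" by (simp add: whomog_def)
qed

lemma wdeg_le_degree_grade:
  "m \<in> Poly_Mapping.keys p \<Longrightarrow> wdeg w m \<le> Polynomial.degree (grade w p)"
  by (rule le_degree) (metis in_keys_iff lookup_coeff_grade lookup_zero)

lemma degree_grade_le:
  assumes "\<And>m. m \<in> Poly_Mapping.keys p \<Longrightarrow> wdeg w m \<le> n"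
  shows "Polynomial.degree (grade w p) \<le> n"
proof (rule degree_le, intro allI impI)
  fix k assume "n < k"
  then have "Poly_Mapping.lookup (coeff (grade w p) k) m = 0" for m
    using assms[of m] by (cases "m \<in> Poly_Mapping.keys p") (auto simp: lookup_coeff_grade in_keys_iff)
  then show "coeff (grade w p) k = 0" by (intro poly_mapping_eqI) simp
qed

section \<open>Unique factorization\<close>

lemma vdeg_mult:
  fixes p q :: "('v::linorder, 'c::idom) mpoly"
  assumes "p \<noteq> 0" "q \<noteq> 0"
  shows "vdeg v (p * q) = vdeg v p + vdeg v q"
  using assms by (simp add: to_uni.hom_mult degree_mult_eq)

lemma degree_grade_mult:
  fixes p q :: "('v::linorder, 'c::idom) mpoly"
  assumes "p \<noteq> 0" "q \<noteq> 0"
  shows "Polynomial.degree (grade w (p * q)) = Polynomial.degree (grade w p) + Polynomial.degree (grade w q)"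
  using assms by (simp add: grade.hom_mult degree_mult_eq)

lemma wdeg_indicator: "wdeg (\<lambda>u. if u = v then 1 else 0) m = Poly_Mapping.lookup m v"
  by (simp add: wdeg_def if_distrib[of "\<lambda>x. x * _"] sum.delta in_keys_iff cong: if_cong)

text \<open>Take the weight that counts the variable \<open>v\<close> only: degrees in \<open>v\<close> add up, so a product free of \<open>v\<close>
  has factors free of \<open>v\<close>.\<close>

lemma polys_in_factor:
  fixes p q :: "('v::linorder, 'c::idom) mpoly"
  assumes "p * q \<in> polys_in J" "p * q \<noteq> 0"
  shows "p \<in> polys_in J"
  unfolding polys_in_def
proof (intro CollectI ballI subsetI, rule ccontr)
  fix m v assume m: "m \<in> Poly_Mapping.keys p" and v: "v \<in> Poly_Mapping.keys m" "v \<notin> J"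
  define w where "w = (\<lambda>u. if u = v then 1 else 0 :: nat)"
  have "Polynomial.degree (grade w (p * q)) \<le> 0"
  proof (rule degree_grade_le)
    fix m assume "m \<in> Poly_Mapping.keys (p * q)"
    then have "v \<notin> Poly_Mapping.keys m" using assms(1) v by (auto simp: polys_in_def)
    then show "wdeg w m \<le> 0" by (simp add: w_def wdeg_indicator in_keys_iff)
  qed
  then have "Polynomial.degree (grade w p) = 0"
    using assms(2) by (simp add: degree_grade_mult)
  with wdeg_le_degree_grade[OF m, of w] v show False
    by (simp add: w_def wdeg_indicator in_keys_iff)
qed

lemma polys_in_dvd:
  fixes p q :: "('v::linorder, 'c::idom) mpoly"
  assumes "p dvd q" "q \<in> polys_in J" "q \<noteq> 0"
  shows "p \<in> polys_in J"
  using assms by (auto elim!: dvdE intro: polys_in_factor)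

lemma lookup_Const_mult:
  "Poly_Mapping.lookup (Const c * p) m = (c :: 'c::comm_semiring_1) * Poly_Mapping.lookup p m"
  by (simp add: map.rep_eq when_def flip: mult_map_scale_conv_mult)

definition height :: "('v, int) mpoly \<Rightarrow> nat" where
  "height p = (\<Sum>m\<in>Poly_Mapping.keys p. nat \<bar>Poly_Mapping.lookup p m\<bar>)"

text \<open>Removing a nonconstant factor lowers the total degree; removing an integer factor leaves it
  unchanged and lowers the sum of the absolute values of the coefficients. The lexicographic order
  of the two therefore makes division by nonunits terminate.\<close>

definition factor_order :: "(('v::linorder, int) mpoly \<times> ('v, int) mpoly) set" where
  "factor_order = measures [\<lambda>p. Polynomial.degree (grade (\<lambda>_. 1) p), height]"

lemma proper_factor_less:
  fixes p q :: "('v::linorder, int) mpoly"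
  assumes "p \<noteq> 0" "q \<noteq> 0" "\<not> q dvd 1"
  shows "(p, q * p) \<in> factor_order"
proof (cases "Polynomial.degree (grade (\<lambda>_. 1) q) = 0")
  case False
  then show ?thesis using assms by (simp add: factor_order_def degree_grade_mult)
next
  case True
  have "wdeg (\<lambda>_. 1) m = 0" if "m \<in> Poly_Mapping.keys q" for m
    using wdeg_le_degree_grade[OF that, of "\<lambda>_. 1"] True by simp
  then have "q \<in> polys_in {}"
    by (fastforce simp: polys_in_def wdeg_def in_keys_iff intro!: poly_mapping_eqI)
  then obtain c where q: "q = Const c" by (auto simp: polys_in_empty_iff)
  have c0: "c \<noteq> 0" using assms q by auto
  have "\<not> c dvd 1"
  proof
    assume "c dvd 1"
    then obtain b where "1 = c * b" by (elim dvdE)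
    then have "1 = Const c * (Const b :: ('v, int) mpoly)" by (simp add: mult_single)
    with q assms show False by (metis dvd_triv_left)
  qed
  with c0 have c: "\<bar>c\<bar> \<ge> 2" by (cases "\<bar>c\<bar> = 1") auto
  have keys: "Poly_Mapping.keys (Const c * p) = Poly_Mapping.keys p"
    using c by (auto simp: in_keys_iff lookup_Const_mult)
  have h: "height (Const c * p) = nat \<bar>c\<bar> * height p"
    unfolding height_def keys by (simp add: lookup_Const_mult abs_mult nat_mult_distrib sum_distrib_left)
  obtain m where "m \<in> Poly_Mapping.keys p" using assms(1) by (metis keys_eq_empty all_not_in_conv)
  then have "height p > 0"
    unfolding height_def by (intro sum_pos2[of _ m]) (auto simp: in_keys_iff)
  moreover have "2 * height p \<le> height (q * p)"
    unfolding q h using c by (intro mult_right_mono) auto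
  ultimately have "height p < height (q * p)" by linarith
  then show ?thesis using assms True by (simp add: factor_order_def degree_grade_mult)
qed

lemma wf_factor_order: "wf factor_order"
  by (simp add: factor_order_def)

lemma irreducible_divisor_exists:
  fixes c :: "('v::linorder, int) mpoly"
  assumes "c \<noteq> 0" "\<not> c dvd 1"
  obtains p where "Factorial_Ring.irreducible p" "p dvd c"
proof -
  let ?Q = "{p. p dvd c \<and> \<not> p dvd 1}"
  have "c \<in> ?Q" using assms by simp
  then obtain p where p: "p \<in> ?Q" and min: "\<And>a. (a, p) \<in> factor_order \<Longrightarrow> a \<notin> ?Q"
    by (rule wfE_min[OF wf_factor_order]) blast
  have p0: "p \<noteq> 0" using p assms by auto
  have "Factorial_Ring.irreducible p"
  proof (rule irreducibleI)
    fix a b assume ab: "p = a * b"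
    show "a dvd 1 \<or> b dvd 1"
    proof (rule ccontr)
      assume n: "\<not> (a dvd 1 \<or> b dvd 1)"
      then have "(b, p) \<in> factor_order" using ab p0 by (auto intro!: proper_factor_less)
      moreover have "b dvd c" using p ab by (auto intro: dvd_trans)
      ultimately show False using min n by blast
    qed
  qed (use p p0 in auto)
  then show ?thesis using that p by auto
qed

text \<open>Existence of a factorization into irreducibles, in the form of an induction principle.\<close>

lemma irreducible_factor_induct [consumes 1, case_names unit mult]:
  fixes c :: "('v::linorder, int) mpoly"
  assumes "c \<noteq> 0"
    and "\<And>u. u dvd 1 \<Longrightarrow> P u"
    and "\<And>p c. Factorial_Ring.irreducible p \<Longrightarrow> c \<noteq> 0 \<Longrightarrow> P c \<Longrightarrow> P (p * c)"
  shows "P c"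
  using wf_factor_order assms(1)
proof (induction c rule: wf_induct_rule)
  case (less c)
  show ?case
  proof (cases "c dvd 1")
    case True
    then show ?thesis by (rule assms(2))
  next
    case False
    with less(2) obtain p where p: "Factorial_Ring.irreducible p" "p dvd c"
      by (rule irreducible_divisor_exists)
    then obtain d where d: "c = p * d" by (elim dvdE)
    then have "d \<noteq> 0" using less(2) by auto
    moreover have "(d, c) \<in> factor_order"
      unfolding d using p \<open>d \<noteq> 0\<close> by (intro proper_factor_less) (auto simp: irreducible_def)
    ultimately show ?thesis using less(1) p(1) assms(3) d by blast
  qed
qed

text \<open>Primality tested only against polynomials in the variables \<open>J\<close>: the form in which primality can be
  carried from \<open>J\<close> to one more variable.\<close>

definition prime_on :: "'v set \<Rightarrow> ('v::linorder, 'c::idom) mpoly \<Rightarrow> bool" where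
  "prime_on J q \<longleftrightarrow> (\<forall>f\<in>polys_in J. \<forall>g\<in>polys_in J. q dvd f * g \<longrightarrow> q dvd f \<or> q dvd g)"

lemma dvd_iff_coeffs:
  fixes p :: "('v::linorder, 'c::idom) mpoly"
  assumes "p \<in> polys_in J" "v \<notin> J"
  shows "p dvd f \<longleftrightarrow> (\<forall>k. p dvd coeff (to_uni v f) k)"
proof -
  have "p dvd f \<longleftrightarrow> [:p:] dvd to_uni v f"
  proof
    assume "p dvd f"
    then show "[:p:] dvd to_uni v f"
      using to_uni.hom_dvd[of p f v] to_uni_free[OF assms] by simp
  next
    assume "[:p:] dvd to_uni v f"
    then have "poly [:p:] (Var v) dvd poly (to_uni v f) (Var v)" by (rule poly_hom.hom_dvd)
    then show "p dvd f" by simp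
  qed
  then show ?thesis by (simp add: const_poly_dvd_iff)
qed

text \<open>Gauss: in a product of two polynomials in \<open>v\<close>, neither divisible by the prime \<open>p\<close>, the lowest
  coefficients not divisible by \<open>p\<close> contribute the only term not divisible by \<open>p\<close> to one coefficient of
  the product.\<close>

lemma prime_on_insert:
  assumes "prime_on J p" "p \<in> polys_in J" "v \<notin> J"
  shows "prime_on (insert v J) p"
  unfolding prime_on_def
proof (intro ballI impI, rule ccontr)
  fix f g assume f: "f \<in> polys_in (insert v J)" and g: "g \<in> polys_in (insert v J)"
    and dvd: "p dvd f * g" and no: "\<not> (p dvd f \<or> p dvd g)"
  note iff = dvd_iff_coeffs[OF assms(2,3)]
  let ?F = "coeff (to_uni v f)" and ?G = "coeff (to_uni v g)"
  define i where "i = (LEAST i. \<not> p dvd ?F i)"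
  define j where "j = (LEAST j. \<not> p dvd ?G j)"
  have i: "\<not> p dvd ?F i" "\<And>k. k < i \<Longrightarrow> p dvd ?F k"
  proof -
    obtain k where "\<not> p dvd ?F k" using no iff[of f] by blast
    then show "\<not> p dvd ?F i" unfolding i_def by (rule LeastI)
    show "p dvd ?F k" if "k < i" for k using that not_less_Least unfolding i_def by blast
  qed
  have j: "\<not> p dvd ?G j" "\<And>k. k < j \<Longrightarrow> p dvd ?G k"
  proof -
    obtain k where "\<not> p dvd ?G k" using no iff[of g] by blast
    then show "\<not> p dvd ?G j" unfolding j_def by (rule LeastI)
    show "p dvd ?G k" if "k < j" for k using that not_less_Least unfolding j_def by blast
  qed
  have "p dvd coeff (to_uni v (f * g)) (i + j)" using dvd iff by blast
  also have "coeff (to_uni v (f * g)) (i + j) = (\<Sum>k\<le>i + j. ?F k * ?G (i + j - k))"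
    by (simp add: to_uni.hom_mult coeff_mult)
  also have "\<dots> = ?F i * ?G j + (\<Sum>k\<in>{..i + j} - {i}. ?F k * ?G (i + j - k))"
    by (subst sum.remove[of _ i]) auto
  finally have "p dvd ?F i * ?G j + (\<Sum>k\<in>{..i + j} - {i}. ?F k * ?G (i + j - k))" .
  moreover have "p dvd (\<Sum>k\<in>{..i + j} - {i}. ?F k * ?G (i + j - k))"
  proof (rule dvd_sum)
    fix k assume k: "k \<in> {..i + j} - {i}"
    then consider "k < i" | "i + j - k < j" by force
    then show "p dvd ?F k * ?G (i + j - k)" using i(2) j(2) by cases auto
  qed
  ultimately have "p dvd ?F i * ?G j" by (simp add: dvd_add_left_iff)
  moreover have "?F i \<in> polys_in J" "?G j \<in> polys_in J"
    using coeff_to_uni_in[OF f, of v i] coeff_to_uni_in[OF g, of v j] assms(3) by simp_all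
  ultimately show False
    using assms(1) i(1) j(1) unfolding prime_on_def by blast
qed

text \<open>The leading coefficient of \<open>h\<close> in \<open>v\<close> has no inverse, so each step of the division multiplies \<open>f\<close> by it
  instead.\<close>

lemma pseudo_division:
  fixes f h :: "('v::linorder, 'c::idom) mpoly"
  assumes "v \<in> K" "h \<in> polys_in K" "h \<noteq> 0" "f \<in> polys_in K"
  shows "\<exists>c s r. c \<in> polys_in (K - {v}) \<and> c \<noteq> 0 \<and> s \<in> polys_in K \<and> r \<in> polys_in K \<and>
    c * f = h * s + r \<and> (r = 0 \<or> vdeg v r < vdeg v h)"
  using assms(4)
proof (induction "vdeg v f" arbitrary: f rule: less_induct)
  case less
  show ?case
  proof (cases "f = 0 \<or> vdeg v f < vdeg v h")
    case True
    then show ?thesis using less(2) by (intro exI[of _ 1] exI[of _ 0] exI[of _ f]) auto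
  next
    case False
    define a where "a = lead_coeff (to_uni v h)"
    define b where "b = lead_coeff (to_uni v f)"
    define k where "k = vdeg v f - vdeg v h"
    \<comment> \<open>cancels the leading terms in \<open>v\<close>\<close>
    define f' where "f' = a * f - b * Var v ^ k * h"
    have a: "a \<in> polys_in (K - {v})" "a \<noteq> 0" and b: "b \<in> polys_in (K - {v})"
      using assms less by (auto simp: a_def b_def coeff_to_uni_in)
    then have aK: "a \<in> polys_in K" "b \<in> polys_in K" by (auto intro: polys_in_mono)
    note in_K = polys_in_diff polys_in_mult polys_in_add polys_in_power polys_in_Var
    have f': "f' \<in> polys_in K"
      unfolding f'_def using aK assms less by (intro in_K) auto
    have V: "to_uni v (Var v ^ k) = Polynomial.monom 1 k"
      by (simp add: to_uni.hom_power to_uni_def[of v "Var v"] comm_semiring_hom.mpeval_Var[OF comm_semiring_hom_poly_Const]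
          x_as_monom monom_power)
    have "to_uni v f' = Polynomial.smult a (to_uni v f) - Polynomial.monom b k * to_uni v h"
      using to_uni_free[OF a(1), of v] to_uni_free[OF b, of v]
      by (simp add: f'_def to_uni.hom_minus to_uni.hom_mult V smult_monom flip: mult_smult_left)
    moreover have "coeff \<dots> (vdeg v f) = 0"
      using False by (simp add: k_def coeff_monom_mult a_def b_def)
    moreover have "Polynomial.degree (Polynomial.smult a (to_uni v f) - Polynomial.monom b k * to_uni v h) \<le> vdeg v f"
    proof (rule degree_diff_le)
      have "Polynomial.degree (Polynomial.monom b k * to_uni v h) \<le> k + vdeg v h"
        using degree_mult_le[of "Polynomial.monom b k" "to_uni v h"] degree_monom_le[of b k] by linarith
      then show "Polynomial.degree (Polynomial.monom b k * to_uni v h) \<le> vdeg v f"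
        using False by (simp add: k_def)
    qed (rule degree_smult_le)
    ultimately have "f' = 0 \<or> vdeg v f' < vdeg v f"
      by (metis eq_zero_or_degree_less to_uni_eq_0_iff)
    then show ?thesis
    proof
      assume "f' = 0"
      then have "a * f = h * (b * Var v ^ k) + 0" by (simp add: f'_def algebra_simps)
      moreover have "b * Var v ^ k \<in> polys_in K" using aK assms(1) by (intro in_K)
      ultimately show ?thesis using a polys_in_0[of K] by blast
    next
      assume "vdeg v f' < vdeg v f"
      from less(1)[OF this f'] obtain c s r where csr: "c \<in> polys_in (K - {v})" "c \<noteq> 0"
        "s \<in> polys_in K" "r \<in> polys_in K" "c * f' = h * s + r" "r = 0 \<or> vdeg v r < vdeg v h"
        by blast
      have "c * a * f = h * (s + c * b * Var v ^ k) + r"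
        using csr(5) by (simp add: f'_def algebra_simps)
      moreover have "c * a \<in> polys_in (K - {v})" "c * a \<noteq> 0"
        using csr a by (auto intro: in_K)
      moreover have "s + c * b * Var v ^ k \<in> polys_in K"
        using csr aK assms(1) by (intro in_K) (auto intro: polys_in_mono)
      ultimately show ?thesis using csr by blast
    qed
  qed
qed

text \<open>Up to factors free of \<open>v\<close>, an ideal is principal, generated by an element of least degree in \<open>v\<close>.
  This replaces passing to the fraction field of the coefficients and using that polynomials over
  a field form a principal ideal domain.\<close>

lemma minimal_vdeg_generator:
  fixes I :: "('v::linorder, 'c::idom) mpoly set"
  assumes "v \<in> K" "I \<subseteq> polys_in K" "f0 \<in> I" "f0 \<noteq> 0"
    and closed: "\<And>f h c s. f \<in> I \<Longrightarrow> h \<in> I \<Longrightarrow> c \<in> polys_in K \<Longrightarrow> s \<in> polys_in K \<Longrightarrow> c * f - h * s \<in> I"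
  obtains h where "h \<in> I" "h \<noteq> 0"
    "\<And>f. f \<in> I \<Longrightarrow> \<exists>c s. c \<in> polys_in (K - {v}) \<and> c \<noteq> 0 \<and> s \<in> polys_in K \<and> c * f = h * s"
proof -
  have "\<exists>h. (h \<in> I \<and> h \<noteq> 0) \<and> (\<forall>g. g \<in> I \<and> g \<noteq> 0 \<longrightarrow> vdeg v h \<le> vdeg v g)"
    by (rule ex_has_least_nat[of _ f0]) (use assms in auto)
  then obtain h where h: "h \<in> I" "h \<noteq> 0" and min: "\<And>g. g \<in> I \<Longrightarrow> g \<noteq> 0 \<Longrightarrow> vdeg v h \<le> vdeg v g"
    by blast
  show ?thesis
  proof (rule that[OF h])
    fix f assume f: "f \<in> I"
    obtain c s r where csr: "c \<in> polys_in (K - {v})" "c \<noteq> 0"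
        "s \<in> polys_in K" "r \<in> polys_in K" "c * f = h * s + r" "r = 0 \<or> vdeg v r < vdeg v h"
      using pseudo_division[of v K h f] assms h f by blast
    have r: "r = c * f - h * s" using csr(5) by simp
    have "c \<in> polys_in K" using csr(1) by (rule polys_in_mono) auto
    then have "r \<in> I" unfolding r using closed[OF f h(1)] csr(3) by blast
    then have "r = 0" using csr(6) min[of r] by linarith
    then show "\<exists>c s. c \<in> polys_in (K - {v}) \<and> c \<noteq> 0 \<and> s \<in> polys_in K \<and> c * f = h * s"
      using csr by auto
  qed
qed

text \<open>The induction step for unique factorization: irreducible elements are prime in the variables
  \<open>J\<close>, and \<open>q\<close> is irreducible and involves one further variable \<open>v\<close>.\<close>

context
  fixes J :: "'v::linorder set" and v :: 'v and q :: "('v, int) mpoly"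
  assumes IH: "\<And>p :: ('v, int) mpoly. p \<in> polys_in J \<Longrightarrow> Factorial_Ring.irreducible p \<Longrightarrow> prime_on J p"
    and v: "v \<notin> J" and q: "Factorial_Ring.irreducible q" "q \<in> polys_in (insert v J)" "vdeg v q > 0"
begin

lemma vdeg_free: "c \<in> polys_in J \<Longrightarrow> vdeg v c = 0"
  using v by (simp add: to_uni_free)

lemma not_dvd_q:
  assumes "Factorial_Ring.irreducible p" "p \<in> polys_in J"
  shows "\<not> p dvd q"
proof
  assume "p dvd q"
  then obtain u where u: "q = p * u" by (elim dvdE)
  then have "u dvd 1" using q(1) assms(1) by (auto simp: irreducible_def)
  then have "q dvd p" unfolding u using mult_dvd_mono[of p p u 1] by simp
  moreover have "p \<noteq> 0" using assms by (auto simp: irreducible_def)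
  ultimately show False using assms(2) q vdeg_free polys_in_dvd[of q p J] by fastforce
qed

text \<open>The prime factors of \<open>c\<close> stay prime when \<open>v\<close> is added and do not divide \<open>q\<close>, so they can be
  cancelled one after the other.\<close>

lemma cancel_coefficient:
  assumes "c \<in> polys_in J" "c \<noteq> 0" "q dvd c * g" "g \<in> polys_in (insert v J)"
  shows "q dvd g"
  using assms(2,1,3)
proof (induction c rule: irreducible_factor_induct)
  case (unit u)
  then show ?case using dvd_mult_unit_iff' by blast
next
  case (mult p c)
  show ?case
  proof (cases "g = 0")
    case False
    have p0: "p * c \<noteq> 0" using mult by (auto simp: irreducible_def)
    have pJ: "p \<in> polys_in J" "c \<in> polys_in J"
      using mult p0 polys_in_factor[of p c J] polys_in_factor[of c p J] by (auto simp: mult.commute)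
    obtain t where t: "p * c * g = q * t" using mult by (auto elim: dvdE)
    then have qt: "t * q \<noteq> 0" "t * q = p * (c * g)" using False p0 by (auto simp: algebra_simps)
    have "t * q \<in> polys_in (insert v J)"
      unfolding qt using pJ assms(4) by (auto intro!: polys_in_mult intro: polys_in_mono)
    then have "t \<in> polys_in (insert v J)" using qt polys_in_factor by blast
    moreover have "p dvd q * t" by (simp flip: t)
    ultimately have "p dvd t"
      using prime_on_insert[OF IH[OF pJ(1) mult(1)] pJ(1) v] q not_dvd_q[OF mult(1) pJ(1)]
      by (auto simp: prime_on_def)
    then obtain t' where "t = p * t'" by (elim dvdE)
    then have "c * g = q * t'" using t p0 by (simp add: algebra_simps)
    then show ?thesis using mult.IH pJ by simp
  qed simp
qed

text \<open>Each prime factor of \<open>c\<close> divides \<open>h\<close> or \<open>s\<close>. Those dividing \<open>h\<close> make up \<open>c1\<close>, and what is left of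
  \<open>h\<close> divides \<open>q\<close>.\<close>

lemma split_off_coefficient:
  assumes "c \<in> polys_in J" "c \<noteq> 0" "c * q = h * s" "h \<in> polys_in (insert v J)" "s \<in> polys_in (insert v J)"
  shows "\<exists>c1 h'. c1 \<in> polys_in J \<and> h = c1 * h' \<and> h' dvd q"
  using assms(2,1,3,4,5)
proof (induction c arbitrary: h s rule: irreducible_factor_induct)
  case (unit u)
  then have "h dvd u * q" by simp
  then have "h dvd q" using unit dvd_mult_unit_iff' by blast
  then show ?case by (intro exI[of _ 1] exI[of _ h]) simp
next
  case (mult p c)
  have p0: "p \<noteq> 0" "p * c \<noteq> 0" "q \<noteq> 0" using mult q by (auto simp: irreducible_def)
  have pJ: "p \<in> polys_in J" "c \<in> polys_in J"
    using mult p0 polys_in_factor[of p c J] polys_in_factor[of c p J] by (auto simp: mult.commute)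
  have h0: "h \<noteq> 0" "s \<noteq> 0" using mult p0 by auto
  have "p dvd h * s" unfolding mult.prems(2)[symmetric] by (simp add: mult.assoc)
  then have "p dvd h \<or> p dvd s"
    using prime_on_insert[OF IH[OF pJ(1) mult(1)] pJ(1) v] mult.prems by (auto simp: prime_on_def)
  then show ?case
  proof
    assume "p dvd h"
    then obtain k where k: "h = p * k" by (elim dvdE)
    then have "c * q = k * s" using mult.prems(2) p0 by (simp add: algebra_simps)
    moreover have "k \<in> polys_in (insert v J)"
      using mult.prems h0 polys_in_dvd[of k h] by (simp add: k)
    ultimately obtain c1 h' where "c1 \<in> polys_in J" "k = c1 * h'" "h' dvd q"
      using mult.IH[OF pJ(2)] mult.prems by blast
    then show ?thesis using pJ by (intro exI[of _ "p * c1"] exI[of _ h']) (auto simp: k polys_in_mult)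
  next
    assume "p dvd s"
    then obtain k where k: "s = p * k" by (elim dvdE)
    then have "c * q = h * k" using mult.prems(2) p0 by (simp add: algebra_simps)
    moreover have "k \<in> polys_in (insert v J)"
      using mult.prems h0 polys_in_dvd[of k s] by (simp add: k)
    ultimately show ?thesis using mult.IH[OF pJ(2)] mult.prems by blast
  qed
qed

text \<open>Let \<open>h\<close> have least degree in \<open>v\<close> in the ideal of all \<open>h\<close> with \<open>q dvd h * g\<close>. If \<open>h\<close> is free of \<open>v\<close>, it
  can be cancelled and \<open>q\<close> divides \<open>g\<close>. Otherwise \<open>q\<close>, being in the ideal, is a multiple of \<open>h\<close> up to
  factors free of \<open>v\<close>, and by irreducibility equals \<open>h\<close> up to such factors; then \<open>q\<close> divides \<open>f\<close>, which
  is in the ideal too.\<close>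

lemma prime_on_extend: "prime_on (insert v J) q"
  unfolding prime_on_def
proof (intro ballI impI)
  fix f g assume f: "f \<in> polys_in (insert v J)" and g: "g \<in> polys_in (insert v J)" and fg: "q dvd f * g"
  let ?K = "insert v J"
  have KJ: "?K - {v} = J" using v by auto
  have q0: "q \<noteq> 0" using q by (auto simp: irreducible_def)
  let ?I = "{h \<in> polys_in ?K. q dvd h * g}"
  obtain h where h: "h \<in> ?I" "h \<noteq> 0"
    and gen: "\<And>f. f \<in> ?I \<Longrightarrow> \<exists>c s. c \<in> polys_in (?K - {v}) \<and> c \<noteq> 0 \<and> s \<in> polys_in ?K \<and> c * f = h * s"
  proof (rule minimal_vdeg_generator[of v ?K ?I q])
    fix f h c s :: "('v, int) mpoly" assume "f \<in> ?I" "h \<in> ?I" "c \<in> polys_in ?K" "s \<in> polys_in ?K"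
    moreover have "(c * f - h * s) * g = c * (f * g) - s * (h * g)" by (simp add: algebra_simps)
    ultimately show "c * f - h * s \<in> ?I" by (auto intro: polys_in_diff polys_in_mult)
  qed (use q q0 in auto)
  show "q dvd f \<or> q dvd g"
  proof (cases "vdeg v h = 0")
    case True
    then have "to_uni v h = [:coeff (to_uni v h) 0:]" by (metis degree_0_id)
    then have "h = coeff (to_uni v h) 0" by (metis poly_to_uni_Var poly_pCons poly_0 mult_zero_right add.right_neutral)
    then have "h \<in> polys_in J" using coeff_to_uni_in[of h ?K v 0] h KJ by auto
    then show ?thesis using cancel_coefficient[of h g] h g by auto
  next
    case False
    obtain c s where cs: "c \<in> polys_in J" "c \<noteq> 0" "s \<in> polys_in ?K" "c * q = h * s"
      using gen[of q] q KJ by auto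
    obtain d t where dt: "d \<in> polys_in J" "d \<noteq> 0" "t \<in> polys_in ?K" "d * f = h * t"
      using gen[of f] f fg KJ by auto
    obtain c1 h' where h': "c1 \<in> polys_in J" "h = c1 * h'" "h' dvd q"
      using split_off_coefficient[OF cs(1,2,4)] h cs(3) by auto
    then obtain s' where s': "q = h' * s'" by (auto elim: dvdE)
    have nz: "c1 \<noteq> 0" "h' \<noteq> 0" using h h' by auto
    have "vdeg v h' > 0" using False vdeg_mult[OF nz, of v] vdeg_free[OF h'(1)] h'(2) by simp
    then have "\<not> h' dvd 1"
      using polys_in_dvd[of h' 1 J] vdeg_free[of h'] by auto
    then have "s' dvd 1" using s' q(1) by (auto simp: irreducible_def)
    then have "q dvd h'" unfolding s' using mult_dvd_mono[of h' h' s' 1] by simp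
    then have "q dvd h" unfolding h'(2) by (rule dvd_mult)
    then have "q dvd d * f" unfolding dt(4) by (rule dvd_mult2)
    from cancel_coefficient[OF dt(1,2) this f] show ?thesis ..
  qed
qed

end

lemma vdeg_0_imp:
  assumes "p \<in> polys_in K" "vdeg v p = 0"
  shows "p \<in> polys_in (K - {v})"
proof -
  have "to_uni v p = [:coeff (to_uni v p) 0:]" using assms by (metis degree_0_id)
  then have "p = coeff (to_uni v p) 0"
    by (metis poly_to_uni_Var poly_pCons poly_0 mult_zero_right add.right_neutral)
  then show ?thesis using coeff_to_uni_in[OF assms(1), of v 0] by simp
qed

lemma Const_dvd_iff: "Const a dvd (Const b :: ('v, 'c::comm_ring_1) mpoly) \<longleftrightarrow> a dvd b"
proof
  assume "Const a dvd (Const b :: ('v, 'c) mpoly)"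
  then obtain k :: "('v, 'c) mpoly" where "Const b = Const a * k" by (elim dvdE)
  then have "b = a * Poly_Mapping.lookup k 0" by (metis lookup_Const_mult lookup_single_eq)
  then show "a dvd b" by simp
next
  assume "a dvd b"
  then obtain k where "b = a * k" by (elim dvdE)
  then have "Const b = Const a * (Const k :: ('v, 'c) mpoly)" by (simp add: mult_single)
  then show "Const a dvd (Const b :: ('v, 'c) mpoly)" by simp
qed

lemma irreducible_prime_on:
  fixes q :: "('v::linorder, int) mpoly"
  assumes "finite J" "q \<in> polys_in J" "Factorial_Ring.irreducible q"
  shows "prime_on J q"
  using assms
proof (induction J arbitrary: q rule: finite_induct)
  case empty
  then obtain c where c: "q = Const c" by (auto simp: polys_in_empty_iff)
  have "Factorial_Ring.irreducible c"
  proof (rule irreducibleI)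
    show "c \<noteq> 0" using empty c by auto
    have "\<not> Const c dvd (Const 1 :: ('v, int) mpoly)" using empty c by (auto simp: irreducible_def)
    then show "\<not> c dvd 1" unfolding Const_dvd_iff .
    fix a b assume "c = a * b"
    then have "q = Const a * Const b" by (simp add: c mult_single)
    then have "Const a dvd (Const 1 :: ('v, int) mpoly) \<or> Const b dvd (Const 1 :: ('v, int) mpoly)"
      using empty by (auto simp: irreducible_def)
    then show "a dvd 1 \<or> b dvd 1" unfolding Const_dvd_iff .
  qed
  then have "prime_elem c" by (rule irreducible_imp_prime_elem)
  then show ?case
    by (auto simp: prime_on_def polys_in_empty_iff c mult_single Const_dvd_iff prime_elem_dvd_mult_iff)
next
  case (insert v J)
  show ?case
  proof (cases "vdeg v q = 0")
    case True
    then have "q \<in> polys_in J" using vdeg_0_imp[OF insert(4) True] insert(2) by simp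
    then show ?thesis using insert prime_on_insert by blast
  next
    case False
    then show ?thesis using prime_on_extend[of J v q] insert by blast
  qed
qed

theorem irreducible_imp_prime_elem_mpoly:
  fixes q :: "('v::linorder, int) mpoly"
  assumes "Factorial_Ring.irreducible q"
  shows "prime_elem q"
proof (rule prime_elemI)
  fix f g assume dvd: "q dvd f * g"
  obtain J1 J2 J3 where J: "finite J1" "q \<in> polys_in J1" "finite J2" "f \<in> polys_in J2" "finite J3" "g \<in> polys_in J3"
    by (metis finite_vars)
  let ?J = "J1 \<union> J2 \<union> J3"
  have *: "q \<in> polys_in ?J" "f \<in> polys_in ?J" "g \<in> polys_in ?J" using J by (auto intro: polys_in_mono)
  have "prime_on ?J q" using irreducible_prime_on[OF _ *(1) assms] J by auto
  with * dvd show "q dvd f \<or> q dvd g" by (auto simp: prime_on_def)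
qed (use assms in \<open>auto simp: irreducible_def\<close>)

section \<open>Zeros of hypersurfaces\<close>

lemma comm_semiring_hom_of_int: "comm_semiring_hom (of_int :: int \<Rightarrow> 'a::comm_ring_1)"
  by unfold_locales auto

lemmas of_int_mpeval =
  comm_semiring_hom.mpeval_add[OF comm_semiring_hom_of_int]
  comm_semiring_hom.mpeval_mult[OF comm_semiring_hom_of_int]

lemma poly_map_to_uni_of_int:
  "poly (map_poly (\<lambda>c. mpeval of_int c x) (to_uni v p)) t = mpeval of_int p (x(v := t :: complex))"
  by (rule poly_map_to_uni) (rule comm_semiring_hom_of_int)

text \<open>Choose the other coordinates such that the leading coefficient in \<open>v\<close> does not vanish; then only
  finitely many values of the coordinate \<open>v\<close> are excluded.\<close>

lemma nonzero_point:
  fixes p :: "('v, int) mpoly"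
  assumes "finite J" "p \<in> polys_in J" "p \<noteq> 0"
  shows "\<exists>x\<in>coord_space J. mpeval of_int p x \<noteq> (0::complex)"
  using assms
proof (induction J arbitrary: p rule: finite_induct)
  case empty
  then obtain c where "p = Const c" by (auto simp: polys_in_empty_iff)
  then show ?case using empty by (auto simp: coord_space_def)
next
  case (insert v J)
  have "lead_coeff (to_uni v p) \<in> polys_in J" "lead_coeff (to_uni v p) \<noteq> 0"
    using coeff_to_uni_in[OF insert(4), of v "vdeg v p"] insert by auto
  then obtain x where x: "x \<in> coord_space J" "mpeval of_int (lead_coeff (to_uni v p)) x \<noteq> (0::complex)"
    using insert.IH by blast
  let ?r = "map_poly (\<lambda>c. mpeval of_int c x) (to_uni v p)"
  have "coeff ?r (vdeg v p) \<noteq> 0" using x by (simp add: coeff_map_poly)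
  then have "?r \<noteq> 0" by auto
  then obtain t where "poly ?r t \<noteq> 0"
    by (metis poly_all_0_iff_0)
  then have "mpeval of_int p (x(v := t)) \<noteq> 0" by (simp add: poly_map_to_uni_of_int)
  moreover have "x(v := t) \<in> coord_space (insert v J)" using x by (auto simp: coord_space_def)
  ultimately show ?case by blast
qed

text \<open>If \<open>q\<close> does not divide \<open>p\<close>, then eliminating \<open>v\<close> from \<open>q\<close> and \<open>p\<close> gives a nonzero
  \<open>h = a * q + b * p\<close> free of \<open>v\<close>. At a point where neither \<open>h\<close> nor the leading coefficient of \<open>q\<close> in \<open>v\<close>
  vanishes, the coordinate \<open>v\<close> can be changed to a root of \<open>q\<close>. There \<open>p\<close> vanishes too, but \<open>h\<close> still
  does not.\<close>

theorem hypersurface_nullstellensatz: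
  fixes p q :: "('v::linorder, int) mpoly"
  assumes q: "Factorial_Ring.irreducible q" and v: "vdeg v q > 0"
    and J: "finite J" "p \<in> polys_in J" "q \<in> polys_in J"
    and zero: "\<And>x. x \<in> coord_space J \<Longrightarrow> mpeval of_int q x = (0::complex) \<Longrightarrow> mpeval of_int p x = (0::complex)"
  shows "q dvd p"
proof -
  have q0: "q \<noteq> 0" using q by (auto simp: irreducible_def)
  have prime: "prime_elem q" using q by (rule irreducible_imp_prime_elem_mpoly)
  have vJ: "v \<in> J"
  proof (rule ccontr)
    assume "v \<notin> J"
    then show False using v to_uni_free[OF J(3)] by simp
  qed
  let ?I = "{a * q + b * p | a b. a \<in> polys_in J \<and> b \<in> polys_in J}"
  have q_in: "q \<in> ?I" by (rule CollectI, rule exI[of _ 1], rule exI[of _ 0]) simp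
  have p_in: "p \<in> ?I" by (rule CollectI, rule exI[of _ 0], rule exI[of _ 1]) simp
  \<comment> \<open>an element of least degree in \<open>v\<close>; it is free of \<open>v\<close> unless \<open>q\<close> divides \<open>p\<close>\<close>
  obtain h where h: "h \<in> ?I" "h \<noteq> 0"
    and gen: "\<And>f. f \<in> ?I \<Longrightarrow> \<exists>c s. c \<in> polys_in (J - {v}) \<and> c \<noteq> 0 \<and> s \<in> polys_in J \<and> c * f = h * s"
  proof (rule minimal_vdeg_generator[of v J ?I q])
    show "?I \<subseteq> polys_in J" using J by (auto intro!: polys_in_add polys_in_mult)
    fix f h c s :: "('v, int) mpoly" assume "f \<in> ?I" "h \<in> ?I" and cs: "c \<in> polys_in J" "s \<in> polys_in J"
    then obtain a b a' b' where f: "f = a * q + b * p" "a \<in> polys_in J" "b \<in> polys_in J"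
      and h: "h = a' * q + b' * p" "a' \<in> polys_in J" "b' \<in> polys_in J" by blast
    have "c * f - h * s = (c * a - a' * s) * q + (c * b - b' * s) * p"
      by (simp add: f h algebra_simps)
    moreover have "c * a - a' * s \<in> polys_in J" "c * b - b' * s \<in> polys_in J"
      using cs f h by (auto intro!: polys_in_diff polys_in_mult)
    ultimately show "c * f - h * s \<in> ?I" by blast
  qed (use vJ q_in q0 in auto)
  obtain a b where ab: "h = a * q + b * p" "a \<in> polys_in J" "b \<in> polys_in J" using h(1) by blast
  then have hJ: "h \<in> polys_in J" using J by (auto intro!: polys_in_add polys_in_mult)
  show ?thesis
  proof (cases "vdeg v h = 0")
    case True
    then have hv: "h \<in> polys_in (J - {v})" using vdeg_0_imp[OF hJ] by simp
    let ?l = "lead_coeff (to_uni v q)"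
    have "?l \<in> polys_in (J - {v})" "?l \<noteq> 0" using coeff_to_uni_in[OF J(3)] q0 by auto
    then have "h * ?l \<in> polys_in (J - {v})" "h * ?l \<noteq> 0" using hv h by (auto intro: polys_in_mult)
    then obtain x where x: "x \<in> coord_space (J - {v})" "mpeval of_int (h * ?l) x \<noteq> (0::complex)"
      using nonzero_point[of "J - {v}"] J(1) by blast
    then have hx: "mpeval of_int h x \<noteq> (0::complex)" and lx: "mpeval of_int ?l x \<noteq> (0::complex)"
      by (auto simp: of_int_mpeval)
    let ?r = "map_poly (\<lambda>c. mpeval of_int c x) (to_uni v q)"
    have "coeff ?r (vdeg v q) \<noteq> 0" using lx by (simp add: coeff_map_poly)
    then have "Polynomial.degree ?r \<noteq> 0" using v le_degree[of ?r "vdeg v q"] by linarith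
    then obtain t where "poly ?r t = 0"
      using fundamental_theorem_of_algebra[of ?r] by (auto simp: constant_degree)
    then have "mpeval of_int q (x(v := t)) = 0" by (simp add: poly_map_to_uni_of_int)
    moreover have "x(v := t) \<in> coord_space J" using x vJ by (auto simp: coord_space_def)
    ultimately have "mpeval of_int h (x(v := t)) = 0"
      using zero by (simp add: ab of_int_mpeval)
    moreover have "mpeval of_int h (x(v := t)) = mpeval of_int h x"
      using hv by (rule mpeval_cong) auto
    ultimately show ?thesis using hx by simp
  next
    case False
    have free: "vdeg v c = 0" if "c \<in> polys_in (J - {v})" for c :: "('v, int) mpoly"
      using that by (simp add: to_uni_free)
    obtain c s where cs: "c \<in> polys_in (J - {v})" "c \<noteq> 0" "s \<in> polys_in J" "c * q = h * s" using gen[OF q_in] by blast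
    obtain d t where dt: "d \<in> polys_in (J - {v})" "d \<noteq> 0" "t \<in> polys_in J" "d * p = h * t" using gen[OF p_in] by blast
    have "q dvd h * s" by (simp flip: cs(4))
    then have "q dvd h \<or> q dvd s" using prime by (simp add: prime_elem_dvd_mult_iff)
    moreover have "\<not> q dvd s"
    proof
      assume "q dvd s"
      then obtain k where "s = q * k" by (elim dvdE)
      then have "c = h * k" using cs(4) q0 by (simp add: algebra_simps)
      then have "h \<in> polys_in (J - {v})" using cs(1,2) polys_in_factor[of h k "J - {v}"] by simp
      from free[OF this] show False using False by simp
    qed
    ultimately have "q dvd d * p" unfolding dt(4) by (intro dvd_mult2) blast
    then have "q dvd d \<or> q dvd p" using prime by (simp add: prime_elem_dvd_mult_iff)
    moreover have "\<not> q dvd d"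
      using polys_in_dvd[OF _ dt(1,2)] free v by fastforce
    ultimately show ?thesis by blast
  qed
qed

section \<open>Weighted homogeneity\<close>

lemma whomog_0 [simp]: "whomog w n 0"
  by (simp add: whomog_def)

lemma whomog_Const: "whomog w 0 (Const c)"
  by (simp add: whomog_def)

lemma whomog_Var: "w v = n \<Longrightarrow> whomog w n (Var v)"
  by (simp add: whomog_def Var_def)

lemma whomog_add: "whomog w n p \<Longrightarrow> whomog w n q \<Longrightarrow> whomog w n (p + q)"
  by (auto simp: whomog_def dest!: subsetD[OF Poly_Mapping.keys_add])

lemma whomog_uminus: "whomog w n p \<Longrightarrow> whomog w n (- p)"
  by (auto simp: whomog_def in_keys_iff)

lemma whomog_diff:
  "whomog w n p \<Longrightarrow> whomog w n q \<Longrightarrow> whomog w n (p - q :: ('v, 'c::ab_group_add) mpoly)"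
  using whomog_add[of w n p "- q"] whomog_uminus[of w n q] by simp

lemma whomog_sum: "(\<And>a. a \<in> A \<Longrightarrow> whomog w n (f a)) \<Longrightarrow> whomog w n (sum f A)"
  by (induction A rule: infinite_finite_induct) (auto intro: whomog_add)

lemma whomog_mult:
  "whomog w n p \<Longrightarrow> whomog w k q \<Longrightarrow> whomog w (n + k) (p * q :: ('v, 'c::semiring_0) mpoly)"
  by (fastforce simp: whomog_def wdeg_add dest!: subsetD[OF Poly_Mapping.keys_mult])

lemma whomog_prod:
  "(\<And>a. a \<in> A \<Longrightarrow> whomog w (n a) (f a)) \<Longrightarrow>
    whomog w (sum n A) (prod f A :: ('v, 'c::comm_semiring_1) mpoly)"
proof (induction A rule: infinite_finite_induct)
  case (insert a A)
  then show ?case by (auto intro: whomog_mult)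
qed (simp_all add: whomog_def)

lemma whomog_power:
  "whomog w n p \<Longrightarrow> whomog w (n * k) (p ^ k :: ('v, 'c::comm_semiring_1) mpoly)"
  using whomog_prod[of "{..<k}" w "\<lambda>_. n" "\<lambda>_. p"] by (simp add: mult.commute)

lemma whomog_eval_scale:
  assumes "whomog w n p"
  shows "mpeval h p (\<lambda>v. c ^ w v * x v) = c ^ n * mpeval h p x"
proof -
  have "h (Poly_Mapping.lookup p m) * mono_eval m (\<lambda>v. c ^ w v * x v) =
      c ^ n * (h (Poly_Mapping.lookup p m) * mono_eval m x)" if "m \<in> Poly_Mapping.keys p" for m
    using assms that by (simp add: whomog_def mono_eval_scale mult.left_commute)
  then show ?thesis by (simp add: mpeval_def sum_distrib_left)
qed

text \<open>In a monomial the order of vanishing at \<open>0\<close> equals the degree. For each factor the former is at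
  most the latter, and both add up in products.\<close>

lemma factor_of_monom:
  fixes A B :: "'a::idom poly"
  assumes "A * B = Polynomial.monom c n" "c \<noteq> 0"
  obtains c' k where "A = Polynomial.monom c' k"
proof -
  have nz: "A * B \<noteq> 0" "A \<noteq> 0" "B \<noteq> 0" using assms by auto
  have "order 0 (A * B) = n" using assms by (simp add: order_0_monom)
  moreover have "Polynomial.degree (A * B) = n" using assms by (simp add: degree_monom_eq)
  ultimately have "order 0 A + order 0 B = Polynomial.degree A + Polynomial.degree B"
    using nz by (simp add: order_mult degree_mult_eq)
  then have oA: "order 0 A = Polynomial.degree A"
    using order_degree[OF nz(2), of 0] order_degree[OF nz(3), of 0] by linarith
  have "coeff A k = 0" if "k \<noteq> Polynomial.degree A" for k
  proof (cases "k < Polynomial.degree A")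
    case True
    have "Polynomial.monom 1 (Polynomial.degree A) dvd A"
      using order_1[of 0 A] unfolding oA by (simp add: x_as_monom monom_power)
    then show ?thesis using True by (auto simp: monom_1_dvd_iff')
  qed (use that in \<open>auto simp: coeff_eq_0\<close>)
  then have "A = Polynomial.monom (lead_coeff A) (Polynomial.degree A)"
    by (intro poly_eqI) auto
  then show ?thesis by (rule that)
qed

lemma whomog_factor:
  fixes p q :: "('v::linorder, 'c::idom) mpoly"
  assumes "whomog w n (p * q)" "p * q \<noteq> 0"
  obtains k where "k \<le> n" "whomog w k p"
proof -
  have *: "grade w p * grade w q = Polynomial.monom (p * q) n"
    using assms(1) by (simp add: whomog_iff_grade grade.hom_mult)
  then obtain c k where k: "grade w p = Polynomial.monom c k"
    using assms(2) by (rule factor_of_monom)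
  have "wdeg w m = k" if "m \<in> Poly_Mapping.keys p" for m
  proof -
    have "Poly_Mapping.lookup (coeff (grade w p) (wdeg w m)) m \<noteq> 0"
      using that by (simp add: lookup_coeff_grade in_keys_iff)
    then show ?thesis by (auto simp: k split: if_splits)
  qed
  then have "whomog w k p" by (simp add: whomog_def)
  moreover have "k \<le> n"
  proof -
    have "c \<noteq> 0" using k assms(2) by (metis grade_eq_0_iff monom_eq_0 mult_zero_left)
    then have "Polynomial.degree (grade w p) = k" by (simp add: k degree_monom_eq)
    moreover have "n = Polynomial.degree (grade w p) + Polynomial.degree (grade w q)"
      using assms(2) * degree_mult_eq[of "grade w p" "grade w q"] by (simp add: degree_monom_eq)
    ultimately show ?thesis by simp
  qed
  ultimately show ?thesis using that by blast
qed

lemma vdeg_le: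
  assumes "\<And>m. m \<in> Poly_Mapping.keys p \<Longrightarrow> Poly_Mapping.lookup m v \<le> n"
  shows "vdeg v p \<le> n"
  unfolding to_uni_def mpeval_def
proof (rule degree_sum_le)
  fix m assume m: "m \<in> Poly_Mapping.keys p"
  let ?x = "\<lambda>u. if u = v then [:0, 1:] else [:Var u:] :: ('a, 'b) mpoly poly"
  have deg: "Polynomial.degree (?x u ^ k) \<le> (if u = v then k else 0)" for u k
    using degree_power_le[of "?x u" k] by auto
  have "Polynomial.degree (mono_eval m ?x) \<le>
      (\<Sum>u\<in>Poly_Mapping.keys m. Polynomial.degree (?x u ^ Poly_Mapping.lookup m u))"
    unfolding mono_eval_def using degree_prod_sum_le[of "Poly_Mapping.keys m"] by (simp add: o_def)
  also have "\<dots> \<le> (\<Sum>u\<in>Poly_Mapping.keys m. if u = v then Poly_Mapping.lookup m u else 0)"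
    by (intro sum_mono deg)
  also have "\<dots> \<le> Poly_Mapping.lookup m v" by (simp add: sum.delta)
  also have "\<dots> \<le> n" using m by (rule assms)
  finally show "Polynomial.degree ([:Const (Poly_Mapping.lookup p m):] * mono_eval m ?x) \<le> n"
    using degree_mult_le[of "[:Const (Poly_Mapping.lookup p m):]" "mono_eval m ?x"] by simp
qed simp

section \<open>Tuples of forms\<close>

lemma lookup_le_mdeg: "Poly_Mapping.lookup m v \<le> mdeg m"
  unfolding mdeg_def by (cases "v \<in> Poly_Mapping.keys m") (auto intro: member_le_sum simp: in_keys_iff)

lemma mdeg_monomials: "m \<in> monomials N d \<Longrightarrow> (\<Sum>j\<le>N. Poly_Mapping.lookup m j) = d"
  using wdeg_superset[of "{..N}" m "\<lambda>_. 1"] by (auto simp: monomials_def mdeg_eq_wdeg)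

lemma finite_monomials [simp]: "finite (monomials N d)"
proof -
  have "inj_on (\<lambda>m. restrict (Poly_Mapping.lookup m) {..N}) (monomials N d)"
  proof (rule inj_onI, rule poly_mapping_eqI)
    fix m m' j assume m: "m \<in> monomials N d" "m' \<in> monomials N d"
      and eq: "restrict (Poly_Mapping.lookup m) {..N} = restrict (Poly_Mapping.lookup m') {..N}"
    show "Poly_Mapping.lookup m j = Poly_Mapping.lookup m' j"
    proof (cases "j \<le> N")
      case True
      then show ?thesis using fun_cong[OF eq, of j] by simp
    next
      case False
      then have "j \<notin> Poly_Mapping.keys m" "j \<notin> Poly_Mapping.keys m'"
        using m by (auto simp: monomials_def)
      then show ?thesis by (simp add: in_keys_iff)
    qed
  qed
  moreover have "(\<lambda>m. restrict (Poly_Mapping.lookup m) {..N}) ` monomials N d \<subseteq> {..N} \<rightarrow>\<^sub>E {..d}"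
    using lookup_le_mdeg by (intro image_subsetI restrict_PiE_iff[THEN iffD2]) (auto simp: monomials_def)
  ultimately show ?thesis
    by (rule inj_on_finite) (auto intro: finite_PiE)
qed

lemma finite_coeff_index [simp]: "finite (coeff_index N d)"
  by (simp add: coeff_index_def)

lemma power_monomial: "i \<le> N \<Longrightarrow> Poly_Mapping.single i d \<in> monomials N d"
  by (auto simp: monomials_def mdeg_eq_wdeg)

lemma lookup_tuple_form:
  "Poly_Mapping.lookup (tuple_form N d a i) m = (if m \<in> monomials N d then a (i, m) else 0)"
  by (simp add: tuple_form_def lookup_sum lookup_single when_def sum.delta)

lemma eval_tuple_form:
  "mpeval id (tuple_form N d a i) x = (\<Sum>m\<in>monomials N d. a (i, m) * mono_eval m x)"
proof -
  have "Poly_Mapping.keys (tuple_form N d a i) \<subseteq> monomials N d"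
    by (auto simp: in_keys_iff lookup_tuple_form split: if_splits)
  then show ?thesis by (subst mpeval_superset) (auto simp: lookup_tuple_form intro: sum.cong)
qed

text \<open>The coordinates of a tuple of forms, inverse to \<open>tuple_form\<close>.\<close>

definition form_coeffs ::
  "nat \<Rightarrow> nat \<Rightarrow> (nat \<Rightarrow> (nat, complex) mpoly) \<Rightarrow> coeff_ix \<Rightarrow> complex" where
  "form_coeffs N d p = (\<lambda>(i, m). if (i, m) \<in> coeff_index N d then Poly_Mapping.lookup (p i) m else 0)"

lemma form_coeffs_in_coord_space: "form_coeffs N d p \<in> coord_space (coeff_index N d)"
  by (auto simp: form_coeffs_def coord_space_def)

lemma tuple_form_form_coeffs:
  assumes "i \<le> N" "p i \<in> polys_in {..N}" "whomog (\<lambda>_. 1) d (p i)"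
  shows "tuple_form N d (form_coeffs N d p) i = p i"
proof (rule poly_mapping_eqI)
  fix m
  have "m \<in> monomials N d" if "m \<in> Poly_Mapping.keys (p i)"
    using assms(2,3) that by (auto simp: polys_in_def whomog_def monomials_def mdeg_eq_wdeg)
  then show "Poly_Mapping.lookup (tuple_form N d (form_coeffs N d p) i) m = Poly_Mapping.lookup (p i) m"
    using assms(1) by (auto simp: lookup_tuple_form form_coeffs_def coeff_index_def in_keys_iff)
qed

text \<open>The degree in the coefficients of the \<open>i\<close>-th form.\<close>

abbreviation block_weight :: "nat \<Rightarrow> coeff_ix \<Rightarrow> nat" where
  "block_weight i \<equiv> \<lambda>v. if fst v = i then 1 else 0"

lemma mdeg_eq_sum_blocks:
  assumes "Poly_Mapping.keys m \<subseteq> coeff_index N d"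
  shows "mdeg m = (\<Sum>i\<le>N. wdeg (block_weight i) m)"
proof -
  have "(\<Sum>i\<le>N. wdeg (block_weight i) m) =
    (\<Sum>v\<in>Poly_Mapping.keys m. \<Sum>i\<le>N. if fst v = i then Poly_Mapping.lookup m v else 0)"
    unfolding wdeg_def by (subst sum.swap) (intro sum.cong refl; simp)
  also have "\<dots> = mdeg m"
    unfolding mdeg_def using assms by (intro sum.cong) (auto simp: sum.delta coeff_index_def)
  finally show ?thesis ..
qed

section \<open>The Macaulay determinant\<close>

text \<open>The rows and columns of the Macaulay matrix are the monomials of the critical degree
  \<open>crit\<close>. By the pigeonhole principle each of them is divisible by some \<open>x\<^sub>j ^ d\<close>; a choice of \<open>j\<close> turns it
  into a multiple \<open>m * f\<^sub>j\<close> of the \<open>j\<close>-th form, whose coefficients are the row. To minimise the degree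
  in the coefficients of \<open>f\<close> with index \<open>i0\<close>, this index is chosen only if there is no other.\<close>

context
  fixes N d i0 :: nat
  assumes d: "d \<ge> 1" and i0: "i0 \<le> N"
begin

definition crit :: nat where
  "crit = (N + 1) * (d - 1) + 1"

definition row_form :: "nat monomial \<Rightarrow> nat" where
  "row_form m = (if \<exists>j\<le>N. j \<noteq> i0 \<and> d \<le> Poly_Mapping.lookup m j
    then SOME j. j \<le> N \<and> j \<noteq> i0 \<and> d \<le> Poly_Mapping.lookup m j else i0)"

lemma row_form:
  assumes "m \<in> monomials N crit"
  shows "row_form m \<le> N" "d \<le> Poly_Mapping.lookup m (row_form m)"
proof -
  have "row_form m \<le> N \<and> d \<le> Poly_Mapping.lookup m (row_form m)"
  proof (cases "\<exists>j\<le>N. j \<noteq> i0 \<and> d \<le> Poly_Mapping.lookup m j")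
    case True
    then have "\<exists>j. j \<le> N \<and> j \<noteq> i0 \<and> d \<le> Poly_Mapping.lookup m j" by blast
    from someI_ex[OF this] show ?thesis using True by (simp add: row_form_def)
  next
    case False
    have "d \<le> Poly_Mapping.lookup m i0"
    proof (rule ccontr)
      assume "\<not> d \<le> Poly_Mapping.lookup m i0"
      then have "Poly_Mapping.lookup m j \<le> d - 1" if "j \<le> N" for j
        proof -
        have "Poly_Mapping.lookup m j < d"
          using False that \<open>\<not> d \<le> Poly_Mapping.lookup m i0\<close> by (cases "j = i0") (auto simp: not_le[symmetric])
        then show ?thesis by simp
      qed
      then have "(\<Sum>j\<le>N. Poly_Mapping.lookup m j) \<le> of_nat (card {..N}) * (d - 1)"
        by (intro sum_bounded_above) auto
      then show False using mdeg_monomials[OF assms] by (simp add: crit_def)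
    qed
    with False i0 show ?thesis by (auto simp: row_form_def)
  qed
  then show "row_form m \<le> N" "d \<le> Poly_Mapping.lookup m (row_form m)" by auto
qed

text \<open>In a row that belongs to \<open>i0\<close> all other exponents are less than \<open>d\<close>, and they determine the monomial
  since its degree is fixed.\<close>

lemma card_row_form: "card {m \<in> monomials N crit. row_form m = i0} \<le> d ^ N"
proof -
  let ?S = "{m \<in> monomials N crit. row_form m = i0}" and ?J = "{..N} - {i0}"
  have small: "Poly_Mapping.lookup m j < d" if "m \<in> ?S" "j \<in> ?J" for m j
  proof (rule ccontr)
    assume "\<not> Poly_Mapping.lookup m j < d"
    then have ex: "\<exists>j. j \<le> N \<and> j \<noteq> i0 \<and> d \<le> Poly_Mapping.lookup m j" using that by auto
    from someI_ex[OF this] ex that show False by (auto simp: row_form_def)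
  qed
  have "inj_on (\<lambda>m. restrict (Poly_Mapping.lookup m) ?J) ?S"
  proof (rule inj_onI, rule poly_mapping_eqI)
    fix m m' j assume m: "m \<in> ?S" "m' \<in> ?S"
      and eq: "restrict (Poly_Mapping.lookup m) ?J = restrict (Poly_Mapping.lookup m') ?J"
    have eq': "Poly_Mapping.lookup m j = Poly_Mapping.lookup m' j" if "j \<in> ?J" for j
      using fun_cong[OF eq, of j] that by simp
    have "(\<Sum>j\<le>N. Poly_Mapping.lookup m j) = (\<Sum>j\<le>N. Poly_Mapping.lookup m' j)"
      using m mdeg_monomials[of m N crit] mdeg_monomials[of m' N crit] by simp
    moreover have "(\<Sum>j\<in>?J. Poly_Mapping.lookup m j) = (\<Sum>j\<in>?J. Poly_Mapping.lookup m' j)"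
      using eq' by (rule sum.cong[OF refl])
    ultimately have "Poly_Mapping.lookup m i0 = Poly_Mapping.lookup m' i0"
      using i0 by (simp add: sum.remove[of "{..N}" i0])
    moreover have "Poly_Mapping.lookup m j = 0" "Poly_Mapping.lookup m' j = 0" if "\<not> j \<le> N"
      using m that by (auto simp: monomials_def in_keys_iff)
    ultimately show "Poly_Mapping.lookup m j = Poly_Mapping.lookup m' j"
      using eq'[of j] by (cases "j \<le> N"; cases "j = i0") auto
  qed
  then have "card ?S \<le> card (?J \<rightarrow>\<^sub>E {..<d})"
  proof (rule card_inj_on_le)
    show "(\<lambda>m. restrict (Poly_Mapping.lookup m) ?J) ` ?S \<subseteq> ?J \<rightarrow>\<^sub>E {..<d}"
      using small by (intro image_subsetI restrict_PiE_iff[THEN iffD2]) blast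
  qed (simp add: finite_PiE)
  also have "\<dots> = d ^ N" using i0 by (simp add: card_PiE)
  finally show ?thesis .
qed

definition cofactor :: "nat monomial \<Rightarrow> nat monomial" where
  "cofactor m = m - Poly_Mapping.single (row_form m) d"

lemma cofactor_add:
  assumes "m \<in> monomials N crit"
  shows "cofactor m + Poly_Mapping.single (row_form m) d = m"
  using row_form(2)[OF assms]
  by (intro poly_mapping_eqI) (auto simp: cofactor_def lookup_add lookup_minus lookup_single when_def)

lemma cofactor_times:
  assumes "m \<in> monomials N crit" "\<mu> \<in> monomials N d"
  shows "cofactor m + \<mu> \<in> monomials N crit"
proof -
  have c: "cofactor m + Poly_Mapping.single (row_form m) d \<in> monomials N crit"
    using assms by (simp add: cofactor_add)
  then have "mdeg (cofactor m + \<mu>) = crit"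
    using assms(2) by (simp add: monomials_def mdeg_eq_wdeg wdeg_add)
  moreover have "Poly_Mapping.keys (cofactor m + \<mu>) \<subseteq> {..N}"
  proof -
    have "Poly_Mapping.keys (cofactor m) \<subseteq> Poly_Mapping.keys m"
      by (auto simp: cofactor_def in_keys_iff lookup_minus)
    then show ?thesis
      using assms by (fastforce simp: monomials_def dest!: subsetD[OF Poly_Mapping.keys_add])
  qed
  ultimately show ?thesis by (simp add: monomials_def)
qed

definition macaulay_entry :: "nat monomial \<Rightarrow> nat monomial \<Rightarrow> (coeff_ix, int) mpoly" where
  "macaulay_entry m m' =
    (if \<exists>\<mu>\<in>monomials N d. m' = cofactor m + \<mu> then Var (row_form m, m' - cofactor m) else 0)"

lemma macaulay_entry_cofactor:
  "\<mu> \<in> monomials N d \<Longrightarrow> macaulay_entry m (cofactor m + \<mu>) = Var (row_form m, \<mu>)"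
  by (auto simp: macaulay_entry_def)

text \<open>Applying a row to the vector of all monomials evaluated at \<open>x\<close> gives the value at \<open>x\<close> of the
  corresponding multiple of a form.\<close>

lemma macaulay_row:
  assumes m: "m \<in> monomials N crit"
  shows "(\<Sum>m'\<in>monomials N crit. mpeval of_int (macaulay_entry m m') a * mono_eval m' x) =
    mono_eval (cofactor m) x * mpeval id (tuple_form N d a (row_form m)) (x :: nat \<Rightarrow> complex)"
proof -
  let ?A = "(\<lambda>\<mu>. cofactor m + \<mu>) ` monomials N d"
  have "(\<Sum>m'\<in>monomials N crit. mpeval of_int (macaulay_entry m m') a * mono_eval m' x) =
    (\<Sum>m'\<in>?A. mpeval of_int (macaulay_entry m m') a * mono_eval m' x)"
    using m by (intro sum.mono_neutral_right)
      (auto simp: macaulay_entry_def cofactor_times comm_semiring_hom.mpeval_0[OF comm_semiring_hom_of_int])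
  also have "\<dots> = (\<Sum>\<mu>\<in>monomials N d. a (row_form m, \<mu>) * (mono_eval (cofactor m) x * mono_eval \<mu> x))"
    by (subst sum.reindex) (auto simp: inj_on_def macaulay_entry_cofactor mono_eval_add
      comm_semiring_hom.mpeval_Var[OF comm_semiring_hom_of_int])
  also have "\<dots> = mono_eval (cofactor m) x * mpeval id (tuple_form N d a (row_form m)) x"
    by (simp add: eval_tuple_form sum_distrib_left algebra_simps)
  finally show ?thesis .
qed

text \<open>At a tuple with a common zero \<open>x\<close> the matrix kills the vector of monomials at \<open>x\<close>. At the tuple of
  powers \<open>x\<^sub>i ^ d\<close> it is the identity. Each term of the Leibniz formula takes from every row one
  coefficient of the form belonging to that row, so its degree in a block is the number of rows
  belonging to it.\<close>

lemma macaulay_determinant: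
  obtains \<Delta> :: "(coeff_ix, int) mpoly"
  where "\<Delta> \<in> polys_in (coeff_index N d)"
    and "mpeval of_int \<Delta> (power_tuple N d) = (1::complex)"
    and "\<And>a x. a \<in> coord_space (coeff_index N d) \<Longrightarrow> x \<in> coord_space {..N} \<Longrightarrow> x \<noteq> (\<lambda>_. 0) \<Longrightarrow>
      \<forall>i\<le>N. mpeval id (tuple_form N d a i) x = 0 \<Longrightarrow> mpeval of_int \<Delta> a = (0::complex)"
    and "\<And>i. \<exists>n. whomog (block_weight i) n \<Delta>"
    and "\<exists>n\<le>d ^ N. whomog (block_weight i0) n \<Delta>"
proof -
  let ?T = "monomials N crit"
  define n where "n = card ?T"
  obtain b where b: "bij_betw b {0..<n} ?T"
    using ex_bij_betw_nat_finite[OF finite_monomials] unfolding n_def by blast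
  then have bT: "b i \<in> ?T" if "i < n" for i using that by (auto simp: bij_betw_def)
  have b_eq: "b i = b j \<longleftrightarrow> i = j" if "i < n" "j < n" for i j
    using b that by (auto simp: bij_betw_def inj_on_def)
  define A where "A = mat n n (\<lambda>(i, j). macaulay_entry (b i) (b j))"
  have A: "A \<in> carrier_mat n n" by (simp add: A_def)
  have entry: "A $$ (i, p i) = macaulay_entry (b i) (b (p i))" if "p permutes {0..<n}" "i < n" for p i
    using that permutes_in_image[OF that(1), of i] by (simp add: A_def)
  have ev: "mpeval of_int (det A) a = det (mat n n (\<lambda>(i, j). mpeval of_int (macaulay_entry (b i) (b j)) a))"
    for a :: "coeff_ix \<Rightarrow> complex"
  proof -
    interpret e: comm_ring_hom "\<lambda>p. mpeval of_int p a"
      by unfold_locales (auto simp: of_int_mpeval comm_semiring_hom.mpeval_0[OF comm_semiring_hom_of_int]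
        comm_semiring_hom.mpeval_1[OF comm_semiring_hom_of_int])
    have "map_mat (\<lambda>p. mpeval of_int p a) A = mat n n (\<lambda>(i, j). mpeval of_int (macaulay_entry (b i) (b j)) a)"
      by (rule eq_matI) (auto simp: A_def)
    then show ?thesis by (metis e.hom_det)
  qed
  have homog: "whomog (block_weight i) (card {m\<in>?T. row_form m = i}) (det A)" for i
  proof -
    have "whomog (block_weight i) (card {m\<in>?T. row_form m = i}) (signof p * (\<Prod>k = 0..<n. A $$ (k, p k)))"
      if p: "p permutes {0..<n}" for p
    proof -
      have "whomog (block_weight i) (\<Sum>k = 0..<n. if row_form (b k) = i then 1 else 0) (\<Prod>k = 0..<n. A $$ (k, p k))"
        using p by (intro whomog_prod) (auto simp: entry macaulay_entry_def intro!: whomog_Var)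
      also have "(\<Sum>k = 0..<n. if row_form (b k) = i then 1 else 0) = (\<Sum>m\<in>?T. if row_form m = i then 1 else 0 :: nat)"
        using b by (intro sum.reindex_bij_betw)
      also have "\<dots> = card {m\<in>?T. row_form m = i}"
        by (simp add: sum.If_cases Int_def)
      finally show ?thesis
        by (cases p rule: sign_cases) (auto intro: whomog_uminus)
    qed
    then show ?thesis unfolding det_def'[OF A] by (intro whomog_sum) auto
  qed
  show ?thesis
  proof (rule that[of "det A"])
    show "det A \<in> polys_in (coeff_index N d)" unfolding det_def'[OF A]
    proof (rule polys_in_sum)
      fix p assume p: "p \<in> {p. p permutes {0..<n}}"
      have "A $$ (k, p k) \<in> polys_in (coeff_index N d)" if "k < n" for k
        using p that row_form(1)[OF bT[of k]]
        by (auto simp: entry macaulay_entry_def coeff_index_def intro!: polys_in_Var)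
      then have "(\<Prod>k\<in>K. A $$ (k, p k)) \<in> polys_in (coeff_index N d)" if "K \<subseteq> {0..<n}" for K
        using that by (induction K rule: infinite_finite_induct) (auto intro: polys_in_mult)
      then show "signof p * (\<Prod>k = 0..<n. A $$ (k, p k)) \<in> polys_in (coeff_index N d)"
        by (cases p rule: sign_cases) (auto intro: polys_in_uminus)
    qed
    show "mpeval of_int (det A) (power_tuple N d) = (1::complex)"
    proof -
      have E: "mpeval of_int (macaulay_entry m m') (power_tuple N d) = (if m = m' then 1 else (0::complex))"
        if m: "m \<in> ?T" for m m'
      proof (cases "\<exists>\<mu>\<in>monomials N d. m' = cofactor m + \<mu>")
        case True
        then obtain \<mu> where \<mu>: "\<mu> \<in> monomials N d" "m' = cofactor m + \<mu>" by blast
        have "m = m' \<longleftrightarrow> \<mu> = Poly_Mapping.single (row_form m) d"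
          using cofactor_add[OF m] unfolding \<mu>(2) by (metis add_left_imp_eq)
        then show ?thesis using \<mu> row_form(1)[OF m]
          by (simp add: macaulay_entry_cofactor power_tuple_def comm_semiring_hom.mpeval_Var[OF comm_semiring_hom_of_int])
      next
        case False
        moreover have "m \<noteq> m'"
        proof
          assume "m = m'"
          then have "m' = cofactor m + Poly_Mapping.single (row_form m) d" using cofactor_add[OF m] by simp
          then show False using False power_monomial[OF row_form(1)[OF m]] by blast
        qed
        ultimately show ?thesis
          by (simp add: macaulay_entry_def comm_semiring_hom.mpeval_0[OF comm_semiring_hom_of_int])
      qed
      have "mat n n (\<lambda>(i, j). mpeval of_int (macaulay_entry (b i) (b j)) (power_tuple N d)) = (1\<^sub>m n :: complex mat)"
        by (rule eq_matI) (simp_all add: E[OF bT] b_eq)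
      then show ?thesis by (simp add: ev)
    qed
    show "mpeval of_int (det A) a = (0::complex)"
      if x: "x \<in> coord_space {..N}" "x \<noteq> (\<lambda>_. 0 :: complex)"
        and zero: "\<forall>i\<le>N. mpeval id (tuple_form N d a i) x = 0" for a x
    proof -
      let ?M = "mat n n (\<lambda>(i, j). mpeval of_int (macaulay_entry (b i) (b j)) a) :: complex mat"
      let ?v = "vec n (\<lambda>j. mono_eval (b j) x)"
      have "?M *\<^sub>v ?v = 0\<^sub>v n"
      proof (rule eq_vecI)
        fix i assume "i < dim_vec (0\<^sub>v n :: complex vec)"
        then have i: "i < n" by simp
        then have "(?M *\<^sub>v ?v) $ i = (\<Sum>j = 0..<n. mpeval of_int (macaulay_entry (b i) (b j)) a * mono_eval (b j) x)"
          by (simp add: scalar_prod_def)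
        also have "\<dots> = (\<Sum>m'\<in>?T. mpeval of_int (macaulay_entry (b i) m') a * mono_eval m' x)"
          using b by (rule sum.reindex_bij_betw)
        also have "\<dots> = 0" using zero row_form(1)[OF bT[OF i]] by (simp add: macaulay_row[OF bT[OF i]])
        finally show "(?M *\<^sub>v ?v) $ i = 0\<^sub>v n $ i" using i by simp
      qed simp
      moreover have "?v \<noteq> 0\<^sub>v n"
      proof
        assume v0: "?v = 0\<^sub>v n"
        obtain j where j: "x j \<noteq> 0" using x(2) by auto
        then have "j \<le> N" using x(1) by (auto simp: coord_space_def)
        then have "Poly_Mapping.single j crit \<in> ?T" by (rule power_monomial)
        then obtain k where k: "k < n" "b k = Poly_Mapping.single j crit"
          using b by (auto simp: bij_betw_def image_iff set_eq_iff) (metis atLeastLessThan_iff)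
        then have "?v $ k \<noteq> 0" using j by simp
        then show False using k unfolding v0 by simp
      qed
      ultimately have "det ?M = 0"
        by (subst det_0_iff_vec_prod_zero[of _ n]) (auto intro!: exI[of _ ?v])
      then show ?thesis by (simp add: ev)
    qed
    show "\<exists>n. whomog (block_weight i) n (det A)" for i using homog[of i] by (rule exI)
    show "\<exists>n\<le>d ^ N. whomog (block_weight i0) n (det A)" using homog[of i0] card_row_form by (intro exI conjI)
  qed
qed

end

section \<open>The degree of the resultant\<close>

lemma comm_ring_hom_mpeval:
  assumes "comm_ring_hom h"
  shows "comm_ring_hom (\<lambda>p. mpeval h p x)"
proof -
  interpret h: comm_ring_hom h by fact
  show ?thesis by unfold_locales (simp_all add: h.mpeval_add h.mpeval_mult)
qed

lemma comm_ring_hom_id: "comm_ring_hom (id :: 'a::comm_ring_1 \<Rightarrow> 'a)"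
  by unfold_locales simp_all

lemma comm_ring_hom_of_int: "comm_ring_hom (of_int :: int \<Rightarrow> 'a::comm_ring_1)"
  by unfold_locales simp_all

lemma base_digits_sum: "(\<Sum>k<N. d ^ k * (n div d ^ k mod d)) = n mod (d ^ N :: nat)"
  by (induction N) (simp_all add: mod_mult2_eq mult.commute[of d])

lemma vdeg_pos_if_not_constant:
  assumes "p \<notin> polys_in {}"
  obtains v where "vdeg v p > 0"
proof -
  from assms obtain m where m: "m \<in> Poly_Mapping.keys p" "Poly_Mapping.keys m \<noteq> {}"
    by (auto simp: polys_in_def simp del: keys_eq_empty)
  then obtain v where v: "v \<in> Poly_Mapping.keys m" by blast
  have "vdeg v p > 0"
  proof (rule ccontr)
    assume "\<not> vdeg v p > 0"
    then have "p \<in> polys_in (UNIV - {v})"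
      using vdeg_0_imp[of p UNIV v] by (simp add: polys_in_def)
    then show False using m v by (auto simp: polys_in_def)
  qed
  then show ?thesis by (rule that)
qed

context
  fixes N d :: nat and \<rho> :: "(coeff_ix, int) mpoly"
  assumes d: "d \<ge> 1" and res: "macaulay_resultant N d \<rho>"
begin

lemma res_in: "\<rho> \<in> polys_in (coeff_index N d)"
  and res_irreducible: "Factorial_Ring.irreducible \<rho>"
  and res_zero_iff: "a \<in> coord_space (coeff_index N d) \<Longrightarrow> mpeval of_int \<rho> a = (0::complex) \<longleftrightarrow>
        (\<exists>x\<in>coord_space {..N}. x \<noteq> (\<lambda>_. 0) \<and> (\<forall>i\<le>N. mpeval id (tuple_form N d a i) x = 0))"
  and res_power: "mpeval of_int \<rho> (power_tuple N d) = (1::complex)"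
  using res unfolding macaulay_resultant_def by blast+

text \<open>The resultant is \<open>1\<close> at the tuple of powers, but \<open>0\<close> at the zero tuple.\<close>

lemma res_nonconstant: obtains v where "vdeg v \<rho> > 0"
proof (rule vdeg_pos_if_not_constant)
  show "\<rho> \<notin> polys_in {}"
  proof
    assume "\<rho> \<in> polys_in {}"
    then have "mpeval of_int \<rho> (power_tuple N d) = mpeval of_int \<rho> (\<lambda>_. 0::complex)"
      by (rule mpeval_cong) simp
    moreover have "mpeval of_int \<rho> (\<lambda>_. 0::complex) = 0"
    proof (subst res_zero_iff)
      let ?x = "\<lambda>j. if j = 0 then 1 else 0 :: complex"
      have "?x \<in> coord_space {..N}" by (simp add: coord_space_def)
      moreover have "?x \<noteq> (\<lambda>_. 0)" by (auto simp: fun_eq_iff)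
      ultimately show "\<exists>x\<in>coord_space {..N}. x \<noteq> (\<lambda>_. 0) \<and>
          (\<forall>i\<le>N. mpeval id (tuple_form N d (\<lambda>_. 0) i) x = (0::complex))"
        by (intro bexI[of _ ?x]) (simp_all add: eval_tuple_form)
    qed (simp add: coord_space_def)
    ultimately show False by (simp add: res_power)
  qed
qed

lemma res_block_degree_le:
  assumes "i \<le> N"
  obtains k where "k \<le> d ^ N" "whomog (block_weight i) k \<rho>"
proof -
  obtain \<Delta> where \<Delta>: "\<Delta> \<in> polys_in (coeff_index N d)" "mpeval of_int \<Delta> (power_tuple N d) = (1::complex)"
    and zero: "\<And>a x. a \<in> coord_space (coeff_index N d) \<Longrightarrow> x \<in> coord_space {..N} \<Longrightarrow> x \<noteq> (\<lambda>_. 0) \<Longrightarrow>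
      \<forall>i\<le>N. mpeval id (tuple_form N d a i) x = 0 \<Longrightarrow> mpeval of_int \<Delta> a = (0::complex)"
    and "\<exists>n\<le>d ^ N. whomog (block_weight i) n \<Delta>"
    by (rule macaulay_determinant[OF d assms]) metis
  then obtain n where n: "n \<le> d ^ N" "whomog (block_weight i) n \<Delta>" by blast
  obtain v where v: "vdeg v \<rho> > 0" by (rule res_nonconstant)
  have "\<rho> dvd \<Delta>"
  proof (rule hypersurface_nullstellensatz[OF res_irreducible v _ \<Delta>(1) res_in])
    fix a :: "coeff_ix \<Rightarrow> complex" assume "a \<in> coord_space (coeff_index N d)" "mpeval of_int \<rho> a = 0"
    then show "mpeval of_int \<Delta> a = 0" using zero res_zero_iff by blast
  qed simp
  then obtain q where q: "\<Delta> = \<rho> * q" by (elim dvdE)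
  have "\<Delta> \<noteq> 0" using \<Delta>(2) by (auto simp: comm_semiring_hom.mpeval_0[OF comm_semiring_hom_of_int])
  then obtain k where "k \<le> n" "whomog (block_weight i) k \<rho>"
    using n(2) unfolding q by (elim whomog_factor) auto
  then show ?thesis using that n(1) by (meson order_trans)
qed

text \<open>For \<open>j \<noteq> i\<close> let \<open>f\<^sub>j\<close> be the product of the \<open>x\<^sub>j - k * x\<^sub>i\<close> over \<open>k < d\<close>. The common zeros of these forms, with
  \<open>x\<^sub>i = 1\<close>, are the points whose other coordinates are in \<open>{0..<d}\<close>, the digits in base \<open>d\<close> of the numbers
  \<open>n < d ^ N\<close>. Let \<open>f\<^sub>i\<close> be \<open>c * x\<^sub>i ^ d\<close> plus the form that takes the value \<open>n\<close> at the point of \<open>n\<close>. Then the tuple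
  has a common zero for each \<open>c = - n\<close>, and none for \<open>c = 1\<close>; as a polynomial in the single coefficient
  \<open>c\<close>, the resultant is nonzero and has \<open>d ^ N\<close> roots.\<close>

lemma res_leading_degree_ge:
  assumes i: "i \<le> N"
  shows "d ^ N \<le> vdeg (i, Poly_Mapping.single i d) \<rho>"
proof -
  let ?v = "(i, Poly_Mapping.single i d)"
  define \<sigma> where "\<sigma> = (\<lambda>k. if k < i then k else Suc k)"
  define \<tau> where "\<tau> = (\<lambda>j. if j < i then j else j - 1)"
  have \<sigma>: "\<sigma> k \<le> N" "\<sigma> k \<noteq> i" "\<tau> (\<sigma> k) = k" if "k < N" for k
    using that i by (auto simp: \<sigma>_def \<tau>_def)
  define G :: "(nat, complex) mpoly" where
    "G = Var i ^ (d - 1) * (\<Sum>k<N. Const (of_nat (d ^ k)) * Var (\<sigma> k))"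
  define P :: "complex \<Rightarrow> nat \<Rightarrow> (nat, complex) mpoly" where
    "P = (\<lambda>c j. if j = i then Const c * Var i ^ d + G
      else (\<Prod>k<d. Var j - Const (of_nat k) * Var i))"
  define a where "a = (\<lambda>c. form_coeffs N d (P c))"
  interpret id: comm_ring_hom "id :: complex \<Rightarrow> complex" by (rule comm_ring_hom_id)
  interpret ev: comm_ring_hom "\<lambda>p. mpeval id p x" for x :: "nat \<Rightarrow> complex"
    by (intro comm_ring_hom_mpeval comm_ring_hom_id)
  note ev_simps = ev.hom_add ev.hom_mult ev.hom_minus ev.hom_prod ev.hom_power ev.hom_sum
    id.mpeval_Var id.mpeval_Const
  have P_in: "P c j \<in> polys_in {..N}" if "j \<le> N" for c j
  proof -
    have "(\<Prod>k\<in>K. Var j - Const (of_nat k) * Var i) \<in> (polys_in {..N} :: (nat, complex) mpoly set)"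
      for K :: "nat set"
      using that i by (induction K rule: infinite_finite_induct)
        (auto intro!: polys_in_mult polys_in_diff polys_in_Var simp del: single_of_nat)
    then show ?thesis
      using i that \<sigma>(1)
      by (auto simp: P_def G_def intro!: polys_in_add polys_in_mult polys_in_power polys_in_sum polys_in_Var
        simp del: single_of_nat of_nat_power)
  qed
  have P_homog: "whomog (\<lambda>_. 1) d (P c j)" for c j
  proof (cases "j = i")
    case True
    have "whomog (\<lambda>_. 1) (0 + 1 * d) (Const c * Var i ^ d)"
      by (intro whomog_mult whomog_power whomog_Const whomog_Var) simp
    moreover have "whomog (\<lambda>_. 1) (1 * (d - 1) + (0 + 1)) G"
      unfolding G_def
      by (intro whomog_mult whomog_power whomog_sum whomog_Const whomog_Var) simp_all
    ultimately show ?thesis using True d by (simp add: P_def whomog_add)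
  next
    case False
    have "whomog (\<lambda>_. 1) (\<Sum>k<d. 1) (\<Prod>k<d. Var j - Const (of_nat k :: complex) * Var i)"
    proof (rule whomog_prod)
      fix k
      have "whomog (\<lambda>_. 1) (0 + 1) (Const (of_nat k :: complex) * Var i)"
        by (intro whomog_mult whomog_Const whomog_Var) simp
      then show "whomog (\<lambda>_. 1) 1 (Var j - Const (of_nat k :: complex) * Var i)"
        by (intro whomog_diff whomog_Var) simp_all
    qed
    then show ?thesis using False by (simp add: P_def)
  qed
  have zero_iff: "mpeval of_int \<rho> (a c) = 0 \<longleftrightarrow>
      (\<exists>x\<in>coord_space {..N}. x \<noteq> (\<lambda>_. 0) \<and> (\<forall>j\<le>N. mpeval id (P c j) x = 0))" for c
  proof -
    have "tuple_form N d (a c) j = P c j" if "j \<le> N" for j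
      using that P_in P_homog unfolding a_def by (intro tuple_form_form_coeffs)
    then show ?thesis
      using res_zero_iff[of "a c"] by (simp add: a_def form_coeffs_in_coord_space cong: conj_cong)
  qed
  have eval_i: "mpeval id (P c i) x = c * x i ^ d + x i ^ (d - 1) * (\<Sum>k<N. of_nat (d ^ k) * x (\<sigma> k))" for c x
    by (simp add: P_def G_def ev_simps del: of_nat_power single_of_nat)
  have eval_j: "mpeval id (P c j) x = (\<Prod>k<d. x j - of_nat k * x i)" if "j \<noteq> i" for c j x
    using that by (simp add: P_def ev_simps del: single_of_nat)
  have root: "mpeval of_int \<rho> (a (- of_nat n)) = 0" if n: "n < d ^ N" for n
  proof -
    define x where "x = (\<lambda>j. if j = i then 1 else if j \<le> N then of_nat (n div d ^ \<tau> j mod d) else 0 :: complex)"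
    have "(\<Sum>k<N. of_nat (d ^ k) * x (\<sigma> k)) = of_nat (\<Sum>k<N. d ^ k * (n div d ^ k mod d))"
      using \<sigma> by (simp add: x_def)
    also have "\<dots> = of_nat n" using n by (simp add: base_digits_sum)
    finally have "mpeval id (P (- of_nat n) i) x = 0" by (simp add: eval_i x_def)
    moreover have "mpeval id (P (- of_nat n) j) x = 0" if "j \<noteq> i" "j \<le> N" for j
      using that d by (auto simp: eval_j x_def intro!: bexI[of _ "n div d ^ \<tau> j mod d"])
    moreover have "x \<in> coord_space {..N}" "x \<noteq> (\<lambda>_. 0)"
      using i by (auto simp: x_def coord_space_def fun_eq_iff)
    ultimately show ?thesis unfolding zero_iff by metis
  qed
  have nonroot: "mpeval of_int \<rho> (a 1) \<noteq> 0"
  proof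
    assume "mpeval of_int \<rho> (a 1) = 0"
    then obtain x where x: "x \<in> coord_space {..N}" "x \<noteq> (\<lambda>_. 0)" "\<And>j. j \<le> N \<Longrightarrow> mpeval id (P 1 j) x = 0"
      unfolding zero_iff by blast
    have "\<exists>k. x j = of_nat k * x i" if "j \<le> N" "j \<noteq> i" for j
      using x(3)[OF that(1)] that by (auto simp: eval_j)
    then obtain \<kappa> where \<kappa>: "\<And>j. j \<le> N \<Longrightarrow> j \<noteq> i \<Longrightarrow> x j = of_nat (\<kappa> j) * x i" by metis
    have "x i \<noteq> 0"
    proof
      assume "x i = 0"
      then have "x j = 0" for j using \<kappa>[of j] x(1) by (cases "j \<le> N"; cases "j = i") (auto simp: coord_space_def)
      with x(2) show False by auto
    qed
    have "(\<Sum>k<N. of_nat (d ^ k) * x (\<sigma> k)) = of_nat (\<Sum>k<N. d ^ k * \<kappa> (\<sigma> k)) * x i"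
      using \<sigma> by (simp add: \<kappa> sum_distrib_right sum_distrib_left algebra_simps)
    then have "mpeval id (P 1 i) x = of_nat (1 + (\<Sum>k<N. d ^ k * \<kappa> (\<sigma> k))) * x i ^ d"
      using d by (cases d) (simp_all add: eval_i algebra_simps)
    then show False using x(3)[OF i] \<open>x i \<noteq> 0\<close> by (simp del: of_nat_Suc of_nat_add)
  qed
  \<comment> \<open>the tuples lie on a coordinate line\<close>
  have line: "a c = (a 0)(?v := c + a 0 ?v)" for c
  proof
    fix jm :: coeff_ix
    obtain j m where jm: "jm = (j, m)" by (cases jm)
    have "Const c * Var i ^ d = Poly_Mapping.single (Poly_Mapping.single i d) c"
      using mono_eval_Var[of "Poly_Mapping.single i d", where 'c = complex] by (simp add: mult_single)
    then have "Poly_Mapping.lookup (P c i) m = (if m = Poly_Mapping.single i d then c else 0) + Poly_Mapping.lookup (P 0 i) m"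
      by (simp add: P_def lookup_add lookup_single when_def)
    moreover have "?v \<in> coeff_index N d" using i power_monomial by (auto simp: coeff_index_def)
    ultimately show "a c jm = ((a 0)(?v := c + a 0 ?v)) jm"
      by (auto simp: jm a_def form_coeffs_def P_def)
  qed
  define r where "r = map_poly (\<lambda>q. mpeval of_int q (a 0)) (to_uni ?v \<rho>)"
  have r: "poly r (c + a 0 ?v) = mpeval of_int \<rho> (a c)" for c
    unfolding r_def line[of c] by (rule poly_map_to_uni_of_int)
  have "r \<noteq> 0" using r[of 1] nonroot by auto
  have "d ^ N = card ((\<lambda>n. - of_nat n + a 0 ?v) ` {..<d ^ N})"
    by (subst card_image) (auto simp: inj_on_def)
  also have "\<dots> \<le> card {t. poly r t = 0}"
  proof (rule card_mono)
    show "finite {t. poly r t = 0}" using \<open>r \<noteq> 0\<close> by (rule poly_roots_finite)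
    show "(\<lambda>n. - of_nat n + a 0 ?v) ` {..<d ^ N} \<subseteq> {t. poly r t = 0}"
      by (intro image_subsetI CollectI) (simp only: r root lessThan_iff)
  qed
  also have "\<dots> \<le> Polynomial.degree r" using \<open>r \<noteq> 0\<close> by (rule card_poly_roots_bound)
  also have "\<dots> \<le> vdeg ?v \<rho>" unfolding r_def by (rule degree_map_poly_le)
  finally show ?thesis .
qed

lemma res_block_homog:
  assumes i: "i \<le> N"
  shows "whomog (block_weight i) (d ^ N) \<rho>"
proof -
  obtain k where k: "k \<le> d ^ N" "whomog (block_weight i) k \<rho>"
    by (rule res_block_degree_le[OF i])
  have "vdeg (i, Poly_Mapping.single i d) \<rho> \<le> k"
  proof (rule vdeg_le)
    fix m assume m: "m \<in> Poly_Mapping.keys \<rho>"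
    let ?v = "(i, Poly_Mapping.single i d)"
    have "Poly_Mapping.lookup m ?v \<le> wdeg (block_weight i) m"
    proof (cases "?v \<in> Poly_Mapping.keys m")
      case True
      then have "block_weight i ?v * Poly_Mapping.lookup m ?v \<le> wdeg (block_weight i) m"
        unfolding wdeg_def by (intro member_le_sum[of ?v]) auto
      then show ?thesis by simp
    qed (simp add: in_keys_iff)
    then show "Poly_Mapping.lookup m ?v \<le> k" using k(2) m by (simp add: whomog_def)
  qed
  then have "k = d ^ N" using res_leading_degree_ge[OF i] k(1) by linarith
  then show ?thesis using k(2) by simp
qed

theorem resultant_degree: "\<rho> \<in> forms_in (coeff_index N d) ((N + 1) * d ^ N)"
proof -
  have "mdeg m = (N + 1) * d ^ N" if m: "m \<in> Poly_Mapping.keys \<rho>" for m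
  proof -
    have "Poly_Mapping.keys m \<subseteq> coeff_index N d" using res_in m by (auto simp: polys_in_def)
    then have "mdeg m = (\<Sum>i\<le>N. wdeg (block_weight i) m)" by (rule mdeg_eq_sum_blocks)
    also have "\<dots> = (\<Sum>i\<le>N. d ^ N)"
      using res_block_homog m by (intro sum.cong) (auto simp: whomog_def)
    finally show ?thesis by simp
  qed
  then show ?thesis using res_in by (simp add: forms_in_def)
qed

end

section \<open>Projective points and basic open sets\<close>

lemma forms_in_iff: "p \<in> forms_in I n \<longleftrightarrow> p \<in> polys_in I \<and> whomog (\<lambda>_. 1) n p"
  by (simp add: forms_in_def whomog_def mdeg_eq_wdeg)

lemma forms_in_mult:
  "p \<in> forms_in I n \<Longrightarrow> q \<in> forms_in I k \<Longrightarrow> (p * q :: ('v, 'c::semiring_0) mpoly) \<in> forms_in I (n + k)"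
  by (simp add: forms_in_iff polys_in_mult whomog_mult)

lemma forms_in_add: "p \<in> forms_in I n \<Longrightarrow> q \<in> forms_in I n \<Longrightarrow> p + q \<in> forms_in I n"
  by (simp add: forms_in_iff polys_in_add whomog_add)

lemma forms_in_Const: "Const c \<in> forms_in I 0"
  by (simp add: forms_in_iff whomog_Const)

lemma form_eval_scale:
  assumes "p \<in> forms_in I n"
  shows "mpeval h p (\<lambda>v. c * x v) = c ^ n * mpeval h p x"
  using whomog_eval_scale[of "\<lambda>_. 1" n p h c x] assms by (simp add: forms_in_iff)

lemma form_eval_0:
  assumes "p \<in> forms_in I n" "n > 0"
  shows "mpeval h p (\<lambda>_. 0) = 0"
  using form_eval_scale[OF assms(1), of h 0 "\<lambda>_. 0"] assms(2) by (simp add: zero_power)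

lemma proj_point_self: "x \<in> proj_point x"
  unfolding proj_point_def by (rule CollectI, rule exI[of _ 1]) simp

lemma proj_points_rep:
  assumes "P \<in> proj_points I"
  obtains x where "x \<in> P"
  using assms proj_point_self by (auto simp: proj_points_def)

lemma proj_points_scale:
  assumes "P \<in> proj_points I" "x \<in> P" "y \<in> P"
  obtains c where "c \<noteq> 0" "y = (\<lambda>v. c * x v)"
proof -
  from assms obtain z a b where z: "x = (\<lambda>v. a * z v)" "y = (\<lambda>v. b * z v)" "a \<noteq> 0" "b \<noteq> 0"
    by (auto simp: proj_points_def proj_point_def)
  show ?thesis by (rule that[of "b / a"]) (use z in auto)
qed

lemma proj_points_scaled_mem:
  assumes "P \<in> proj_points I" "x \<in> P" "c \<noteq> 0"
  shows "(\<lambda>v. c * x v) \<in> P"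
proof -
  from assms obtain z a where z: "P = proj_point z" "x = (\<lambda>v. a * z v)" "a \<noteq> 0"
    by (auto simp: proj_points_def proj_point_def)
  then show ?thesis using assms(3) by (auto simp: proj_point_def mult.assoc intro!: exI[of _ "c * a"])
qed

lemma form_nonzero_on_point:
  assumes "P \<in> proj_points I" "x \<in> P" "y \<in> P" "p \<in> forms_in I n" "mpeval h p x \<noteq> (0::complex)"
  shows "mpeval h p y \<noteq> 0"
proof -
  obtain c where "c \<noteq> 0" "y = (\<lambda>v. c * x v)" using assms(1-3) by (rule proj_points_scale)
  then show ?thesis using assms by (simp add: form_eval_scale)
qed

lemma form_quotient_on_point:
  assumes "P \<in> proj_points I" "x \<in> P" "y \<in> P" "p \<in> forms_in I n" "q \<in> forms_in I n"
  shows "mpeval h p y / mpeval h' q y = mpeval h p x / (mpeval h' q x :: complex)"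
proof -
  obtain c where "c \<noteq> 0" "y = (\<lambda>v. c * x v)" using assms(1-3) by (rule proj_points_scale)
  then show ?thesis using assms by (simp add: form_eval_scale)
qed

lemma comm_semiring_hom_of_rat: "comm_semiring_hom (of_rat :: rat \<Rightarrow> complex)"
  by unfold_locales (auto simp: of_rat_add of_rat_mult)

lemmas of_rat_mpeval =
  comm_semiring_hom.mpeval_add[OF comm_semiring_hom_of_rat]
  comm_semiring_hom.mpeval_mult[OF comm_semiring_hom_of_rat]

abbreviation basic_open :: "'v set \<Rightarrow> ('v, rat) mpoly \<Rightarrow> ('v \<Rightarrow> complex) set set" where
  "basic_open I F \<equiv> {P \<in> proj_points I. \<forall>x\<in>P. mpeval of_rat F x \<noteq> 0}"

lemma openin_basic_open: "F \<in> forms_in I n \<Longrightarrow> openin (proj_zar I) (basic_open I F)"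
  unfolding proj_zar_def by (rule topology_generated_by_Basis) blast

lemma basic_open_1: "basic_open I 1 = proj_points I"
  by (simp add: comm_semiring_hom.mpeval_1[OF comm_semiring_hom_of_rat])

lemma topspace_proj_zar [simp]: "topspace (proj_zar I) = proj_points I"
proof
  show "topspace (proj_zar I) \<subseteq> proj_points I"
    unfolding proj_zar_def topology_generated_by_topspace by blast
  have "(1 :: ('a, rat) mpoly) \<in> forms_in I 0"
    using forms_in_Const[of "1 :: rat" I] by simp
  from openin_basic_open[OF this] show "proj_points I \<subseteq> topspace (proj_zar I)"
    unfolding basic_open_1 by (rule openin_subset)
qed

text \<open>The basic open sets are closed under finite intersections, so they form a base and not just a
  subbase.\<close>

lemma basic_open_neighbourhood:
  assumes "openin (proj_zar I) W" "P \<in> W"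
  shows "\<exists>n F. F \<in> forms_in I n \<and> P \<in> basic_open I F \<and> basic_open I F \<subseteq> W"
proof -
  let ?B = "{basic_open I F | F. \<exists>n. F \<in> forms_in I n}"
  have "generate_topology_on ?B W"
    using assms(1) unfolding proj_zar_def openin_topology_generated_by_iff .
  then show ?thesis using assms(2)
  proof (induction arbitrary: P rule: generate_topology_on.induct)
    case Empty
    then show ?case by simp
  next
    case (Int V W)
    then have P: "P \<in> V" "P \<in> W" by auto
    obtain n F where F: "F \<in> forms_in I n" "P \<in> basic_open I F" "basic_open I F \<subseteq> V"
      using Int.IH(1)[OF P(1)] by (elim exE conjE)
    obtain k G where G: "G \<in> forms_in I k" "P \<in> basic_open I G" "basic_open I G \<subseteq> W"
      using Int.IH(2)[OF P(2)] by (elim exE conjE)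
    have "basic_open I (F * G) = basic_open I F \<inter> basic_open I G"
      by (auto simp: of_rat_mpeval)
    then show ?case using F G forms_in_mult[OF F(1) G(1)] by (intro exI[of _ "n + k"] exI[of _ "F * G"]) auto
  next
    case (UN K)
    then obtain k where k: "k \<in> K" "P \<in> k" by blast
    from UN.IH[OF this] obtain n F where F: "F \<in> forms_in I n" "P \<in> basic_open I F" "basic_open I F \<subseteq> k"
      by (elim exE conjE)
    moreover have "k \<subseteq> \<Union>K" using k(1) by blast
    ultimately show ?case by (intro exI[of _ n] exI[of _ F]) blast
  next
    case (Basis s)
    then show ?case by blast
  qed
qed

section \<open>Integral and rational coefficients\<close>

lemma common_denominator:
  assumes "finite (S :: rat set)"
  shows "\<exists>c::int. c \<noteq> 0 \<and> (\<forall>q\<in>S. \<exists>k. of_int c * q = of_int k)"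
  using assms
proof (induction S rule: finite_induct)
  case empty
  then show ?case by (intro exI[of _ 1]) simp
next
  case (insert q S)
  then obtain c where c: "c \<noteq> 0" "\<forall>q\<in>S. \<exists>k. of_int c * q = of_int k" by blast
  obtain a b where ab: "quotient_of q = (a, b)" by (cases "quotient_of q")
  have q: "q = of_int a / of_int b" "b > 0"
    using quotient_of_div[OF ab] quotient_of_denom_pos[OF ab] by simp_all
  have bq: "of_int (b * c) * q = of_int (c * a)" unfolding q(1) using q(2) by simp
  have "\<exists>k. of_int (b * c) * q' = of_int k" if "q' \<in> insert q S" for q'
  proof (cases "q' = q")
    case True
    show ?thesis unfolding True by (rule exI[of _ "c * a"]) (rule bq)
  next
    case False
    then obtain k where "of_int c * q' = of_int k" using c(2) \<open>q' \<in> insert q S\<close> by auto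
    then have "of_int (b * c) * q' = of_int (b * k)" by (simp only: of_int_mult mult.assoc)
    then show ?thesis ..
  qed
  moreover have "b * c \<noteq> 0" using c(1) q(2) by simp
  ultimately have "b * c \<noteq> 0 \<and> (\<forall>q'\<in>insert q S. \<exists>k. of_int (b * c) * q' = of_int k)" by blast
  then show ?case by (rule exI)
qed

lemma clear_denominators:
  fixes F :: "('v, rat) mpoly"
  assumes "c \<noteq> 0" "\<And>q. q \<in> Poly_Mapping.lookup F ` Poly_Mapping.keys F \<Longrightarrow> \<exists>k. of_int c * q = of_int k"
  shows "\<exists>F' :: ('v, int) mpoly. Poly_Mapping.keys F' = Poly_Mapping.keys F \<and>
    (\<forall>x. mpeval of_int F' x = of_int c * (mpeval of_rat F x :: complex))"
proof -
  define F' where "F' = Poly_Mapping.map (\<lambda>q. \<lfloor>of_int c * q\<rfloor>) F"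
  have l: "of_int (Poly_Mapping.lookup F' m) = of_int c * Poly_Mapping.lookup F m" for m
  proof (cases "m \<in> Poly_Mapping.keys F")
    case True
    then obtain k where "of_int c * Poly_Mapping.lookup F m = of_int k" using assms(2) by blast
    then show ?thesis using True by (simp add: F'_def map.rep_eq in_keys_iff)
  qed (simp add: F'_def map.rep_eq in_keys_iff)
  have keys: "Poly_Mapping.keys F' = Poly_Mapping.keys F"
  proof -
    have "(of_int (Poly_Mapping.lookup F' m) :: rat) = 0 \<longleftrightarrow> Poly_Mapping.lookup F m = 0" for m
      unfolding l using assms(1) by simp
    then show ?thesis by (simp add: set_eq_iff in_keys_iff)
  qed
  have lc: "(of_int (Poly_Mapping.lookup F' m) :: complex) = of_int c * of_rat (Poly_Mapping.lookup F m)" for m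
    using arg_cong[OF l[of m], of "of_rat :: rat \<Rightarrow> complex"] by (simp add: of_rat_mult)
  have "mpeval of_int F' x = of_int c * (mpeval of_rat F x :: complex)" for x
    by (simp add: mpeval_def keys lc sum_distrib_left mult.assoc)
  with keys show ?thesis by blast
qed

text \<open>Multiplying numerator and denominator by a common denominator of all coefficients makes the
  unique factorization of integral polynomials applicable to quotients of rational forms.\<close>

lemma int_form_quotient:
  fixes F G :: "('v, rat) mpoly"
  assumes "F \<in> forms_in I n" "G \<in> forms_in I n"
  obtains c :: complex and F' G' :: "('v, int) mpoly"
  where "c \<noteq> 0" "F' \<in> forms_in I n" "G' \<in> forms_in I n"
    "\<forall>x. mpeval of_int F' x = c * mpeval of_rat F x" "\<forall>x. mpeval of_int G' x = c * mpeval of_rat G x"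
proof -
  obtain c :: int where c: "c \<noteq> 0" "\<And>q. q \<in> Poly_Mapping.lookup F ` Poly_Mapping.keys F \<union>
      Poly_Mapping.lookup G ` Poly_Mapping.keys G \<Longrightarrow> \<exists>k. of_int c * q = of_int k"
    using common_denominator[of "Poly_Mapping.lookup F ` Poly_Mapping.keys F \<union>
      Poly_Mapping.lookup G ` Poly_Mapping.keys G"] by auto
  obtain F' :: "('v, int) mpoly" where F': "Poly_Mapping.keys F' = Poly_Mapping.keys F"
    "\<forall>x. mpeval of_int F' x = of_int c * (mpeval of_rat F x :: complex)"
    using clear_denominators[OF c(1), of F] c(2) by blast
  obtain G' :: "('v, int) mpoly" where G': "Poly_Mapping.keys G' = Poly_Mapping.keys G"
    "\<forall>x. mpeval of_int G' x = of_int c * (mpeval of_rat G x :: complex)"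
    using clear_denominators[OF c(1), of G] c(2) by blast
  show ?thesis
    by (rule that[of "of_int c" F' G']) (use c F' G' assms in \<open>auto simp: forms_in_def polys_in_def\<close>)
qed

definition rat_poly :: "('v, int) mpoly \<Rightarrow> ('v, rat) mpoly" where
  "rat_poly p = Poly_Mapping.map of_int p"

lemma lookup_rat_poly: "Poly_Mapping.lookup (rat_poly p) m = of_int (Poly_Mapping.lookup p m)"
  by (simp add: rat_poly_def map.rep_eq when_def)

lemma keys_rat_poly [simp]: "Poly_Mapping.keys (rat_poly p) = Poly_Mapping.keys p"
  by (simp add: set_eq_iff in_keys_iff lookup_rat_poly)

lemma eval_rat_poly [simp]: "mpeval of_rat (rat_poly p) x = (mpeval of_int p x :: complex)"
  by (simp add: mpeval_def lookup_rat_poly)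

lemma rat_poly_form: "rat_poly p \<in> forms_in I n \<longleftrightarrow> p \<in> forms_in I n"
  by (simp add: forms_in_def polys_in_def)

section \<open>Regular functions on the complement of a hypersurface\<close>

lemma whomog_unique:
  assumes "whomog w n p" "whomog w k p" "p \<noteq> 0"
  shows "n = k"
proof -
  obtain m where "m \<in> Poly_Mapping.keys p" using assms(3) by (metis keys_eq_empty all_not_in_conv)
  then show ?thesis using assms by (auto simp: whomog_def)
qed

lemma forms_in_factor:
  fixes p q :: "('v::linorder, 'c::idom) mpoly"
  assumes "p * q \<in> forms_in I n" "p * q \<noteq> 0"
  obtains k l where "p \<in> forms_in I k" "q \<in> forms_in I l" "k + l = n"
proof -
  have pq: "p * q \<in> polys_in I" "whomog (\<lambda>_. 1) n (p * q)" using assms by (auto simp: forms_in_iff)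
  obtain k where k: "whomog (\<lambda>_. 1) k p" using pq(2) assms(2) by (rule whomog_factor)
  obtain l where l: "whomog (\<lambda>_. 1) l q"
    using whomog_factor[of "\<lambda>_. 1" n q p] pq(2) assms(2) by (auto simp: mult.commute)
  have "k + l = n" using whomog_mult[OF k l] pq(2) assms(2) by (rule whomog_unique)
  moreover have "p \<in> polys_in I" "q \<in> polys_in I"
    using polys_in_factor[of p q I] polys_in_factor[of q p I] pq(1) assms(2) by (auto simp: mult.commute)
  ultimately show ?thesis using that k l by (auto simp: forms_in_iff)
qed

lemma monomial_split:
  assumes "n \<le> mdeg e"
  shows "\<exists>e1 e2. e = e1 + e2 \<and> mdeg e1 = n"
  using assms
proof (induction n)
  case 0
  then show ?case by (intro exI[of _ 0] exI[of _ e]) (simp add: mdeg_eq_wdeg)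
next
  case (Suc n)
  then obtain e1 e2 where e: "e = e1 + e2" "mdeg e1 = n" by auto
  have "e2 \<noteq> 0" using Suc.prems e by (auto simp: mdeg_eq_wdeg)
  then obtain v where v: "Poly_Mapping.lookup e2 v \<noteq> 0" by (metis lookup_zero poly_mapping_eqI)
  let ?s = "Poly_Mapping.single v (1::nat)"
  have "e2 = ?s + (e2 - ?s)"
    using v by (intro poly_mapping_eqI) (auto simp: lookup_add lookup_minus lookup_single when_def)
  then have "e = (e1 + ?s) + (e2 - ?s)" using e by (simp add: add.assoc)
  moreover have "mdeg (e1 + ?s) = Suc n" using e by (simp add: mdeg_eq_wdeg wdeg_add)
  ultimately show ?case by blast
qed

lemma a_inv_fun_ring:
  assumes "f \<in> extensional S"
  shows "\<ominus>\<^bsub>fun_ring S\<^esub> f = (\<lambda>p\<in>S. - f p)"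
  unfolding a_inv_def m_inv_def fun_ring_def using assms
  by (intro the_equality) (auto simp: fun_eq_iff extensional_def restrict_def add_eq_0_iff split: if_splits)

lemma fun_ring_simps [simp]:
  "\<zero>\<^bsub>fun_ring S\<^esub> = (\<lambda>p\<in>S. 0)" "\<one>\<^bsub>fun_ring S\<^esub> = (\<lambda>p\<in>S. 1)"
  "f \<oplus>\<^bsub>fun_ring S\<^esub> g = (\<lambda>p\<in>S. f p + g p)" "f \<otimes>\<^bsub>fun_ring S\<^esub> g = (\<lambda>p\<in>S. f p * g p)"
  by (simp_all add: fun_ring_def)

definition nonvanishing :: "'v set \<Rightarrow> ('v, int) mpoly \<Rightarrow> ('v \<Rightarrow> complex) set set" where
  "nonvanishing I h = {P \<in> proj_points I. \<forall>x\<in>P. mpeval of_int h x \<noteq> 0}"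

lemma nonvanishing_point: "P \<in> nonvanishing I h \<Longrightarrow> P \<in> proj_points I"
  and nonvanishing_nz: "P \<in> nonvanishing I h \<Longrightarrow> x \<in> P \<Longrightarrow> mpeval of_int h x \<noteq> 0"
  by (auto simp: nonvanishing_def)

text \<open>On a projective point the quotient takes a single value when \<open>e\<close> and \<open>h\<close> have the same degree, the
  case of interest.\<close>

definition monomial_quotient ::
  "'v set \<Rightarrow> ('v, int) mpoly \<Rightarrow> 'v monomial \<Rightarrow> ('v \<Rightarrow> complex) set \<Rightarrow> complex" where
  "monomial_quotient I h e =
    (\<lambda>P\<in>nonvanishing I h. the_elem ((\<lambda>x. mono_eval e x / mpeval of_int h x) ` P))"

context
  fixes I :: "'v::linorder set" and h :: "('v, int) mpoly" and D :: nat
  assumes I: "finite I" and D: "D > 0" and h: "h \<in> forms_in I D" "Factorial_Ring.irreducible h"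
begin

abbreviation U :: "('v \<Rightarrow> complex) set set" where
  "U \<equiv> nonvanishing I h"

text \<open>The fractions \<open>F / G\<close> that represent \<open>f\<close> wherever their denominator does not vanish. Shrinking an open
  set on which \<open>f\<close> is a quotient to a basic one, the nonvanishing locus of a form \<open>H\<close>, and expanding
  the fraction by \<open>H\<close> gives a fraction of this kind, so no open sets need to be remembered.\<close>

definition local_pairs :: "(('v \<Rightarrow> complex) set \<Rightarrow> complex) \<Rightarrow> (('v, int) mpoly \<times> ('v, int) mpoly) set" where
  "local_pairs f = {(F, G). G \<noteq> 0 \<and> (\<exists>n. F \<in> forms_in I n \<and> G \<in> forms_in I n) \<and>
    (\<forall>Q\<in>U. \<forall>x\<in>Q. mpeval of_int G x \<noteq> 0 \<longrightarrow> f Q = mpeval of_int F x / mpeval of_int G x)}"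

lemma regular_proj_iff:
  "f \<in> regular (proj_space I) V \<longleftrightarrow> f \<in> extensional V \<and> (\<forall>P\<in>V. \<exists>W n (F :: ('v, rat) mpoly) G.
    openin (proj_zar I) W \<and> P \<in> W \<and> W \<subseteq> V \<and> F \<in> forms_in I n \<and> G \<in> forms_in I n \<and>
    (\<forall>Q\<in>W. \<forall>x\<in>Q. mpeval of_rat G x \<noteq> 0 \<and> f Q = mpeval of_rat F x / mpeval of_rat G x))"
  by (simp add: proj_space_def)

lemma local_pair_exists:
  assumes "f \<in> regular (proj_space I) U" "P \<in> U"
  shows "\<exists>(F, G)\<in>local_pairs f. \<forall>x\<in>P. mpeval of_int G x \<noteq> (0::complex)"
proof -
  from assms(1)[unfolded regular_proj_iff, THEN conjunct2, THEN bspec, OF assms(2)]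
  obtain W n F G where W: "openin (proj_zar I) W" "P \<in> W" "W \<subseteq> U"
    and F: "F \<in> forms_in I n" "G \<in> forms_in I n"
    and FG: "\<forall>Q\<in>W. \<forall>x\<in>Q. mpeval of_rat G x \<noteq> 0 \<and> f Q = mpeval of_rat F x / mpeval of_rat G x"
    by (elim exE conjE)
  obtain k H where H: "H \<in> forms_in I k" "P \<in> basic_open I H" "basic_open I H \<subseteq> W"
    using basic_open_neighbourhood[OF W(1,2)] by (elim exE conjE)
  obtain c F' G' where c: "c \<noteq> 0" and F': "F' \<in> forms_in I (n + k)" "G' \<in> forms_in I (n + k)"
    and eval: "\<forall>x. mpeval of_int F' x = (c * mpeval of_rat (F * H) x :: complex)"
      "\<forall>x. mpeval of_int G' x = (c * mpeval of_rat (G * H) x :: complex)"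
    by (rule int_form_quotient[OF forms_in_mult[OF F(1) H(1)] forms_in_mult[OF F(2) H(1)]])
  obtain x where x: "x \<in> P" by (rule proj_points_rep[OF nonvanishing_point[OF assms(2)]])
  have G'P: "mpeval of_int G' x \<noteq> 0" if "x \<in> P" for x
    using c H(2) bspec[OF bspec[OF FG W(2)] that] that by (simp add: eval of_rat_mpeval)
  have "f Q = mpeval of_int F' x / mpeval of_int G' x" if "Q \<in> U" "x \<in> Q" "mpeval of_int G' x \<noteq> 0" for Q x
  proof -
    have "mpeval of_rat H x \<noteq> 0" using that(3) by (auto simp: eval of_rat_mpeval)
    then have "Q \<in> basic_open I H"
      using nonvanishing_point[OF that(1)] form_nonzero_on_point[OF _ that(2) _ H(1), of _ of_rat] by auto
    then have "Q \<in> W" using H(3) by (rule subsetD[rotated])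
    then have "f Q = mpeval of_rat F x / mpeval of_rat G x" using bspec[OF bspec[OF FG] that(2)] by simp
    then show ?thesis using c \<open>mpeval of_rat H x \<noteq> 0\<close> by (simp add: eval of_rat_mpeval)
  qed
  moreover have "G' \<noteq> 0" using G'P[OF x] by (auto simp: comm_semiring_hom.mpeval_0[OF comm_semiring_hom_of_int])
  ultimately have "(F', G') \<in> local_pairs f" using F' by (auto simp: local_pairs_def)
  then show ?thesis using G'P by blast
qed

lemma proj_point_in_U:
  assumes "x \<in> coord_space I" "mpeval of_int h x \<noteq> (0::complex)"
  shows "proj_point x \<in> U"
proof -
  have "x \<noteq> (\<lambda>_. 0)" using assms(2) form_eval_0[OF h(1) D, of "of_int :: int \<Rightarrow> complex"] by auto
  then have "proj_point x \<in> proj_points I" using assms(1) by (auto simp: proj_points_def)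
  then show ?thesis
    using form_nonzero_on_point[OF _ proj_point_self _ h(1) assms(2)] by (simp add: nonvanishing_def)
qed

text \<open>The equation holds at all points where \<open>h * G * G'\<close> does not vanish, and a nonzero polynomial
  multiplied by \<open>h * G * G'\<close> does not vanish everywhere.\<close>

lemma local_pairs_cross:
  assumes "(F, G) \<in> local_pairs f" "(F', G') \<in> local_pairs f"
  shows "F * G' = F' * G"
proof (rule ccontr)
  assume ne: "F * G' \<noteq> F' * G"
  let ?p = "(F * G' - F' * G) * (h * (G * G'))"
  from assms have G: "G \<noteq> 0" "G' \<noteq> 0" "F \<in> polys_in I" "G \<in> polys_in I" "F' \<in> polys_in I" "G' \<in> polys_in I"
    by (auto simp: local_pairs_def forms_in_def)
  have "h \<noteq> 0" "h \<in> polys_in I" using h by (auto simp: irreducible_def forms_in_def)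
  then have "?p \<noteq> 0" "?p \<in> polys_in I" using ne G by (auto intro!: polys_in_mult polys_in_diff)
  then obtain x where x: "x \<in> coord_space I" "mpeval of_int ?p x \<noteq> (0::complex)"
    using nonzero_point[OF I] by blast
  then have nz: "mpeval of_int h x \<noteq> (0::complex)" "mpeval of_int G x \<noteq> (0::complex)" "mpeval of_int G' x \<noteq> (0::complex)"
    by (auto simp: of_int_mpeval)
  have "proj_point x \<in> U" using x(1) nz(1) by (rule proj_point_in_U)
  then have "f (proj_point x) = mpeval of_int F x / mpeval of_int G x"
    "f (proj_point x) = mpeval of_int F' x / mpeval of_int G' x"
    using assms nz proj_point_self[of x] unfolding local_pairs_def by blast+
  then have "mpeval of_int F x * mpeval of_int G' x = mpeval of_int F' x * (mpeval of_int G x :: complex)"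
    using nz by (simp add: field_simps)
  moreover have "mpeval of_int (F * G' - F' * G) x = mpeval of_int (F * G') x - (mpeval of_int (F' * G) x :: complex)"
  proof -
    interpret ev: comm_ring_hom "\<lambda>p. mpeval of_int p x :: complex"
      by (intro comm_ring_hom_mpeval comm_ring_hom_of_int)
    show ?thesis by (rule ev.hom_minus)
  qed
  ultimately show False using x(2) by (simp add: of_int_mpeval)
qed

text \<open>A denominator that is minimal with respect to division is a constant times a power of \<open>h\<close>, and
  therefore serves on the whole complement of \<open>h = 0\<close>.\<close>

lemma regular_global_quotient:
  assumes f: "f \<in> regular (proj_space I) U"
  obtains c :: int and F k where "c \<noteq> 0" "F \<in> forms_in I (k * D)"
    "\<forall>Q\<in>U. \<forall>x\<in>Q. f Q = mpeval of_int F x / (of_int c * mpeval of_int h x ^ k)"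
proof -
  have h0: "h \<noteq> 0" "h \<in> polys_in I" using h by (auto simp: irreducible_def forms_in_def)
  obtain x0 where "x0 \<in> coord_space I" "mpeval of_int h x0 \<noteq> (0::complex)"
    using nonzero_point[OF I h0(2,1)] by blast
  then have "proj_point x0 \<in> U" by (rule proj_point_in_U)
  from local_pair_exists[OF f this] have "snd ` local_pairs f \<noteq> {}" by auto
  then obtain G where G: "G \<in> snd ` local_pairs f"
    and min: "\<And>G'. (G', G) \<in> factor_order \<Longrightarrow> G' \<notin> snd ` local_pairs f"
    using wfE_min[OF wf_factor_order] by (metis all_not_in_conv)
  then obtain F where "(F, G) \<in> local_pairs f" by force
  moreover from this obtain n where "F \<in> forms_in I n" "G \<in> forms_in I n" "G \<noteq> 0"
    by (auto simp: local_pairs_def)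
  ultimately have FG: "(F, G) \<in> local_pairs f" "F \<in> forms_in I n" "G \<in> forms_in I n" "G \<noteq> 0" .
  have factor: "q dvd h \<or> q \<in> polys_in {}" if q: "Factorial_Ring.irreducible q" "q dvd G" for q
  proof -
    have q0: "q \<noteq> 0" "\<not> q dvd 1" and prime: "prime_elem q"
      using q irreducible_imp_prime_elem_mpoly by (auto simp: irreducible_def)
    obtain G' where G': "G = q * G'" using q(2) by (elim dvdE)
    have "\<not> q dvd F"
    proof
      assume "q dvd F"
      then obtain F' where F': "F = q * F'" by (elim dvdE)
      obtain k l where kl: "q \<in> forms_in I k" "G' \<in> forms_in I l" "k + l = n"
        using forms_in_factor[of q G' I n] FG(3,4) G' by metis
      have "F' \<in> forms_in I l"
      proof (cases "F = 0")
        case True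
        then show ?thesis using F' q0 by (simp add: forms_in_def)
      next
        case False
        obtain k' l' where "q \<in> forms_in I k'" "F' \<in> forms_in I l'" "k' + l' = n"
          using forms_in_factor[of q F' I n] FG(2) False F' by metis
        moreover have "k' = k" using calculation kl q0(1) whomog_unique by (metis forms_in_iff)
        moreover have "l' = l" using calculation(3,4) kl(3) by linarith
        ultimately show ?thesis by simp
      qed
      \<comment> \<open>At points where \<open>q\<close> vanishes but \<open>G'\<close> does not, the fraction \<open>F / G\<close> says nothing about \<open>f\<close>;
        another local representation does.\<close>
      have "f Q = mpeval of_int F' x / mpeval of_int G' x"
        if Q: "Q \<in> U" "x \<in> Q" "mpeval of_int G' x \<noteq> 0" for Q x
      proof -
        obtain F1 G1 where 1: "(F1, G1) \<in> local_pairs f" "mpeval of_int G1 x \<noteq> (0::complex)"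
          using local_pair_exists[OF f Q(1)] Q(2) by blast
        have "q * (F' * G1) = q * (F1 * G')"
          using local_pairs_cross[OF FG(1) 1(1)] by (simp add: F' G' algebra_simps)
        then have "F' * G1 = F1 * G'" using q0 by simp
        then have "mpeval of_int F' x * mpeval of_int G1 x = mpeval of_int F1 x * (mpeval of_int G' x :: complex)"
          by (metis of_int_mpeval(2))
        moreover have "f Q = mpeval of_int F1 x / mpeval of_int G1 x"
          using 1 Q unfolding local_pairs_def by blast
        ultimately have "mpeval of_int F' x * mpeval of_int G1 x = f Q * mpeval of_int G' x * mpeval of_int G1 x"
          using 1(2) by simp
        then show ?thesis using 1(2) Q(3) by (simp add: eq_divide_eq)
      qed
      then have "(F', G') \<in> local_pairs f"
        using kl \<open>F' \<in> forms_in I l\<close> FG(4) G' unfolding local_pairs_def by auto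
      moreover have "(G', G) \<in> factor_order"
        unfolding G' using q0 FG(4) G' by (intro proper_factor_less) auto
      ultimately show False using min by force
    qed
    \<comment> \<open>\<open>q\<close> divides all local denominators\<close>
    have nz: "mpeval of_int q x \<noteq> (0::complex)" if PU: "P \<in> U" and xP: "x \<in> P" for P x
    proof -
      obtain F1 G1 where 1: "(F1, G1) \<in> local_pairs f" "mpeval of_int G1 x \<noteq> (0::complex)"
        using local_pair_exists[OF f PU] xP by blast
      have "q dvd F * G1" using local_pairs_cross[OF FG(1) 1(1)] q(2) by simp
      then have "q dvd G1" using prime \<open>\<not> q dvd F\<close> by (simp add: prime_elem_dvd_mult_iff)
      then show ?thesis using 1(2) by (auto simp: of_int_mpeval elim!: dvdE)
    qed
    show ?thesis
    proof (cases "q \<in> polys_in {}")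
      case False
      then obtain v where v: "vdeg v q > 0" by (rule vdeg_pos_if_not_constant)
      have qI: "q \<in> polys_in I" using polys_in_dvd[OF q(2)] FG by (simp add: forms_in_def)
      have "q dvd h"
      proof (rule hypersurface_nullstellensatz[OF q(1) v I h0(2) qI])
        fix x :: "'v \<Rightarrow> complex" assume "x \<in> coord_space I" "mpeval of_int q x = 0"
        then show "mpeval of_int h x = 0" using nz[OF proj_point_in_U proj_point_self] by blast
      qed
      then show ?thesis ..
    qed simp
  qed
  have "\<exists>c k. G = Const c * h ^ k"
    using FG(4) factor
  proof (induction G rule: irreducible_factor_induct)
    case (unit u)
    then have "u \<in> polys_in {}" using polys_in_dvd[of u 1] by simp
    then obtain c where "u = Const c" by (auto simp: polys_in_empty_iff)
    then show ?case by (intro exI[of _ c] exI[of _ 0]) simp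
  next
    case (mult p G)
    then obtain c k where ck: "G = Const c * h ^ k" by (metis dvd_mult)
    have "p dvd h \<or> p \<in> polys_in {}" using mult by simp
    then show ?case
    proof
      assume "p dvd h"
      then obtain u where u: "h = p * u" by (elim dvdE)
      then have "u dvd 1" using h(2) mult(1) by (auto simp: irreducible_def)
      then obtain w where w: "1 = u * w" by (elim dvdE)
      then have "w \<in> polys_in {}" using polys_in_dvd[of w 1 "{}"] by (metis dvd_triv_right polys_in_1 zero_neq_one)
      then obtain b where b: "w = Const b" by (auto simp: polys_in_empty_iff)
      have "p = h * w" using w by (simp add: u mult.assoc)
      then have "p * G = Const (b * c) * h ^ Suc k"
        by (simp add: ck b mult_single[symmetric, where k = 0 and l = 0, simplified] algebra_simps)
      then show ?thesis by blast
    next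
      assume "p \<in> polys_in {}"
      then obtain b where b: "p = Const b" by (auto simp: polys_in_empty_iff)
      have "p * G = Const (b * c) * h ^ k"
        by (simp add: ck b mult.assoc[symmetric] mult_single)
      then show ?thesis by blast
    qed
  qed
  then obtain c k where ck: "G = Const c * h ^ k" by blast
  interpret ev: comm_ring_hom "\<lambda>p. mpeval of_int p x" for x :: "'v \<Rightarrow> complex"
    by (intro comm_ring_hom_mpeval comm_ring_hom_of_int)
  have c0: "c \<noteq> 0" using FG(4) ck by auto
  have evG: "mpeval of_int G x = of_int c * (mpeval of_int h x :: complex) ^ k" for x
    by (simp add: ck ev.hom_mult ev.hom_power comm_semiring_hom.mpeval_Const[OF comm_semiring_hom_of_int])
  have "whomog (\<lambda>_. 1) (0 + D * k) G"
    unfolding ck using h by (intro whomog_mult whomog_Const whomog_power) (simp add: forms_in_iff)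
  then have "n = k * D" using whomog_unique[of "\<lambda>_. 1" n G] FG by (simp add: forms_in_iff mult.commute)
  then show ?thesis
  proof (intro that[OF c0, of F k] ballI)
    fix Q x assume Q: "Q \<in> U" "x \<in> Q"
    then have "mpeval of_int G x \<noteq> (0::complex)" using c0 nonvanishing_nz[OF Q] by (simp add: evG)
    then show "f Q = mpeval of_int F x / (of_int c * mpeval of_int h x ^ k)"
      using FG(1) Q unfolding evG[symmetric] local_pairs_def by blast
  qed (use FG in simp)
qed

lemma monomial_form:
  assumes "Poly_Mapping.keys e \<subseteq> I"
  shows "Poly_Mapping.single e c \<in> forms_in I (mdeg e)"
  using assms by (auto simp: forms_in_def polys_in_def)

lemma monomial_quotient_eq:
  assumes e: "Poly_Mapping.keys e \<subseteq> I" "mdeg e = D" and P: "P \<in> U" "x \<in> P"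
  shows "monomial_quotient I h e P = mono_eval e x / mpeval of_int h x"
proof -
  have *: "mono_eval e y / mpeval of_int h y = mono_eval e x / mpeval of_int h x" if "y \<in> P" for y
    using form_quotient_on_point[of P I x y "Poly_Mapping.single e (1::int)" D h of_int of_int]
      monomial_form[OF e(1), of "1::int"] e P nonvanishing_point[OF P(1)] that h(1) by (simp add: mpeval_single)
  have "(\<lambda>x. mono_eval e x / mpeval of_int h x) ` P = (\<lambda>_. mono_eval e x / mpeval of_int h x) ` P"
    by (rule image_cong[OF refl]) (rule *)
  also have "\<dots> = {mono_eval e x / mpeval of_int h x}" using P(2) by blast
  finally show ?thesis using P by (simp add: monomial_quotient_def)
qed

abbreviation generators :: "(('v \<Rightarrow> complex) set \<Rightarrow> complex) set" where
  "generators \<equiv> {(\<lambda>P\<in>U. of_rat q) | q. True} \<union>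
    {monomial_quotient I h e | e. Poly_Mapping.keys e \<subseteq> I \<and> mdeg e = D}"

text \<open>Expand \<open>f = F / (c * h ^ k)\<close> into monomials and write each \<open>m / h ^ k\<close> as a product of \<open>k\<close> generators. The
  functions on projective points are handled through the expressions in homogeneous coordinates
  that they represent.\<close>

lemma regular_in_generators:
  assumes f: "f \<in> regular (proj_space I) U"
  shows "f \<in> generate_ring (fun_ring U) generators"
proof -
  let ?R = "generate_ring (fun_ring U) generators"
  \<comment> \<open>the expressions \<open>\<phi>\<close> in homogeneous coordinates that represent an element of the generated ring\<close>
  define rep where "rep = (\<lambda>\<phi>. \<exists>g\<in>?R. \<forall>Q\<in>U. \<forall>x\<in>Q. g Q = \<phi> x)"
  have rep_add: "rep (\<lambda>x. \<phi> x + \<psi> x)" if "rep \<phi>" "rep \<psi>" for \<phi> \<psi>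
  proof -
    from that obtain a b where "a \<in> ?R" "b \<in> ?R" "\<forall>Q\<in>U. \<forall>x\<in>Q. a Q = \<phi> x" "\<forall>Q\<in>U. \<forall>x\<in>Q. b Q = \<psi> x"
      unfolding rep_def by blast
    then show ?thesis unfolding rep_def
      by (intro bexI[of _ "a \<oplus>\<^bsub>fun_ring U\<^esub> b"]) (auto intro: generate_ring.eng_add simp del: fun_ring_simps, simp)
  qed
  have rep_mult: "rep (\<lambda>x. \<phi> x * \<psi> x)" if "rep \<phi>" "rep \<psi>" for \<phi> \<psi>
  proof -
    from that obtain a b where "a \<in> ?R" "b \<in> ?R" "\<forall>Q\<in>U. \<forall>x\<in>Q. a Q = \<phi> x" "\<forall>Q\<in>U. \<forall>x\<in>Q. b Q = \<psi> x"
      unfolding rep_def by blast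
    then show ?thesis unfolding rep_def
      by (intro bexI[of _ "a \<otimes>\<^bsub>fun_ring U\<^esub> b"]) (auto intro: generate_ring.eng_mult simp del: fun_ring_simps, simp)
  qed
  have rep_const: "rep (\<lambda>_. of_rat q)" for q
    unfolding rep_def by (intro bexI[of _ "\<lambda>P\<in>U. of_rat q"] generate_ring.incl) auto
  have rep_mono: "rep (\<lambda>x. mono_eval e x / mpeval of_int h x ^ k)"
    if "Poly_Mapping.keys e \<subseteq> I" "mdeg e = k * D" for e k
    using that
  proof (induction k arbitrary: e)
    case 0
    then have "e = 0" by (auto simp: mdeg_def in_keys_iff intro!: poly_mapping_eqI)
    then show ?case using rep_const[of 1] by simp
  next
    case (Suc k)
    then obtain e1 e2 where e: "e = e1 + e2" "mdeg e1 = D"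
      using monomial_split[of D e] by auto
    have keys: "Poly_Mapping.keys e1 \<subseteq> I" "Poly_Mapping.keys e2 \<subseteq> I"
      using Suc.prems(1) by (auto simp: e in_keys_iff lookup_add subset_iff)
    have "mdeg e2 = k * D" using Suc.prems e by (simp add: mdeg_eq_wdeg wdeg_add)
    then have "rep (\<lambda>x. mono_eval e2 x / mpeval of_int h x ^ k)" using Suc.IH keys by blast
    moreover have "rep (\<lambda>x. mono_eval e1 x / mpeval of_int h x)"
      unfolding rep_def using keys e
      by (intro bexI[of _ "monomial_quotient I h e1"] generate_ring.incl) (auto simp: monomial_quotient_eq)
    ultimately have "rep (\<lambda>x. (mono_eval e1 x / mpeval of_int h x) * (mono_eval e2 x / mpeval of_int h x ^ k))"
      by (intro rep_mult)
    then show ?case by (simp add: e mono_eval_add)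
  qed
  obtain c :: int and F k where F: "c \<noteq> 0" "F \<in> forms_in I (k * D)"
    and fF: "\<forall>Q\<in>U. \<forall>x\<in>Q. f Q = mpeval of_int F x / (of_int c * mpeval of_int h x ^ k)"
    by (rule regular_global_quotient[OF f])
  have "rep (\<lambda>x. \<Sum>m\<in>M. of_rat (of_int (Poly_Mapping.lookup F m) / of_int c) * (mono_eval m x / mpeval of_int h x ^ k))"
    if "M \<subseteq> Poly_Mapping.keys F" for M
    using that
  proof (induction M rule: infinite_finite_induct)
    case (insert m M)
    then have "Poly_Mapping.keys m \<subseteq> I" "mdeg m = k * D" using F(2) by (auto simp: forms_in_def polys_in_def)
    then have "rep (\<lambda>x. of_rat (of_int (Poly_Mapping.lookup F m) / of_int c) * (mono_eval m x / mpeval of_int h x ^ k))"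
      by (intro rep_mult rep_const rep_mono)
    moreover have "rep (\<lambda>x. \<Sum>m\<in>M. of_rat (of_int (Poly_Mapping.lookup F m) / of_int c) *
        (mono_eval m x / mpeval of_int h x ^ k))"
      using insert by blast
    ultimately show ?case unfolding sum.insert[OF insert(1,2)] by (rule rep_add)
  qed (use rep_const[of 0] in simp_all)
  from this[OF order_refl] obtain g where g: "g \<in> ?R"
    and gF: "\<And>Q x. Q \<in> U \<Longrightarrow> x \<in> Q \<Longrightarrow> g Q = (\<Sum>m\<in>Poly_Mapping.keys F. of_rat (of_int (Poly_Mapping.lookup F m) / of_int c) *
      (mono_eval m x / mpeval of_int h x ^ k))"
    unfolding rep_def by blast
  have "g \<in> extensional U"
    using g
  proof (induction rule: generate_ring.induct)
    case (a_inv f)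
    show ?case unfolding a_inv_fun_ring[OF a_inv(2)] by (rule restrict_extensional)
  next
    case (incl f)
    then show ?case by (auto simp: monomial_quotient_def)
  qed (unfold fun_ring_simps, (rule restrict_extensional)+)
  moreover have "f \<in> extensional U" using f unfolding regular_proj_iff by blast
  moreover have "f Q = g Q" if Q: "Q \<in> U" for Q
  proof -
    obtain x where x: "x \<in> Q" by (rule proj_points_rep[OF nonvanishing_point[OF Q]])
    have "g Q = mpeval of_int F x / (of_int c * mpeval of_int h x ^ k)"
      unfolding gF[OF Q x] mpeval_def[of of_int F] sum_divide_distrib
      by (intro sum.cong) (auto simp: of_rat_divide)
    then show ?thesis using bspec[OF bspec[OF fF Q] x] by simp
  qed
  ultimately have "f = g" by (intro extensionalityI[of f U g])
  with g show ?thesis by simp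
qed

text \<open>The functions that are locally quotients of forms of equal degree are closed under sums and
  products, and the generators are even globally such quotients.\<close>

lemma generators_regular:
  assumes "f \<in> generate_ring (fun_ring U) generators"
  shows "f \<in> regular (proj_space I) U"
proof -
  \<comment> \<open>\<open>f\<close> is a quotient of forms near \<open>P\<close>\<close>
  let ?loc = "\<lambda>f P. \<exists>W n F G. openin (proj_zar I) W \<and> P \<in> W \<and> W \<subseteq> U \<and> F \<in> forms_in I n \<and> G \<in> forms_in I n \<and>
       (\<forall>Q\<in>W. \<forall>x\<in>Q. mpeval of_rat G x \<noteq> 0 \<and> f Q = mpeval of_rat F x / mpeval of_rat G x)"
  have U_eq: "U = basic_open I (rat_poly h)" by (simp add: nonvanishing_def)
  have openU: "openin (proj_zar I) U"
    unfolding U_eq using h by (intro openin_basic_open) (simp add: rat_poly_form)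
  have const: "?loc (\<lambda>P\<in>U. of_rat q) P" if "P \<in> U" for q P
  proof (intro exI conjI)
    show "openin (proj_zar I) U" "P \<in> U" "U \<subseteq> U" using openU that by auto
    show "Const q \<in> forms_in I 0" "(Const 1 :: ('v, rat) mpoly) \<in> forms_in I 0" by (rule forms_in_Const)+
    show "\<forall>Q\<in>U. \<forall>x\<in>Q. mpeval of_rat (Const (1::rat)) x \<noteq> (0::complex) \<and>
        (\<lambda>P\<in>U. of_rat q) Q = mpeval of_rat (Const q) x / mpeval of_rat (Const (1::rat)) x"
      by (simp add: comm_semiring_hom.mpeval_Const[OF comm_semiring_hom_of_rat] del: single_one)
  qed
  have mult: "?loc (\<lambda>P\<in>U. f P * g P) P" if fg: "?loc f P" "?loc g P" for f g P
  proof -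
    from fg(1) obtain W n F G where 1: "openin (proj_zar I) W" "P \<in> W" "W \<subseteq> U" "F \<in> forms_in I n" "G \<in> forms_in I n"
       "\<And>Q x. Q\<in>W \<Longrightarrow> x\<in>Q \<Longrightarrow> mpeval of_rat G x \<noteq> 0 \<and> f Q = mpeval of_rat F x / mpeval of_rat G x" by metis
    from fg(2) obtain W' n' F' G' where 2: "openin (proj_zar I) W'" "P \<in> W'" "W' \<subseteq> U" "F' \<in> forms_in I n'" "G' \<in> forms_in I n'"
       "\<And>Q x. Q\<in>W' \<Longrightarrow> x\<in>Q \<Longrightarrow> mpeval of_rat G' x \<noteq> 0 \<and> g Q = mpeval of_rat F' x / mpeval of_rat G' x" by metis
    show ?thesis
    proof (intro exI conjI)
      show "openin (proj_zar I) (W \<inter> W')" "P \<in> W \<inter> W'" "W \<inter> W' \<subseteq> U" using 1 2 by auto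
      show "F * F' \<in> forms_in I (n + n')" "G * G' \<in> forms_in I (n + n')" using 1 2 by (auto intro: forms_in_mult)
      show "\<forall>Q\<in>W \<inter> W'. \<forall>x\<in>Q. mpeval of_rat (G * G') x \<noteq> 0 \<and>
          (\<lambda>P\<in>U. f P * g P) Q = mpeval of_rat (F * F') x / mpeval of_rat (G * G') x"
      proof (intro ballI)
        fix Q x assume Q: "Q \<in> W \<inter> W'" "x \<in> Q"
        then have "Q \<in> U" using 1(3) by blast
        then show "mpeval of_rat (G * G') x \<noteq> 0 \<and>
          (\<lambda>P\<in>U. f P * g P) Q = mpeval of_rat (F * F') x / mpeval of_rat (G * G') x"
          using 1(6)[of Q x] 2(6)[of Q x] Q by (simp add: of_rat_mpeval)
      qed
    qed
  qed
  have add: "?loc (\<lambda>P\<in>U. f P + g P) P" if fg: "?loc f P" "?loc g P" for f g P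
  proof -
    from fg(1) obtain W n F G where 1: "openin (proj_zar I) W" "P \<in> W" "W \<subseteq> U" "F \<in> forms_in I n" "G \<in> forms_in I n"
       "\<And>Q x. Q\<in>W \<Longrightarrow> x\<in>Q \<Longrightarrow> mpeval of_rat G x \<noteq> 0 \<and> f Q = mpeval of_rat F x / mpeval of_rat G x" by metis
    from fg(2) obtain W' n' F' G' where 2: "openin (proj_zar I) W'" "P \<in> W'" "W' \<subseteq> U" "F' \<in> forms_in I n'" "G' \<in> forms_in I n'"
       "\<And>Q x. Q\<in>W' \<Longrightarrow> x\<in>Q \<Longrightarrow> mpeval of_rat G' x \<noteq> 0 \<and> g Q = mpeval of_rat F' x / mpeval of_rat G' x" by metis
    show ?thesis
    proof (intro exI conjI)
      show "openin (proj_zar I) (W \<inter> W')" "P \<in> W \<inter> W'" "W \<inter> W' \<subseteq> U" using 1 2 by auto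
      show "F * G' + F' * G \<in> forms_in I (n + n')"
        using forms_in_mult[OF 1(4) 2(5)] forms_in_mult[OF 2(4) 1(5)]
        by (simp add: forms_in_add add.commute)
      show "G * G' \<in> forms_in I (n + n')" using 1 2 by (auto intro: forms_in_mult)
      show "\<forall>Q\<in>W \<inter> W'. \<forall>x\<in>Q. mpeval of_rat (G * G') x \<noteq> 0 \<and>
          (\<lambda>P\<in>U. f P + g P) Q = mpeval of_rat (F * G' + F' * G) x / mpeval of_rat (G * G') x"
      proof (intro ballI)
        fix Q x assume Q: "Q \<in> W \<inter> W'" "x \<in> Q"
        then have "Q \<in> U" using 1(3) by blast
        then show "mpeval of_rat (G * G') x \<noteq> 0 \<and>
          (\<lambda>P\<in>U. f P + g P) Q = mpeval of_rat (F * G' + F' * G) x / mpeval of_rat (G * G') x"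
          using 1(6)[of Q x] 2(6)[of Q x] Q by (simp add: of_rat_mpeval add_frac_eq)
      qed
    qed
  qed
  have mono: "?loc (monomial_quotient I h e) P" if "Poly_Mapping.keys e \<subseteq> I" "mdeg e = D" "P \<in> U" for e P
  proof (intro exI conjI)
    show "openin (proj_zar I) U" "P \<in> U" "U \<subseteq> U" using openU that by auto
    show "Poly_Mapping.single e 1 \<in> forms_in I D" using monomial_form that by blast
    show "rat_poly h \<in> forms_in I D" using h by (simp add: rat_poly_form)
    show "\<forall>Q\<in>U. \<forall>x\<in>Q. mpeval of_rat (rat_poly h) x \<noteq> 0 \<and>
      monomial_quotient I h e Q = mpeval of_rat (Poly_Mapping.single e 1) x / mpeval of_rat (rat_poly h) x"
      using that by (auto simp: monomial_quotient_eq mpeval_single dest: nonvanishing_nz)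
  qed
  have "f \<in> extensional U \<and> (\<forall>P\<in>U. ?loc f P)"
    using assms
  proof (induction rule: generate_ring.induct)
    case one
    show ?case unfolding fun_ring_simps using const[of _ 1, unfolded of_rat_1]
      by (intro conjI ballI restrict_extensional)
  next
    case (incl g)
    then show ?case using const mono by (auto simp: monomial_quotient_def)
  next
    case (a_inv g)
    have eq: "\<ominus>\<^bsub>fun_ring U\<^esub> g = (\<lambda>P\<in>U. (\<lambda>P\<in>U. of_rat (-1)) P * g P)"
      unfolding a_inv_fun_ring[OF conjunct1[OF a_inv(2)]] by (rule restrict_ext) simp
    show ?case unfolding eq
    proof (intro conjI ballI restrict_extensional)
      fix P assume P: "P \<in> U"
      show "?loc (\<lambda>P\<in>U. (\<lambda>P\<in>U. of_rat (-1)) P * g P) P"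
        by (rule mult[OF const[OF P] bspec[OF conjunct2[OF a_inv(2)] P]])
    qed
  next
    case (eng_add g g')
    show ?case unfolding fun_ring_simps
    proof (intro conjI ballI restrict_extensional)
      fix P assume P: "P \<in> U"
      show "?loc (\<lambda>P\<in>U. g P + g' P) P"
        by (rule add[OF bspec[OF conjunct2[OF eng_add(3)] P] bspec[OF conjunct2[OF eng_add(4)] P]])
    qed
  next
    case (eng_mult g g')
    show ?case unfolding fun_ring_simps
    proof (intro conjI ballI restrict_extensional)
      fix P assume P: "P \<in> U"
      show "?loc (\<lambda>P\<in>U. g P * g' P) P"
        by (rule mult[OF bspec[OF conjunct2[OF eng_mult(3)] P] bspec[OF conjunct2[OF eng_mult(4)] P]])
    qed
  qed
  then show ?thesis unfolding regular_proj_iff .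
qed

theorem regular_hypersurface_complement:
  "regular (proj_space I) U = generate_ring (fun_ring U) generators"
  using regular_in_generators generators_regular by blast

end

section \<open>Rescaling a conjugated tuple\<close>

lemma tuple_form_in_forms: "tuple_form N d a i \<in> forms_in {..N} d"
proof -
  have "Poly_Mapping.keys (tuple_form N d a i) \<subseteq> monomials N d"
    by (auto simp: in_keys_iff lookup_tuple_form split: if_splits)
  then show ?thesis by (auto simp: forms_in_def polys_in_def monomials_def)
qed

lemma tuple_form_scale: "tuple_form N d (\<lambda>v. c * a v) i = Const c * tuple_form N d a i"
  by (intro poly_mapping_eqI) (simp add: lookup_tuple_form lookup_Const_mult)

lemma mpeval_Const_scale:
  "mpeval Const (Const c * p) x = Const c * (mpeval Const p x :: ('v, 'c::comm_ring_1) mpoly)"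
  by (simp add: comm_semiring_hom.mpeval_mult[OF comm_semiring_hom_Const]
    comm_semiring_hom.mpeval_Const[OF comm_semiring_hom_Const])

lemma conj_tuple_scale:
  "conj_tuple N d \<alpha> (\<lambda>v. c * a v) = (\<lambda>v. c * conj_tuple N d \<alpha> a v)"
proof -
  have "conj_form N d \<alpha> (\<lambda>v. c * a v) i = Const c * conj_form N d \<alpha> a i" for i
    by (simp add: conj_form_def tuple_form_scale mpeval_Const_scale sum_distrib_left mult.left_commute)
  then show ?thesis by (auto simp: conj_tuple_def lookup_Const_mult fun_eq_iff)
qed

lemma mat_inverse_spec:
  fixes \<alpha> :: "'a::field mat"
  assumes "\<alpha> \<in> carrier_mat n n" "det \<alpha> \<noteq> 0"
  shows "\<alpha> * the (mat_inverse \<alpha>) = 1\<^sub>m n" "the (mat_inverse \<alpha>) * \<alpha> = 1\<^sub>m n"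
    "the (mat_inverse \<alpha>) \<in> carrier_mat n n"
proof -
  have "mat_inverse \<alpha> \<noteq> None"
    using mat_inverse(1)[OF assms(1), of "()"] det_non_zero_imp_unit[OF assms, of "()"] by blast
  then show "\<alpha> * the (mat_inverse \<alpha>) = 1\<^sub>m n" "the (mat_inverse \<alpha>) * \<alpha> = 1\<^sub>m n"
    "the (mat_inverse \<alpha>) \<in> carrier_mat n n"
    using mat_inverse(2)[OF assms(1)] by auto
qed

lemma mat_inverse_smult:
  fixes \<alpha> :: "'a::field mat"
  assumes \<alpha>: "\<alpha> \<in> carrier_mat n n" "det \<alpha> \<noteq> 0" and c: "c \<noteq> 0"
  shows "the (mat_inverse (c \<cdot>\<^sub>m \<alpha>)) = inverse c \<cdot>\<^sub>m the (mat_inverse \<alpha>)"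
proof -
  let ?A = "the (mat_inverse \<alpha>)" and ?B = "the (mat_inverse (c \<cdot>\<^sub>m \<alpha>))"
  note A = mat_inverse_spec[OF \<alpha>]
  have c\<alpha>: "c \<cdot>\<^sub>m \<alpha> \<in> carrier_mat n n" "det (c \<cdot>\<^sub>m \<alpha>) \<noteq> 0" using \<alpha> c by auto
  note B = mat_inverse_spec[OF c\<alpha>]
  have "(c \<cdot>\<^sub>m \<alpha>) * (inverse c \<cdot>\<^sub>m ?A) = c \<cdot>\<^sub>m (\<alpha> * (inverse c \<cdot>\<^sub>m ?A))"
    using \<alpha>(1) A(3) by (intro mult_smult_assoc_mat[of _ n n _ n]) auto
  also have "\<alpha> * (inverse c \<cdot>\<^sub>m ?A) = inverse c \<cdot>\<^sub>m (\<alpha> * ?A)"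
    using \<alpha>(1) A(3) by (intro mult_smult_distrib[of _ n n _ n]) auto
  also have "c \<cdot>\<^sub>m (inverse c \<cdot>\<^sub>m (\<alpha> * ?A)) = 1\<^sub>m n" using c by (intro eq_matI) (auto simp: A(1))
  finally have *: "(c \<cdot>\<^sub>m \<alpha>) * (inverse c \<cdot>\<^sub>m ?A) = 1\<^sub>m n" .
  have "?B = ?B * ((c \<cdot>\<^sub>m \<alpha>) * (inverse c \<cdot>\<^sub>m ?A))" using B(3) by (simp add: *)
  also have "\<dots> = (?B * (c \<cdot>\<^sub>m \<alpha>)) * (inverse c \<cdot>\<^sub>m ?A)"
    using B(3) c\<alpha>(1) A(3) by (intro assoc_mult_mat[symmetric]) auto
  also have "\<dots> = inverse c \<cdot>\<^sub>m ?A" using A(3) by (simp add: B(2))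
  finally show ?thesis .
qed

text \<open>The substitution of \<open>c \<cdot>\<^sub>m \<alpha>\<close> into forms of degree \<open>d\<close> contributes \<open>c ^ d\<close>, the inverse matrix
  \<open>c\<close> to the power \<open>- 1\<close>.\<close>

lemma conj_tuple_smult:
  assumes \<alpha>: "\<alpha> \<in> carrier_mat (N + 1) (N + 1)" "det \<alpha> \<noteq> 0" and c: "c \<noteq> 0" and d: "d \<ge> 1"
  shows "conj_tuple N d (c \<cdot>\<^sub>m \<alpha>) a = (\<lambda>v. c ^ (d - 1) * conj_tuple N d \<alpha> a v)"
proof -
  have lin: "linear_tuple N (c \<cdot>\<^sub>m \<alpha>) l = Const c * linear_tuple N \<alpha> l" if "l \<le> N" for l
    using that \<alpha> unfolding linear_tuple_def sum_distrib_left
    by (intro sum.cong) (auto simp: mult_single)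
  have sub: "mpeval Const (tuple_form N d a k) (linear_tuple N (c \<cdot>\<^sub>m \<alpha>)) =
      Const c ^ d * mpeval Const (tuple_form N d a k) (linear_tuple N \<alpha>)" for k
  proof -
    have "mpeval Const (tuple_form N d a k) (linear_tuple N (c \<cdot>\<^sub>m \<alpha>)) =
        mpeval Const (tuple_form N d a k) (\<lambda>l. Const c * linear_tuple N \<alpha> l)"
      using tuple_form_in_forms[of N d a k] by (intro mpeval_cong[of _ "{..N}"]) (auto simp: lin forms_in_def)
    also have "\<dots> = Const c ^ d * mpeval Const (tuple_form N d a k) (linear_tuple N \<alpha>)"
      by (rule form_eval_scale[OF tuple_form_in_forms])
    finally show ?thesis .
  qed
  have cd: "Const (inverse c) * Const c ^ d = (Const (c ^ (d - 1)) :: (nat, complex) mpoly)"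
  proof -
    interpret C: comm_semiring_hom "Const :: complex \<Rightarrow> (nat, complex) mpoly"
      by (rule comm_semiring_hom_Const)
    have "inverse c * c ^ d = c ^ (d - 1)" using c d by (cases d) auto
    then show ?thesis by (metis C.hom_mult C.hom_power)
  qed
  have "conj_form N d (c \<cdot>\<^sub>m \<alpha>) a i = Const (c ^ (d - 1)) * conj_form N d \<alpha> a i" if "i \<le> N" for i
    unfolding conj_form_def sum_distrib_left
  proof (rule sum.cong[OF refl])
    fix k assume "k \<in> {..N}"
    then have "the (mat_inverse (c \<cdot>\<^sub>m \<alpha>)) $$ (i, k) = inverse c * the (mat_inverse \<alpha>) $$ (i, k)"
      using that mat_inverse_spec(3)[OF \<alpha>] by (simp add: mat_inverse_smult[OF \<alpha> c])
    then show "Const (the (mat_inverse (c \<cdot>\<^sub>m \<alpha>)) $$ (i, k)) *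
        mpeval Const (tuple_form N d a k) (linear_tuple N (c \<cdot>\<^sub>m \<alpha>)) =
      Const (c ^ (d - 1)) * (Const (the (mat_inverse \<alpha>) $$ (i, k)) *
        mpeval Const (tuple_form N d a k) (linear_tuple N \<alpha>))"
      unfolding sub cd[symmetric] by (simp add: mult_single[of 0 _ 0, simplified, symmetric] mult_ac)
  qed
  then show ?thesis by (auto simp: conj_tuple_def lookup_Const_mult coeff_index_def fun_eq_iff)
qed

lemma SL_act_smult:
  assumes \<alpha>: "\<alpha> \<in> carrier_mat (N + 1) (N + 1)" "det \<alpha> \<noteq> 0" and c: "c \<noteq> 0" and d: "d \<ge> 1"
    and P: "P \<in> proj_points I"
  shows "SL_act N d (c \<cdot>\<^sub>m \<alpha>) P = SL_act N d \<alpha> P"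
proof -
  have eq: "conj_tuple N d (c \<cdot>\<^sub>m \<alpha>) a = conj_tuple N d \<alpha> (\<lambda>v. c ^ (d - 1) * a v)" for a
    by (simp add: conj_tuple_smult[OF \<alpha> c d] conj_tuple_scale)
  have scale: "(\<lambda>a v. e * a v) ` P = P" if "e \<noteq> 0" for e
  proof
    show "(\<lambda>a v. e * a v) ` P \<subseteq> P" using proj_points_scaled_mem[OF P _ that] by blast
    show "P \<subseteq> (\<lambda>a v. e * a v) ` P"
    proof
      fix x assume x: "x \<in> P"
      show "x \<in> (\<lambda>a v. e * a v) ` P"
      proof (rule image_eqI)
        show "x = (\<lambda>v. e * (inverse e * x v))" using that by (simp add: fun_eq_iff flip: mult.assoc)
        show "(\<lambda>v. inverse e * x v) \<in> P" using that x by (intro proj_points_scaled_mem[OF P]) auto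
      qed
    qed
  qed
  have "SL_act N d (c \<cdot>\<^sub>m \<alpha>) P = conj_tuple N d \<alpha> ` (\<lambda>a v. c ^ (d - 1) * a v) ` P"
    by (simp add: SL_act_def eq image_image)
  also have "\<dots> = SL_act N d \<alpha> P" using c by (simp add: scale SL_act_def)
  finally show ?thesis .
qed

lemma GL_det_nonzero:
  assumes "\<alpha> \<in> GL n"
  shows "det \<alpha> \<noteq> 0"
proof -
  from assms obtain \<beta> where \<alpha>: "\<alpha> \<in> carrier_mat n n" and 1: "\<alpha> * \<beta> = 1\<^sub>m n" and 2: "\<beta> * \<alpha> = 1\<^sub>m (dim_row \<beta>)"
    by (auto simp: GL_def invertible_mat_def inverts_mat_def)
  have "dim_col \<beta> = n" using arg_cong[OF 1, of dim_col] by simp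
  moreover have "dim_row \<beta> = n" using arg_cong[OF 2, of dim_col] \<alpha> by simp
  ultimately have "\<beta> \<in> carrier_mat n n" by auto
  then have "det \<alpha> * det \<beta> = 1" using \<alpha> 1 by (simp flip: det_mult)
  then show ?thesis by auto
qed

lemma SL_subset_GL: "SL n \<subseteq> GL n"
proof
  fix \<alpha> assume "\<alpha> \<in> SL n"
  then have \<alpha>: "\<alpha> \<in> carrier_mat n n" "det \<alpha> \<noteq> 0" by (auto simp: SL_def)
  note inv = mat_inverse_spec[OF \<alpha>]
  then have "invertible_mat \<alpha>"
    using \<alpha> by (auto simp: invertible_mat_def inverts_mat_def intro!: exI[of _ "the (mat_inverse \<alpha>)"])
  then show "\<alpha> \<in> GL n" using \<alpha> by (simp add: GL_def)
qed

lemma PGL_act_eq: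
  assumes "\<alpha> \<in> GL (N + 1)" "d \<ge> 1" "P \<in> proj_points I"
  shows "PGL_act N d {c \<cdot>\<^sub>m \<alpha> | c. c \<noteq> 0} P = SL_act N d \<alpha> P"
proof -
  have \<alpha>: "\<alpha> \<in> carrier_mat (N + 1) (N + 1)" "det \<alpha> \<noteq> 0"
    using assms(1) GL_det_nonzero by (auto simp: GL_def)
  have "PGL_act N d {c \<cdot>\<^sub>m \<alpha> | c. c \<noteq> 0} P = (\<Union>c\<in>{c. c \<noteq> 0}. SL_act N d (c \<cdot>\<^sub>m \<alpha>) P)"
    by (auto simp: PGL_act_def SL_act_def)
  also have "\<dots> = (\<Union>c\<in>{c::complex. c \<noteq> 0}. SL_act N d \<alpha> P)"
    by (intro SUP_cong refl SL_act_smult[OF \<alpha> _ assms(2,3)]) simp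
  also have "\<dots> = SL_act N d \<alpha> P"
  proof -
    have "(1::complex) \<in> {c. c \<noteq> 0}" by simp
    then show ?thesis by blast
  qed
  finally show ?thesis .
qed

text \<open>The scalar is a root of order \<open>N + 1\<close> of the inverse determinant.\<close>

lemma GL_normalize:
  assumes "\<alpha> \<in> GL (N + 1)"
  obtains c where "c \<noteq> 0" "c \<cdot>\<^sub>m \<alpha> \<in> SL (N + 1)"
proof -
  have \<alpha>: "\<alpha> \<in> carrier_mat (N + 1) (N + 1)" "det \<alpha> \<noteq> 0"
    using assms GL_det_nonzero by (auto simp: GL_def)
  obtain c where c: "c ^ (N + 1) = inverse (det \<alpha>)"
    using nth_root_exists[of "N + 1" "inverse (det \<alpha>)"] by auto
  have "c \<noteq> 0" using c \<alpha>(2) by auto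
  moreover have "c \<cdot>\<^sub>m \<alpha> \<in> SL (N + 1)" using \<alpha> c by (simp add: SL_def det_smult)
  ultimately show ?thesis by (rule that)
qed

lemma PGL_invariants_eq_SL_invariants:
  assumes "d \<ge> 1" "V \<subseteq> proj_points I"
  shows "invariants (PGL (N + 1)) (PGL_act N d) V = invariants (SL (N + 1)) (SL_act N d) V"
proof (intro equalityI subsetI)
  fix f assume f: "f \<in> invariants (PGL (N + 1)) (PGL_act N d) V"
  show "f \<in> invariants (SL (N + 1)) (SL_act N d) V"
    unfolding invariants_def
  proof (intro CollectI ballI)
    fix \<alpha> P assume \<alpha>: "\<alpha> \<in> SL (N + 1)" and P: "P \<in> V"
    then have GL: "\<alpha> \<in> GL (N + 1)" using SL_subset_GL by blast
    then have "{c \<cdot>\<^sub>m \<alpha> | c. c \<noteq> 0} \<in> PGL (N + 1)" unfolding PGL_def by (rule imageI)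
    then have "f (PGL_act N d {c \<cdot>\<^sub>m \<alpha> | c. c \<noteq> 0} P) = f P"
      using f P unfolding invariants_def by blast
    then show "f (SL_act N d \<alpha> P) = f P" using PGL_act_eq[OF GL assms(1)] P assms(2) by auto
  qed
next
  fix f assume f: "f \<in> invariants (SL (N + 1)) (SL_act N d) V"
  show "f \<in> invariants (PGL (N + 1)) (PGL_act N d) V"
    unfolding invariants_def
  proof (intro CollectI ballI)
    fix g P assume "g \<in> PGL (N + 1)" and P: "P \<in> V"
    then obtain \<alpha> where \<alpha>: "\<alpha> \<in> GL (N + 1)" "g = {c \<cdot>\<^sub>m \<alpha> | c. c \<noteq> 0}" by (auto simp: PGL_def)
    obtain c where c: "c \<noteq> 0" "c \<cdot>\<^sub>m \<alpha> \<in> SL (N + 1)" using \<alpha>(1) by (rule GL_normalize)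
    have PI: "P \<in> proj_points I" using P assms(2) by blast
    have "PGL_act N d g P = SL_act N d \<alpha> P" unfolding \<alpha>(2) by (rule PGL_act_eq[OF \<alpha>(1) assms(1) PI])
    also have "\<dots> = SL_act N d (c \<cdot>\<^sub>m \<alpha>) P"
      using \<alpha>(1) GL_det_nonzero[OF \<alpha>(1)]
      by (intro SL_act_smult[OF _ _ c(1) assms(1) PI, symmetric]) (auto simp: GL_def)
    finally show "f (PGL_act N d g P) = f P" using f c(2) P by (auto simp: invariants_def)
  qed
qed

section \<open>Functions on a geometric quotient\<close>

text \<open>The defining bijection between functions on open sets of the quotient and invariant functions on
  their preimages, taken on the whole space, where the ring operations are pointwise.\<close>

lemma quotient_coord_ring_iso:
  assumes "geometric_quotient G act X Y \<pi>"
  shows "pullback X \<pi> (points Y) \<in> ring_iso (coord_ring Y) (invariant_ring G act X)"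
proof -
  from assms have img: "\<pi> ` points X = points Y"
    and bij: "\<And>V. openin (zar Y) V \<Longrightarrow> bij_betw (pullback X \<pi> V) (regular Y V)
          (regular X (preim X \<pi> V) \<inter> invariants G act (preim X \<pi> V))"
    by (auto simp: geometric_quotient_def quotient_map_def)
  have pre: "preim X \<pi> (points Y) = points X" using img by (auto simp: preim_def)
  have \<pi>: "\<pi> x \<in> points Y" if "x \<in> points X" for x using img that by blast
  have bij': "bij_betw (pullback X \<pi> (points Y)) (regular Y (points Y)) (regular X (points X) \<inter> invariants G act (points X))"
    using bij[of "points Y"] by (simp add: pre)
  have "pullback X \<pi> (points Y) \<in> Ring.ring_hom (coord_ring Y) (invariant_ring G act X)"
  proof (rule ring_hom_memI)
    fix f assume "f \<in> carrier (coord_ring Y)"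
    then show "pullback X \<pi> (points Y) f \<in> carrier (invariant_ring G act X)"
      using bij' by (auto simp: coord_ring_def invariant_ring_def bij_betw_def)
  qed (auto simp: coord_ring_def invariant_ring_def fun_ring_def pullback_def pre \<pi> fun_eq_iff restrict_def)
  then show ?thesis using bij' by (simp add: ring_iso_def coord_ring_def invariant_ring_def)
qed

section \<open>Endomorphisms of projective space\<close>

lemma points_Hom_space: "points (Hom_space N d \<rho>) = nonvanishing (coeff_index N d) \<rho>"
  by (auto simp: Hom_space_def open_subspace_def proj_space_def nonvanishing_def)

theorem proposition2p3:
  fixes N d :: nat
    and \<rho> :: "(coeff_ix, int) mpoly"
  assumes "N \<ge> 1" and "d \<ge> 2"
    and "macaulay_resultant N d \<rho>"
  shows "coord_ring (Hom_space N d \<rho>) =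
           rat_subalgebra (points (Hom_space N d \<rho>))
             {mono_over_res N d \<rho> e | e.
                Poly_Mapping.keys e \<subseteq> coeff_index N d \<and> mdeg e = (N + 1) * d ^ N} \<and>
         (\<forall>(M :: 'q fspace) \<pi>.
           geometric_quotient (PGL (N + 1)) (PGL_act N d) (Hom_space N d \<rho>) M \<pi> \<longrightarrow>
           pullback (Hom_space N d \<rho>) \<pi> (points M) \<in>
             ring_iso (coord_ring M)
               (invariant_ring (SL (N + 1)) (SL_act N d) (Hom_space N d \<rho>)))"
proof (intro conjI allI impI)
  let ?I = "coeff_index N d"
  have d: "d \<ge> 1" using assms(2) by simp
  have "regular (proj_space ?I) (nonvanishing ?I \<rho>) = generate_ring (fun_ring (nonvanishing ?I \<rho>))
      ({(\<lambda>P\<in>nonvanishing ?I \<rho>. of_rat q) | q. True} \<union>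
       {monomial_quotient ?I \<rho> e | e. Poly_Mapping.keys e \<subseteq> ?I \<and> mdeg e = (N + 1) * d ^ N})"
    using d by (intro regular_hypersurface_complement resultant_degree[OF d assms(3)]
      res_irreducible[OF d assms(3)]) auto
  moreover have "mono_over_res N d \<rho> e = monomial_quotient ?I \<rho> e" for e
    unfolding mono_over_res_def monomial_quotient_def points_Hom_space ..
  moreover have "regular (Hom_space N d \<rho>) = regular (proj_space ?I)"
    by (simp add: Hom_space_def open_subspace_def)
  ultimately show "coord_ring (Hom_space N d \<rho>) =
           rat_subalgebra (points (Hom_space N d \<rho>))
             {mono_over_res N d \<rho> e | e. Poly_Mapping.keys e \<subseteq> ?I \<and> mdeg e = (N + 1) * d ^ N}"
    by (simp add: coord_ring_def rat_subalgebra_def points_Hom_space)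
  fix M :: "'q fspace" and \<pi>
  assume "geometric_quotient (PGL (N + 1)) (PGL_act N d) (Hom_space N d \<rho>) M \<pi>"
  from quotient_coord_ring_iso[OF this]
  have "pullback (Hom_space N d \<rho>) \<pi> (points M) \<in>
      ring_iso (coord_ring M) (invariant_ring (PGL (N + 1)) (PGL_act N d) (Hom_space N d \<rho>))" .
  moreover have "invariants (PGL (N + 1)) (PGL_act N d) (nonvanishing ?I \<rho>) =
      invariants (SL (N + 1)) (SL_act N d) (nonvanishing ?I \<rho>)"
    using d by (rule PGL_invariants_eq_SL_invariants) (auto dest: nonvanishing_point)
  ultimately show "pullback (Hom_space N d \<rho>) \<pi> (points M) \<in>
      ring_iso (coord_ring M) (invariant_ring (SL (N + 1)) (SL_act N d) (Hom_space N d \<rho>))"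
    by (simp only: invariant_ring_def points_Hom_space)
qed

end
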